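(* There is a universal constant $C>0$ such that the following holds. (a) For any $\varepsilon\in(0,1)$, under the condition $\kappa\le d\le\eta\log n$ and $p_{\max}\le n^{-1+\eta}$, with high probability both $$\max_{k\in[n^{1-\varepsilon}]}\Bigl|\lambda_k(A)-\sqrt{D_k^{\downarrow}}\Bigr|\le C\sqrt{n\,p_{\max}}+\varepsilon\sqrt{L_1}+d$$ and $$\max_{k\in[n^{1-\varepsilon}]}\Bigl|\lambda_{n+1-k}(A)+\sqrt{D_k^{\downarrow}}\Bigr|\le C\sqrt{n\,p_{\max}}+\varepsilon\sqrt{L_1}+d.$$ (b) Under the condition $\kappa\le d\le\eta\log n$ and $p_{\max}\le n^{-1+\eta}$, with high probability, for any $k\in[n]$, $$|\lambda_k(A)-\lambda_k(\mathbb E A)|\le C\bigl(\sqrt{L_1}+\sqrt{n\,p_{\max}}\bigr).$$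
   Context: Setting: $G$ is a random undirected graph on the vertex set $\{1,\dots,n\}$ (loops allowed) in which each edge $\{i,j\}$ (including $i=j$) is present with probability $p_{ij}=p_{ji}\in[0,1]$, independently of the others; $A$ is its adjacency matrix and $(\mathbb E A)_{ij}=p_{ij}$. Set $p_{\max}=\max_{i\ne j}p_{ij}$, $d_i=\sum_j p_{ij}$, $d=\max_i d_i$. The degree of $i$ is $D_i=\sum_j A_{ij}$, and $D_1^{\downarrow}\ge\dots\ge D_n^{\downarrow}$ are the degrees in decreasing order. For a Hermitian $n\times n$ matrix $H$, $\lambda_1(H)\ge\dots\ge\lambda_n(H)$ are its eigenvalues. For $x>0$, $[x]=\{1,2,\dots,\lfloor x\rfloor\}$. Set $$L_1=\frac{\log n}{\log((\log n)/d)}.$$ Parameters: $\kappa>0$ and $\eta\in(0,1)$. An admissible error function is a function $\psi(n,\kappa,\eta)$ such that for every $\kappa>0$, $\psi(n,\kappa,\eta)\to0$ as $n\to\infty$ and $\eta\to0$ (joint limit). "Under a condition $\mathcal A$ on the parameters $\kappa,\eta,(p_{ij})$, an event $E$ holds with high probability" means: there is an admissible error function $\psi$ with $\mathbb P(E)\ge1-\psi(n,\kappa,\eta)$ for all $n,\kappa,\eta,(p_{ij})_{i,j\in[n]}$ satisfying $\mathcal A$ ($\psi$ may depend on $\varepsilon$ in part (a), but not on $(p_{ij})$). In (b) the event is that the inequality holds simultaneously for all $k\in[n]$. *)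

theory Defs
  imports "HOL-Probability.Probability" "Jordan_Normal_Form.Char_Poly"
begin

text \<open>
  The vertex set \<open>{1,\<dots>,n}\<close> is represented by \<open>{..<n}\<close>, so vertices and matrix indices start
  at \<open>0\<close>. Ranks (of eigenvalues and of degrees) start at \<open>1\<close>.
\<close>

definition edge_probabilities :: "nat \<Rightarrow> (nat \<Rightarrow> nat \<Rightarrow> real) \<Rightarrow> bool" where
  "edge_probabilities n p \<longleftrightarrow> (\<forall>i<n. \<forall>j<n. p i j \<in> {0..1} \<and> p i j = p j i)"

text \<open>The undirected edge \<open>{i,j}\<close>, loops included, is encoded by the pair \<open>(min i j, max i j)\<close>.\<close>

definition edges :: "nat \<Rightarrow> (nat \<times> nat) set" where
  "edges n = {(i, j). i \<le> j \<and> j < n}"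

type_synonym graph = "nat \<times> nat \<Rightarrow> bool"

text \<open>The law of \<open>G\<close>: the product measure of the Bernoulli laws of the individual edges.\<close>

definition random_graph :: "nat \<Rightarrow> (nat \<Rightarrow> nat \<Rightarrow> real) \<Rightarrow> graph pmf" where
  "random_graph n p = Pi_pmf (edges n) False (\<lambda>(i, j). bernoulli_pmf (p i j))"

definition adjacency_matrix :: "nat \<Rightarrow> graph \<Rightarrow> real mat" where
  "adjacency_matrix n G = mat n n (\<lambda>(i, j). of_bool (G (min i j, max i j)))"

definition expected_adjacency_matrix :: "nat \<Rightarrow> (nat \<Rightarrow> nat \<Rightarrow> real) \<Rightarrow> real mat" where
  "expected_adjacency_matrix n p = mat n n (\<lambda>(i, j). p i j)"

lemma expectation_adjacency_matrix:
  assumes "edge_probabilities n p" "i < n" "j < n"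
  shows "measure_pmf.expectation (random_graph n p) (\<lambda>G. adjacency_matrix n G $$ (i, j))
           = expected_adjacency_matrix n p $$ (i, j)"
proof -
  let ?e = "(min i j, max i j)"
  have fin: "finite (edges n)"
    by (rule finite_subset[of _ "{..<n} \<times> {..<n}"]) (auto simp: edges_def)
  have e: "?e \<in> edges n"
    using assms by (auto simp: edges_def)
  have pe: "p (min i j) (max i j) = p i j" "p i j \<in> {0..1}"
    using assms by (auto simp: edge_probabilities_def min_def max_def)
  have "measure_pmf.expectation (random_graph n p) (\<lambda>G. adjacency_matrix n G $$ (i, j))
      = measure_pmf.expectation (map_pmf (\<lambda>G. G ?e) (random_graph n p)) (\<lambda>b. of_bool b)"
    using assms by (simp add: adjacency_matrix_def)
  also have "map_pmf (\<lambda>G. G ?e) (random_graph n p) = bernoulli_pmf (p i j)"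
    unfolding random_graph_def by (subst Pi_pmf_component[OF fin]) (use e pe in simp)
  also have "measure_pmf.expectation (bernoulli_pmf (p i j)) (\<lambda>b. of_bool b :: real) = p i j"
    using pe by simp
  finally show ?thesis
    using assms by (simp add: expected_adjacency_matrix_def)
qed

definition p_max :: "nat \<Rightarrow> (nat \<Rightarrow> nat \<Rightarrow> real) \<Rightarrow> real" where
  "p_max n p = Max {p i j | i j. i < n \<and> j < n \<and> i \<noteq> j}"

definition d_max :: "nat \<Rightarrow> (nat \<Rightarrow> nat \<Rightarrow> real) \<Rightarrow> real" where
  "d_max n p = (MAX i\<in>{..<n}. \<Sum>j<n. p i j)"

definition L1 :: "nat \<Rightarrow> (nat \<Rightarrow> nat \<Rightarrow> real) \<Rightarrow> real" where
  "L1 n p = ln (real n) / ln (ln (real n) / d_max n p)"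

definition vertex_degree :: "nat \<Rightarrow> graph \<Rightarrow> nat \<Rightarrow> real" where
  "vertex_degree n G i = (\<Sum>j<n. adjacency_matrix n G $$ (i, j))"

definition ordered_degree :: "nat \<Rightarrow> graph \<Rightarrow> nat \<Rightarrow> real" where
  "ordered_degree n G k = rev (sort (map (vertex_degree n G) [0..<n])) ! (k - 1)"

text \<open>
  Eigenvalues of a real symmetric matrix in decreasing order, repeated according to multiplicity.
  The characteristic polynomial of such a matrix splits over the reals, so the list below has
  length \<open>n\<close> for an \<open>n \<times> n\<close> matrix.
\<close>

definition ordered_eigenvalue :: "nat \<Rightarrow> real mat \<Rightarrow> real" where
  "ordered_eigenvalue k H = rev (sorted_list_of_multiset (proots (char_poly H))) ! (k - 1)"

definition admissible :: "(nat \<Rightarrow> real \<Rightarrow> real \<Rightarrow> real) \<Rightarrow> bool" where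
  "admissible \<psi> \<longleftrightarrow>
     (\<forall>\<kappa>>0. ((\<lambda>(n, \<eta>). \<psi> n \<kappa> \<eta>) \<longlongrightarrow> 0) (at_top \<times>\<^sub>F at_right 0))"

definition with_high_probability ::
  "(nat \<Rightarrow> real \<Rightarrow> real \<Rightarrow> (nat \<Rightarrow> nat \<Rightarrow> real) \<Rightarrow> bool) \<Rightarrow>
   (nat \<Rightarrow> (nat \<Rightarrow> nat \<Rightarrow> real) \<Rightarrow> graph \<Rightarrow> bool) \<Rightarrow> bool" where
  "with_high_probability \<A> E \<longleftrightarrow>
     (\<exists>\<psi>. admissible \<psi> \<and>
        (\<forall>n \<kappa> \<eta> p. n \<ge> 1 \<longrightarrow> \<kappa> > 0 \<longrightarrow> \<eta> \<in> {0<..<1} \<longrightarrow> edge_probabilities n p \<longrightarrow> \<A> n \<kappa> \<eta> p \<longrightarrow>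
           measure_pmf.prob (random_graph n p) {G. E n p G} \<ge> 1 - \<psi> n \<kappa> \<eta>))"

text \<open>
  Since \<open>\<kappa> > 0\<close>, this condition forces \<open>n \<ge> 2\<close>, so that the maxima in \<open>p_max\<close> and \<open>d_max\<close> are over
  nonempty sets, and \<open>ln (ln n / d) \<ge> ln (1 / \<eta>) > 0\<close>.
\<close>

definition sparsity_condition ::
  "nat \<Rightarrow> real \<Rightarrow> real \<Rightarrow> (nat \<Rightarrow> nat \<Rightarrow> real) \<Rightarrow> bool" where
  "sparsity_condition n \<kappa> \<eta> p \<longleftrightarrow>
     \<kappa> \<le> d_max n p \<and> d_max n p \<le> \<eta> * ln (real n) \<and> p_max n p \<le> real n powr (-1 + \<eta>)"

end

theory Submission
  imports Defs "HOL-Real_Asymp.Real_Asymp"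
begin

text \<open>
  Write \<open>A - E A\<close> as a sum over pairs \<open>i < j\<close> and test it against integer vectors (Kahn-Szemeredi,
  Feige-Ofek). Light couples are controlled by an exponential moment and a union bound; heavy couples
  by a discrepancy estimate for edge counts between sets together with a bound \<open>D \<ge> n p_max\<close> on the row sums.
  This yields \<open>\<parallel>A' - E A\<parallel> \<le> C sqrt D\<close> for every graph \<open>A'\<close> with row sums at most \<open>D\<close> obtained from \<open>A\<close> by
  deleting few edges.

  All degrees are at most \<open>3 L1\<close> with high probability, so \<open>A' = A\<close> and Weyl's inequality give (b).
  For (a) delete the star edges joining a vertex of degree at least \<open>\<delta> L1\<close> to neighbours that have no
  other such neighbour. With high probability each star misses only boundedly many neighbours of its
  centre, so that \<open>D = \<delta> L1 + n p_max\<close> is admissible for the rest, and the extreme eigenvalues of the disjoint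
  stars are plus or minus the square roots of their sizes. Finally \<open>\<delta>\<close> is chosen of order \<open>\<epsilon>\<^sup>2\<close>.
\<close>

subsection \<open>Eigenvalues of symmetric matrices\<close>

text \<open>The deleted edges depend on the graph, so a probability bound for a fixed matrix does
  not apply to the matrix left after deletion. The random events are therefore stated for the full
  graph, and the passage to a subgraph is deterministic: the discrepancy property is inherited by
  subgraphs, each deleted edge changes a light sum by at most \<open>sqrt D\<close>, and at most
  \<open>n\<close> edges may be deleted, which is harmless because the test vectors have squared
  norm of order \<open>n\<close>. Row sums matter only for heavy couples with very unbalanced
  coordinates. A vertex of large degree spoils the bound exactly there, which is why stars have to
  be split off. That D dominates n p_max is what controls the variance of light sums and the mean of
  edge counts. Forms are treated on the strict upper triangle, where different entries are different
  independent edges; the diagonal costs an additive 1. The summand d in (a) bounds the norm of the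
  mean matrix, and \<open>L1\<close> is the scale of the largest degrees: up to small corrections, a
  given vertex reaches degree \<delta> \<open>L1\<close> with probability at most
  n^(-\<delta>/2).\<close>

definition inprod :: "nat \<Rightarrow> (nat \<Rightarrow> real) \<Rightarrow> (nat \<Rightarrow> real) \<Rightarrow> real" where
  "inprod n x y = (\<Sum>i<n. x i * y i)"

definition mat_app :: "nat \<Rightarrow> (nat \<Rightarrow> nat \<Rightarrow> real) \<Rightarrow> (nat \<Rightarrow> real) \<Rightarrow> nat \<Rightarrow> real" where
  "mat_app n a x i = (\<Sum>j<n. a i j * x j)"

definition symm :: "nat \<Rightarrow> (nat \<Rightarrow> nat \<Rightarrow> 'a) \<Rightarrow> bool" where
  "symm n a \<longleftrightarrow> (\<forall>i<n. \<forall>j<n. a i j = a j i)"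

lemma sum_of_bool_eq_mult:
  fixes f :: "'a \<Rightarrow> 'b :: comm_semiring_1"
  assumes "finite B"
  shows "(\<Sum>i\<in>B. of_bool (i = j) * f i) = (if j \<in> B then f j else 0)"
    and "(\<Sum>i\<in>B. of_bool (j = i) * f i) = (if j \<in> B then f j else 0)"
proof -
  have "(\<Sum>i\<in>B. of_bool (i = j) * f i) = (\<Sum>i\<in>B. if i = j then f i else 0)"
    by (rule sum.cong) auto
  then show "(\<Sum>i\<in>B. of_bool (i = j) * f i) = (if j \<in> B then f j else 0)"
    using assms by simp
  have "(\<Sum>i\<in>B. of_bool (j = i) * f i) = (\<Sum>i\<in>B. if i = j then f i else 0)"
    by (rule sum.cong) auto
  then show "(\<Sum>i\<in>B. of_bool (j = i) * f i) = (if j \<in> B then f j else 0)"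
    using assms by simp
qed

lemma inprod_cong: "(\<And>i. i < n \<Longrightarrow> x i = x' i) \<Longrightarrow> (\<And>i. i < n \<Longrightarrow> y i = y' i) \<Longrightarrow> inprod n x y = inprod n x' y'"
  by (simp add: inprod_def)

lemma mat_app_cong: "(\<And>i. i < n \<Longrightarrow> x i = x' i) \<Longrightarrow> mat_app n a x = mat_app n a x'"
  by (simp add: mat_app_def fun_eq_iff)

lemma inprod_comm: "inprod n x y = inprod n y x"
  by (simp add: inprod_def mult.commute)

lemma inprod_scale_left: "inprod n (\<lambda>i. c * x i) y = c * inprod n x y"
  by (simp add: inprod_def sum_distrib_left mult.assoc)

lemma inprod_scale_right: "inprod n y (\<lambda>i. c * x i) = c * inprod n y x"
  by (simp add: inprod_def sum_distrib_left algebra_simps)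

lemma inprod_sum_left: "inprod n (\<lambda>i. \<Sum>b\<in>B. f b i) y = (\<Sum>b\<in>B. inprod n (f b) y)"
  unfolding inprod_def by (subst sum.swap) (simp add: sum_distrib_right)

lemma inprod_sum_right: "inprod n y (\<lambda>i. \<Sum>b\<in>B. f b i) = (\<Sum>b\<in>B. inprod n y (f b))"
  using inprod_sum_left[of n f B y] by (simp add: inprod_comm)

lemma inprod_nonneg: "0 \<le> inprod n x x"
  by (simp add: inprod_def sum_nonneg)

lemma inprod_pos: "i < n \<Longrightarrow> x i \<noteq> 0 \<Longrightarrow> 0 < inprod n x x"
  unfolding inprod_def by (rule sum_pos2[of _ i]) (auto simp: zero_less_mult_iff linorder_neq_iff)

lemma mat_app_scale: "mat_app n a (\<lambda>i. c * x i) i = c * mat_app n a x i"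
  by (simp add: mat_app_def sum_distrib_left algebra_simps)

lemma mat_app_sum: "mat_app n a (\<lambda>i. \<Sum>b\<in>B. f b i) i = (\<Sum>b\<in>B. mat_app n a (f b) i)"
  unfolding mat_app_def by (subst sum.swap) (simp add: sum_distrib_left)

lemma inprod_app_symm:
  assumes "symm n a"
  shows "inprod n x (mat_app n a y) = inprod n (mat_app n a x) y"
proof -
  have "inprod n x (mat_app n a y) = (\<Sum>i<n. \<Sum>j<n. x i * (a i j * y j))"
    by (simp add: inprod_def mat_app_def sum_distrib_left)
  also have "\<dots> = (\<Sum>j<n. \<Sum>i<n. a j i * x i * y j)"
    using assms by (subst sum.swap) (auto simp: symm_def intro!: sum.cong)
  also have "\<dots> = inprod n (mat_app n a x) y"
    by (simp add: inprod_def mat_app_def sum_distrib_right)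
  finally show ?thesis .
qed

text \<open>The characteristic polynomial has a complex root \<open>k\<close> with eigenvector
  \<open>z\<close>. The Hermitian form of \<open>z\<close> is its own conjugate, which forces
  \<open>k\<close> to be real; then the real and the imaginary part of \<open>z\<close> both satisfy
  the eigenvalue equation, and one of them is nonzero at \<open>i0\<close>.\<close>

lemma symm_eigenvector_exists:
  fixes a :: "nat \<Rightarrow> nat \<Rightarrow> real"
  assumes n: "n > 0" and sym: "symm n a"
  shows "\<exists>l v. inprod n v v = 1 \<and> (\<forall>i<n. mat_app n a v i = l * v i)"
proof -
  define A where "A = mat n n (\<lambda>(i, j). complex_of_real (a i j))"
  have A: "A \<in> carrier_mat n n" by (simp add: A_def)
  have "\<not> constant (poly (char_poly A))"
    using degree_monic_char_poly[OF A] n by (simp add: constant_degree)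
  then obtain k where "poly (char_poly A) k = 0"
    using fundamental_theorem_of_algebra by blast
  then have "eigenvalue A k"
    using eigenvalue_root_char_poly[OF A] by simp
  then obtain w where w: "w \<in> carrier_vec n" "w \<noteq> 0\<^sub>v n" "A *\<^sub>v w = k \<cdot>\<^sub>v w"
    using A by (auto simp: eigenvalue_def eigenvector_def)
  define z where "z i = w $ i" for i
  have ev: "(\<Sum>j<n. complex_of_real (a i j) * z j) = k * z i" if "i < n" for i
  proof -
    have "(A *\<^sub>v w) $ i = (k \<cdot>\<^sub>v w) $ i" by (simp add: w)
    then show ?thesis
      using that w(1) by (simp add: A_def z_def scalar_prod_def lessThan_atLeast0)
  qed
  obtain i0 where i0: "i0 < n" "z i0 \<noteq> 0"
    using w by (metis carrier_vecD eq_vecI index_zero_vec(1) index_zero_vec(2) z_def)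
  define N where "N = (\<Sum>i<n. (cmod (z i))\<^sup>2)"
  have N: "N > 0" unfolding N_def by (rule sum_pos2[of _ i0]) (use i0 in auto)
  define s where "s = (\<Sum>i<n. \<Sum>j<n. cnj (z i) * complex_of_real (a i j) * z j)"
  have "s = (\<Sum>i<n. cnj (z i) * (k * z i))"
    unfolding s_def by (intro sum.cong refl) (simp add: ev[symmetric] sum_distrib_left mult.assoc)
  also have "\<dots> = k * complex_of_real N"
    unfolding N_def of_real_sum sum_distrib_left
    by (intro sum.cong refl) (simp only: complex_norm_square mult_ac)
  finally have sk: "s = k * complex_of_real N" .
  have "cnj s = (\<Sum>i<n. \<Sum>j<n. cnj (z j) * complex_of_real (a i j) * z i)"
    by (simp add: s_def mult_ac)
  also have "\<dots> = s"
    unfolding s_def using sym by (subst sum.swap) (auto simp: symm_def intro!: sum.cong)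
  finally have "cnj k * complex_of_real N = k * complex_of_real N"
    by (simp add: sk)
  then have "cnj k = k" using N by simp
  then have k: "k = complex_of_real (Re k)"
    by (simp add: complex_eq_iff)
  have re: "mat_app n a (\<lambda>i. Re (z i)) i = Re k * Re (z i)" if "i < n" for i
    using arg_cong[OF ev[OF that], of Re] by (subst (asm) k) (simp add: mat_app_def)
  have im: "mat_app n a (\<lambda>i. Im (z i)) i = Re k * Im (z i)" if "i < n" for i
    using arg_cong[OF ev[OF that], of Im] by (subst (asm) k) (simp add: mat_app_def)
  have "\<exists>x. x i0 \<noteq> 0 \<and> (\<forall>i<n. mat_app n a x i = Re k * x i)"
  proof (cases "Re (z i0) = 0")
    case True
    then have "Im (z i0) \<noteq> 0" using i0 by (simp add: complex_eq_iff)
    then show ?thesis using im by (intro exI[of _ "\<lambda>i. Im (z i)"]) auto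
  next
    case False
    then show ?thesis using re by (intro exI[of _ "\<lambda>i. Re (z i)"]) auto
  qed
  then obtain x where x: "x i0 \<noteq> 0" "\<And>i. i < n \<Longrightarrow> mat_app n a x i = Re k * x i" by blast
  have pos: "inprod n x x > 0" using inprod_pos[OF i0(1)] x by simp
  define c where "c = 1 / sqrt (inprod n x x)"
  have "inprod n (\<lambda>i. c * x i) (\<lambda>i. c * x i) = 1"
    using pos unfolding inprod_scale_left inprod_scale_right by (simp add: c_def)
  moreover have "mat_app n a (\<lambda>i. c * x i) i = Re k * (c * x i)" if "i < n" for i
    using that x by (simp add: mat_app_scale)
  ultimately show ?thesis by blast
qed

text \<open>The reflection I - 2 w w^T / |w|^2 with w = v - e_0 exchanges the unit vectors v and
  e_0. It is the orthogonal change of coordinates by which the induction below peels off one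
  eigenvector.\<close>

lemma householder_exists:
  assumes n: "n > 0" and v: "inprod n v v = 1"
  shows "\<exists>h. symm n h \<and> (\<forall>x. \<forall>i<n. mat_app n h (mat_app n h x) i = x i) \<and>
    (\<forall>i<n. mat_app n h v i = of_bool (i = 0))"
proof -
  define w where "w i = v i - of_bool (i = 0)" for i
  define s where "s = inprod n w w"
  have e0: "inprod n (\<lambda>i. of_bool (i = 0)) x = x 0" for x
    using n by (simp add: inprod_def sum_of_bool_eq_mult)
  have wx: "inprod n w x = inprod n v x - x 0" for x
    using e0[of x] by (simp add: inprod_def w_def left_diff_distrib sum_subtractf)
  have wv: "inprod n w v = 1 - v 0" by (simp add: wx v)
  have s: "s = 2 * (1 - v 0)"
    unfolding s_def wx by (subst inprod_comm, subst wx) (simp add: v w_def)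
  \<comment> \<open>If v equals e_0 then \<open>s = 0\<close>, division by zero gives
    \<open>c = 0\<close>, and \<open>h\<close> is the identity, as it should be.\<close>
  define c where "c = 2 / s"
  define h where "h i j = of_bool (i = j) - c * w i * w j" for i j
  have h: "mat_app n h x i = x i - c * inprod n w x * w i" if "i < n" for x i
  proof -
    have "mat_app n h x i = (\<Sum>j<n. of_bool (i = j) * x j) - (\<Sum>j<n. c * w i * w j * x j)"
      by (simp add: mat_app_def h_def left_diff_distrib sum_subtractf)
    also have "(\<Sum>j<n. of_bool (i = j) * x j) = x i"
      using that by (simp add: sum_of_bool_eq_mult)
    finally show ?thesis by (simp add: inprod_def sum_distrib_left algebra_simps)
  qed
  have "mat_app n h (mat_app n h x) i = x i" if "i < n" for x i
  proof -
    have "inprod n w (mat_app n h x) = inprod n w (\<lambda>i. x i - c * inprod n w x * w i)"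
      by (rule inprod_cong) (auto simp: h)
    also have "\<dots> = inprod n w x - c * inprod n w x * s"
      unfolding s_def inprod_scale_right[symmetric] by (simp add: inprod_def right_diff_distrib sum_subtractf)
    finally have *: "inprod n w (mat_app n h x) = inprod n w x - c * inprod n w x * s" .
    have "mat_app n h (mat_app n h x) i = x i - c * (2 - c * s) * inprod n w x * w i"
      unfolding h[OF that, of "mat_app n h x"] h[OF that, of x] * by (simp add: algebra_simps)
    moreover have "c * (2 - c * s) = 0" by (simp add: c_def)
    ultimately show ?thesis by (simp only: mult_zero_left diff_zero)
  qed
  moreover have "mat_app n h v i = of_bool (i = 0)" if "i < n" for i
  proof (cases "s = 0")
    case True
    then have "w i = 0" using inprod_pos[OF that, of w] by (auto simp: s_def)
    then have "mat_app n h v i = v i" using that by (simp add: h)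
    with \<open>w i = 0\<close> show ?thesis unfolding w_def by linarith
  next
    case False
    then have "c * inprod n w v = 1" by (simp add: c_def wv s)
    then show ?thesis using that by (simp add: h w_def)
  qed
  moreover have "symm n h" by (auto simp: symm_def h_def)
  ultimately show ?thesis by blast
qed

text \<open>Conjugation by the reflection turns the eigenvector \<open>v0\<close> into the first
  unit vector. The conjugate \<open>T\<close> is symmetric, so it maps the orthogonal complement of
  that vector to itself, and the induction hypothesis applies to its restriction.\<close>

lemma symm_eigenbasis_exists:
  fixes a :: "nat \<Rightarrow> nat \<Rightarrow> real"
  assumes "symm n a"
  shows "\<exists>v l. (\<forall>b<n. \<forall>c<n. inprod n (v b) (v c) = of_bool (b = c)) \<and>
     (\<forall>b<n. \<forall>i<n. mat_app n a (v b) i = l b * v b i)"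
  using assms
proof (induction n arbitrary: a)
  case 0
  then show ?case by simp
next
  case (Suc n)
  let ?N = "Suc n"
  obtain l0 v0 where v0: "inprod ?N v0 v0 = 1" "\<And>i. i < ?N \<Longrightarrow> mat_app ?N a v0 i = l0 * v0 i"
    using symm_eigenvector_exists[of ?N a] Suc.prems by auto
  obtain h where h: "symm ?N h" "\<And>x i. i < ?N \<Longrightarrow> mat_app ?N h (mat_app ?N h x) i = x i"
    "\<And>i. i < ?N \<Longrightarrow> mat_app ?N h v0 i = of_bool (i = 0)"
    using householder_exists[of ?N v0] v0 by auto
  define T where "T x = mat_app ?N h (mat_app ?N a (mat_app ?N h x))" for x
  define e :: "nat \<Rightarrow> nat \<Rightarrow> real" where "e j i = of_bool (i = j)" for i j
  have inprod_e: "inprod ?N (e j) x = x j" if "j < ?N" for j x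
    using that by (simp add: inprod_def e_def sum_of_bool_eq_mult)
  have T_symm: "inprod ?N x (T y) = inprod ?N (T x) y" for x y
    by (simp add: T_def inprod_app_symm[OF h(1)] inprod_app_symm[OF Suc.prems])
  have T_cong: "T x = T y" if "\<And>i. i < ?N \<Longrightarrow> x i = y i" for x y
    unfolding T_def using mat_app_cong[of ?N x y] that by metis
  have T_e0: "T (e 0) i = l0 * e 0 i" if "i < ?N" for i
  proof -
    have 1: "mat_app ?N h (e 0) j = v0 j" if "j < ?N" for j
    proof -
      have "mat_app ?N h (e 0) = mat_app ?N h (mat_app ?N h v0)"
        by (rule mat_app_cong) (simp add: h(3) e_def)
      then show ?thesis using h(2) that by simp
    qed
    have "T (e 0) i = mat_app ?N h (\<lambda>i. l0 * v0 i) i"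
    proof -
      have "mat_app ?N a (mat_app ?N h (e 0)) = mat_app ?N a v0" by (rule mat_app_cong) (rule 1)
      moreover have "mat_app ?N h (mat_app ?N a v0) = mat_app ?N h (\<lambda>i. l0 * v0 i)"
        by (rule mat_app_cong) (rule v0(2))
      ultimately show ?thesis by (simp add: T_def)
    qed
    then show ?thesis using that by (simp add: mat_app_scale h(3) e_def)
  qed
  \<comment> \<open>The compression of \<open>T\<close> to the coordinates from 1 on, shifted down
    by one.\<close>
  define b where "b i j = T (e (Suc j)) (Suc i)" for i j
  have "symm n b"
    unfolding symm_def b_def
    by (metis T_symm Suc_less_eq inprod_comm inprod_e)
  then obtain v l where v: "\<And>b c. b < n \<Longrightarrow> c < n \<Longrightarrow> inprod n (v b) (v c) = of_bool (b = c)"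
    and l: "\<And>c i. c < n \<Longrightarrow> i < n \<Longrightarrow> mat_app n b (v c) i = l c * v c i"
    using Suc.IH[of b] by blast
  define u where "u c i = (case i of 0 \<Rightarrow> 0 | Suc i \<Rightarrow> v c i)" for c i
  have inprod_u: "inprod ?N (u c) (u d) = inprod n (v c) (v d)" for c d
    unfolding inprod_def sum.lessThan_Suc_shift by (simp add: u_def)
  have T_u: "T (u c) i = l c * u c i" if "c < n" "i < ?N" for c i
  proof (cases i)
    case 0
    \<comment> \<open>Moving \<open>T\<close> to the other side shows that \<open>T (u c)\<close>
      stays orthogonal to the eigenvector \<open>e 0\<close>.\<close>
    have "T (u c) 0 = inprod ?N (e 0) (T (u c))" by (simp add: inprod_e)
    also have "\<dots> = inprod ?N (\<lambda>i. l0 * e 0 i) (u c)"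
      unfolding T_symm by (rule inprod_cong) (simp_all add: T_e0)
    also have "\<dots> = 0" by (simp add: inprod_scale_left inprod_e u_def)
    finally show ?thesis using 0 by (simp add: u_def)
  next
    case (Suc i')
    have "T (u c) = T (\<lambda>i. \<Sum>j<n. v c j * e (Suc j) i)"
      by (rule T_cong)
        (auto simp: u_def e_def of_bool_def if_distrib split: nat.split cong: if_cong)
    also have "\<dots> = (\<lambda>i. \<Sum>j<n. v c j * T (e (Suc j)) i)"
      unfolding T_def mat_app_sum[abs_def] mat_app_scale[abs_def] by simp
    finally have "T (u c) i = mat_app n b (v c) i'"
      by (simp add: Suc b_def mat_app_def mult.commute)
    then show ?thesis using l that Suc by (simp add: u_def)
  qed
  define U where "U c = (case c of 0 \<Rightarrow> e 0 | Suc c \<Rightarrow> u c)" for c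
  define L where "L c = (case c of 0 \<Rightarrow> l0 | Suc c \<Rightarrow> l c)" for c
  have U_ip: "inprod ?N (U c) (U d) = of_bool (c = d)" if "c < ?N" "d < ?N" for c d
  proof -
    have "inprod ?N (u c) (e 0) = 0" for c by (subst inprod_comm) (simp add: inprod_e u_def)
    then show ?thesis
      using that by (auto simp: U_def inprod_e inprod_u v u_def e_def split: nat.split)
  qed
  have TU: "T (U c) i = L c * U c i" if "c < ?N" "i < ?N" for c i
    using that T_e0 T_u by (auto simp: U_def L_def split: nat.split)
  define V where "V c = mat_app ?N h (U c)" for c
  have "inprod ?N (V c) (V d) = of_bool (c = d)" if "c < ?N" "d < ?N" for c d
  proof -
    have "inprod ?N (V c) (V d) = inprod ?N (U c) (mat_app ?N h (mat_app ?N h (U d)))"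
      unfolding V_def by (simp add: inprod_app_symm[OF h(1)])
    also have "\<dots> = inprod ?N (U c) (U d)" by (rule inprod_cong) (simp_all add: h(2))
    finally show ?thesis using that U_ip by simp
  qed
  moreover have "mat_app ?N a (V c) i = L c * V c i" if "c < ?N" "i < ?N" for c i
  proof -
    have "mat_app ?N a (V c) i = mat_app ?N h (T (U c)) i"
      unfolding T_def V_def using that by (simp add: h(2))
    also have "\<dots> = mat_app ?N h (\<lambda>i. L c * U c i) i"
      by (rule arg_cong[where f = "\<lambda>f. f i"], rule mat_app_cong) (simp add: TU that)
    finally show ?thesis by (simp add: mat_app_scale V_def)
  qed
  ultimately show ?case by (intro exI[of _ V] exI[of _ L]) auto
qed

section \<open>Decreasing order and eigendecompositions\<close>

definition decreasing_perm :: "nat \<Rightarrow> (nat \<Rightarrow> real) \<Rightarrow> (nat \<Rightarrow> nat) \<Rightarrow> bool" where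
  "decreasing_perm n f \<pi> \<longleftrightarrow>
     bij_betw \<pi> {..<n} {..<n} \<and> (\<forall>b c. b \<le> c \<longrightarrow> c < n \<longrightarrow> f (\<pi> c) \<le> f (\<pi> b))"

lemma rev_sort_antimono:
  fixes l :: "nat \<Rightarrow> real"
  assumes "\<forall>b c. b \<le> c \<longrightarrow> c < n \<longrightarrow> l c \<le> l b"
  shows "rev (sort (map l [0..<n])) = map l [0..<n]"
proof -
  have "sorted (rev (map l [0..<n]))"
    using assms by (auto simp: sorted_iff_nth_mono rev_nth)
  then have "sort (map l [0..<n]) = rev (map l [0..<n])"
    by (intro properties_for_sort) auto
  then show ?thesis by simp
qed

lemma decreasing_perm_exists: "\<exists>\<pi>. decreasing_perm n f \<pi>"
proof -
  define xs where "xs = rev (sort_key f [0..<n])"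
  have xs: "distinct xs" "set xs = {..<n}" "length xs = n" by (auto simp: xs_def)
  have "sorted (map f (rev xs))" by (simp add: xs_def)
  then have "f (xs ! c) \<le> f (xs ! b)" if "b \<le> c" "c < n" for b c
    using that xs(3) sorted_nth_mono[of "map f (rev xs)" "n - 1 - c" "n - 1 - b"]
    by (auto simp: rev_nth)
  moreover have "bij_betw ((!) xs) {..<n} {..<n}"
    using xs bij_betw_nth[of xs "{..<n}" "{..<n}"] by (simp add: lessThan_def)
  ultimately show ?thesis
    unfolding decreasing_perm_def by (intro exI[of _ "(!) xs"]) auto
qed

lemma rev_sort_nth:
  assumes "decreasing_perm n f \<pi>" "k < n"
  shows "rev (sort (map f [0..<n])) ! k = f (\<pi> k)"
proof -
  have "mset (map \<pi> [0..<n]) = mset_set (\<pi> ` {..<n})"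
    using assms unfolding decreasing_perm_def bij_betw_def
    by (auto simp: image_mset_mset_set lessThan_atLeast0)
  also have "\<dots> = mset [0..<n]"
    using assms unfolding decreasing_perm_def bij_betw_def by (auto simp: lessThan_atLeast0)
  finally have "mset (map (\<lambda>i. f (\<pi> i)) [0..<n]) = mset (map f [0..<n])"
    by (metis (no_types, lifting) map_map mset_map o_def list.map_cong0)
  then have "sort (map f [0..<n]) = sort (map (\<lambda>i. f (\<pi> i)) [0..<n])"
    by (metis mset_sort properties_for_sort sorted_sort)
  then show ?thesis
    using assms rev_sort_antimono[of n "\<lambda>i. f (\<pi> i)"] by (auto simp: decreasing_perm_def)
qed

definition eigendecomposition ::
  "nat \<Rightarrow> (nat \<Rightarrow> nat \<Rightarrow> real) \<Rightarrow> (nat \<Rightarrow> nat \<Rightarrow> real) \<Rightarrow> (nat \<Rightarrow> real) \<Rightarrow> bool" where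
  "eigendecomposition n a v l \<longleftrightarrow>
     (\<forall>b<n. \<forall>c<n. inprod n (v b) (v c) = of_bool (b = c)) \<and>
     (\<forall>b<n. \<forall>i<n. mat_app n a (v b) i = l b * v b i) \<and>
     (\<forall>b c. b \<le> c \<longrightarrow> c < n \<longrightarrow> l c \<le> l b)"

lemma eigendecomposition_exists:
  assumes "symm n a"
  shows "\<exists>v l. eigendecomposition n a v l"
proof -
  obtain v l where v: "\<And>b c. b < n \<Longrightarrow> c < n \<Longrightarrow> inprod n (v b) (v c) = of_bool (b = c)"
    "\<And>b i. b < n \<Longrightarrow> i < n \<Longrightarrow> mat_app n a (v b) i = l b * v b i"
    using symm_eigenbasis_exists[OF assms] by blast
  obtain \<pi> where \<pi>: "decreasing_perm n l \<pi>" using decreasing_perm_exists by blast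
  have lt: "\<pi> b < n" if "b < n" for b
    using \<pi> that by (auto simp: decreasing_perm_def bij_betw_def)
  have inj: "\<pi> b = \<pi> c \<longleftrightarrow> b = c" if "b < n" "c < n" for b c
    using \<pi> that by (auto simp: decreasing_perm_def bij_betw_def inj_on_def)
  show ?thesis
    by (intro exI[of _ "\<lambda>b. v (\<pi> b)"] exI[of _ "\<lambda>b. l (\<pi> b)"])
      (use \<pi> in \<open>auto simp: eigendecomposition_def v lt inj decreasing_perm_def\<close>)
qed

text \<open>The first identity is orthonormality. The second is completeness of the basis; it
  follows because a left inverse of a square matrix is also a right inverse.\<close>

lemma eigendecomposition_matrix:
  assumes "eigendecomposition n a v l"
  shows "mat n n (\<lambda>(b, i). v b i) * mat n n (\<lambda>(i, b). v b i) = 1\<^sub>m n" (is "?Q * ?P = _")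
    and "mat n n (\<lambda>(i, b). v b i) * mat n n (\<lambda>(b, i). v b i) = 1\<^sub>m n"
proof -
  show 1: "?Q * ?P = 1\<^sub>m n"
    using assms by (intro eq_matI)
      (auto simp: eigendecomposition_def scalar_prod_def inprod_def lessThan_atLeast0)
  show "?P * ?Q = 1\<^sub>m n"
    by (rule mat_mult_left_right_inverse[OF _ _ 1]) auto
qed

lemma eigenbasis_complete:
  assumes e: "eigendecomposition n a v l" and i: "i < n"
  shows "x i = (\<Sum>b<n. inprod n x (v b) * v b i)"
proof -
  have vv: "(\<Sum>b<n. v b i * v b j) = of_bool (i = j)" if "j < n" for j
    using arg_cong[OF eigendecomposition_matrix(2)[OF e], of "\<lambda>A. A $$ (i, j)"] i that
    by (simp add: scalar_prod_def lessThan_atLeast0)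
  have "(\<Sum>b<n. inprod n x (v b) * v b i) = (\<Sum>j<n. x j * (\<Sum>b<n. v b i * v b j))"
    unfolding inprod_def sum_distrib_right sum_distrib_left by (subst sum.swap) (simp add: mult_ac)
  also have "\<dots> = (\<Sum>j<n. of_bool (i = j) * x j)"
    by (intro sum.cong refl) (subst vv, auto)
  finally show ?thesis using i by (simp add: sum_of_bool_eq_mult)
qed

lemma eigenbasis_forms:
  assumes e: "eigendecomposition n a v l"
  shows "inprod n x x = (\<Sum>b<n. (inprod n x (v b))\<^sup>2)"
    and "inprod n x (mat_app n a x) = (\<Sum>b<n. l b * (inprod n x (v b))\<^sup>2)"
proof -
  have *: "inprod n x y = inprod n (\<lambda>i. \<Sum>b<n. inprod n x (v b) * v b i) y" for y
    by (rule inprod_cong) (use eigenbasis_complete[OF e, of _ x] in auto)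
  show "inprod n x x = (\<Sum>b<n. (inprod n x (v b))\<^sup>2)"
    by (subst *) (simp add: inprod_sum_left inprod_scale_left power2_eq_square inprod_comm[of n "v _"])
  have "inprod n x (mat_app n a x) = inprod n x (mat_app n a (\<lambda>i. \<Sum>b<n. inprod n x (v b) * v b i))"
    by (rule arg_cong[where f = "inprod n x"], rule mat_app_cong) (rule eigenbasis_complete[OF e])
  also have "\<dots> = (\<Sum>b<n. inprod n x (v b) * inprod n x (mat_app n a (v b)))"
    unfolding mat_app_sum[abs_def] mat_app_scale[abs_def] inprod_sum_right inprod_scale_right ..
  also have "\<dots> = (\<Sum>b<n. l b * (inprod n x (v b))\<^sup>2)"
  proof (rule sum.cong)
    fix b assume "b \<in> {..<n}"
    then have "inprod n x (mat_app n a (v b)) = inprod n x (\<lambda>i. l b * v b i)"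
      using e by (intro inprod_cong) (auto simp: eigendecomposition_def)
    then show "inprod n x (v b) * inprod n x (mat_app n a (v b)) = l b * (inprod n x (v b))\<^sup>2"
      by (simp add: inprod_scale_right power2_eq_square)
  qed simp
  finally show "inprod n x (mat_app n a x) = (\<Sum>b<n. l b * (inprod n x (v b))\<^sup>2)" .
qed

abbreviation eigval :: "nat \<Rightarrow> nat \<Rightarrow> (nat \<Rightarrow> nat \<Rightarrow> real) \<Rightarrow> real" where
  "eigval k n a \<equiv> ordered_eigenvalue k (mat n n (\<lambda>(i, j). a i j))"

text \<open>The eigenbasis makes the matrix similar to a diagonal one, so the characteristic
  polynomial is the product of the linear factors of the \<open>l b\<close>, and the sorted roots
  are the list \<open>l\<close>. Ranks start at 1 and \<open>l\<close> at 0, hence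
  \<open>k - 1\<close>. From here on eigenvalues are handled through quadratic forms only.\<close>

lemma ordered_eigenvalue_eq:
  assumes e: "eigendecomposition n a v l" and k: "k \<in> {1..n}"
  shows "eigval k n a = l (k - 1)"
proof -
  define A where "A = mat n n (\<lambda>(i, j). a i j)"
  define P where "P = mat n n (\<lambda>(i, b). v b i)"
  define Q where "Q = mat n n (\<lambda>(b, i). v b i)"
  define D where "D = mat n n (\<lambda>(b, c). of_bool (b = c) * l b)"
  have carr: "A \<in> carrier_mat n n" "P \<in> carrier_mat n n" "Q \<in> carrier_mat n n" "D \<in> carrier_mat n n"
    by (simp_all add: A_def P_def Q_def D_def)
  have PQ: "P * Q = 1\<^sub>m n" "Q * P = 1\<^sub>m n"
    using eigendecomposition_matrix[OF e] by (simp_all add: P_def Q_def)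
  have "A * P = P * D"
  proof (rule eq_matI)
    fix i b assume "i < dim_row (P * D)" "b < dim_col (P * D)"
    then have ib: "i < n" "b < n" by (simp_all add: P_def D_def)
    have "(P * D) $$ (i, b) = (\<Sum>c<n. of_bool (c = b) * (v c i * l c))"
      using ib by (simp add: P_def D_def scalar_prod_def lessThan_atLeast0 mult_ac)
    also have "\<dots> = mat_app n a (v b) i"
      using ib e by (simp add: sum_of_bool_eq_mult eigendecomposition_def)
    also have "\<dots> = (A * P) $$ (i, b)"
      using ib by (simp add: A_def P_def scalar_prod_def mat_app_def lessThan_atLeast0)
    finally show "(A * P) $$ (i, b) = (P * D) $$ (i, b)" ..
  qed (simp_all add: A_def P_def D_def)
  then have "A = P * D * Q"
    using carr PQ by (metis assoc_mult_mat right_mult_one_mat)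
  then have "similar_mat A D"
    by (intro similar_matI[of _ _ P Q n]) (use carr PQ in auto)
  then have "char_poly A = char_poly D" by (rule char_poly_similar)
  also have "\<dots> = (\<Prod>x\<leftarrow>diag_mat D. [:- x, 1:])"
    by (rule char_poly_upper_triangular[OF carr(4)]) (auto simp: upper_triangular_def D_def)
  also have "diag_mat D = map l [0..<n]"
    by (auto simp: diag_mat_def D_def)
  finally have cp: "char_poly A = (\<Prod>x\<leftarrow>map l [0..<n]. [:- x, 1:])" .
  have "proots (\<Prod>x\<leftarrow>xs. [:- x, 1:]) = mset xs" for xs :: "real list"
  proof (induction xs)
    case (Cons x xs)
    have "(\<Prod>x\<leftarrow>xs. [:- x, 1:]) \<noteq> 0" by (auto simp: prod_list_zero_iff)
    then show ?case using Cons by (simp only: list.map prod_list.Cons) (subst proots_mult, auto)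
  qed simp
  then have "proots (char_poly A) = mset (map l [0..<n])"
    by (simp only: cp)
  then have "rev (sorted_list_of_multiset (proots (char_poly A))) = map l [0..<n]"
    using rev_sort_antimono[of n l] e
    by (simp add: eigendecomposition_def sorted_list_of_multiset_mset del: mset_map)
  then have "ordered_eigenvalue k A = map l [0..<n] ! (k - 1)"
    by (simp only: ordered_eigenvalue_def)
  also have "\<dots> = l (k - 1)"
    using k by (subst nth_map) auto
  finally show ?thesis by (simp only: A_def)
qed

text \<open>Negation reverses the order of the spectrum. Statements on the bottom eigenvalues
  thereby become statements on the top ones with a sign, which is the role of \<sigma> in the
  section on stars.\<close>

lemma eigval_uminus:
  assumes "symm n a" "k \<in> {1..n}"
  shows "eigval (n + 1 - k) n a = - eigval k n (\<lambda>i j. - a i j)"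
proof -
  obtain v l where e: "eigendecomposition n a v l"
    using eigendecomposition_exists[OF assms(1)] by blast
  have "mat_app n (\<lambda>i j. - a i j) x i = - mat_app n a x i" for x i
    by (simp add: mat_app_def sum_negf)
  then have "eigendecomposition n (\<lambda>i j. - a i j) (\<lambda>b. v (n - 1 - b)) (\<lambda>b. - l (n - 1 - b))"
    using e unfolding eigendecomposition_def by (auto simp: le_diff_conv)
  moreover have "n + 1 - k \<in> {1..n}" "n + 1 - k - 1 = n - 1 - (k - 1)" using assms(2) by auto
  ultimately show ?thesis
    using ordered_eigenvalue_eq[OF e] ordered_eigenvalue_eq[OF _ assms(2)] by simp
qed

lemma eigval_antimono:
  assumes "symm n a" "1 \<le> j" "j \<le> k" "k \<le> n"
  shows "eigval k n a \<le> eigval j n a"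
proof -
  obtain v l where e: "eigendecomposition n a v l"
    using eigendecomposition_exists[OF assms(1)] by blast
  show ?thesis
    using ordered_eigenvalue_eq[OF e, of j] ordered_eigenvalue_eq[OF e, of k] assms e
    by (auto simp: eigendecomposition_def)
qed

section \<open>Min-max principle and Weyl's inequality\<close>

lemma homogeneous_system_solution:
  fixes M :: "nat \<Rightarrow> 'a \<Rightarrow> real"
  assumes "finite K" "m < card K"
  shows "\<exists>c. (\<exists>a\<in>K. c a \<noteq> 0) \<and> (\<forall>b<m. (\<Sum>a\<in>K. M b a * c a) = 0)"
  using assms
proof (induction m arbitrary: K)
  case 0
  then show ?case by (intro exI[of _ "\<lambda>_. 1"]) (auto simp: card_gt_0_iff)
next
  case (Suc m)
  obtain c1 a1 where c1: "a1 \<in> K" "c1 a1 \<noteq> 0" "\<And>b. b < m \<Longrightarrow> (\<Sum>a\<in>K. M b a * c1 a) = 0"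
    using Suc.IH[of K] Suc.prems by auto
  define r1 where "r1 = (\<Sum>a\<in>K. M m a * c1 a)"
  have "card (K - {a1}) > m" using Suc.prems c1(1) by simp
  then obtain c2 a2 where c2: "a2 \<in> K - {a1}" "c2 a2 \<noteq> 0"
    "\<And>b. b < m \<Longrightarrow> (\<Sum>a\<in>K - {a1}. M b a * c2 a) = 0"
    using Suc.IH[of "K - {a1}"] Suc.prems by auto
  define c3 where "c3 a = (if a = a1 then 0 else c2 a)" for a
  have c3_sum: "(\<Sum>a\<in>K. M b a * c3 a) = (\<Sum>a\<in>K - {a1}. M b a * c2 a)" for b
    using Suc.prems(1) by (intro sum.mono_neutral_cong_right) (auto simp: c3_def)
  define r2 where "r2 = (\<Sum>a\<in>K. M m a * c3 a)"
  \<comment> \<open>Both \<open>c1\<close> and \<open>c3\<close> solve the first \<open>m\<close>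
    equations. Since \<open>c3\<close> vanishes at \<open>a1\<close> and \<open>c1\<close> does not,
    they are independent, so the combination that cancels the last equation can be seen to be
    nonzero.\<close>
  define c where "c a = r1 * c3 a - r2 * c1 a" for a
  have sum_c: "(\<Sum>a\<in>K. M b a * c a) = r1 * (\<Sum>a\<in>K. M b a * c3 a) - r2 * (\<Sum>a\<in>K. M b a * c1 a)" for b
    by (simp add: c_def sum_distrib_left sum_subtractf right_diff_distrib mult_ac)
  show ?case
  proof (cases "r1 = 0")
    case True
    then show ?thesis
      using c1 by (intro exI[of _ c1]) (auto simp: less_Suc_eq r1_def)
  next
    case r1: False
    have "(\<Sum>a\<in>K. M b a * c a) = 0" if "b < Suc m" for b
      using that c1(3) c2(3) by (cases "b = m") (auto simp: sum_c c3_sum r1_def[symmetric] r2_def)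
    moreover have "\<exists>a\<in>K. c a \<noteq> 0"
    proof (cases "r2 = 0")
      case True
      then show ?thesis using r1 c2 by (intro bexI[of _ a2]) (auto simp: c_def c3_def)
    next
      case False
      then show ?thesis using c1 by (intro bexI[of _ a1]) (auto simp: c_def c3_def)
    qed
    ultimately show ?thesis by blast
  qed
qed

text \<open>One half of Courant-Fischer: \<open>k - 1\<close> linear constraints leave a nonzero
  vector in the span of the first \<open>k\<close> eigenvectors, and on that span the form is at
  least the \<open>k\<close>-th eigenvalue times the squared norm.\<close>

lemma eigval_le_of_constraints:
  assumes sym: "symm n a" and k: "k \<in> {1..n}"
    and le: "\<And>x. (\<And>b. b < k - 1 \<Longrightarrow> inprod n (g b) x = 0) \<Longrightarrow> inprod n x (mat_app n a x) \<le> t * inprod n x x"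
  shows "eigval k n a \<le> t"
proof -
  obtain v l where e: "eigendecomposition n a v l"
    using eigendecomposition_exists[OF sym] by blast
  obtain c where c: "\<exists>b\<in>{..<k}. c b \<noteq> 0" "\<And>b. b < k - 1 \<Longrightarrow> (\<Sum>d<k. inprod n (g b) (v d) * c d) = 0"
    using homogeneous_system_solution[of "{..<k}" "k - 1" "\<lambda>b d. inprod n (g b) (v d)"] k by auto
  define x where "x i = (\<Sum>d<k. c d * v d i)" for i
  have xv: "inprod n x (v b) = (if b < k then c b else 0)" if "b < n" for b
  proof -
    have "inprod n x (v b) = (\<Sum>d<k. c d * inprod n (v d) (v b))"
      unfolding x_def inprod_sum_left inprod_scale_left ..
    also have "\<dots> = (\<Sum>d<k. of_bool (d = b) * c d)"
      using e k that by (intro sum.cong) (auto simp: eigendecomposition_def)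
    finally show ?thesis by (simp add: sum_of_bool_eq_mult)
  qed
  have "inprod n (g b) x = 0" if "b < k - 1" for b
    using c(2)[OF that] unfolding x_def inprod_sum_right inprod_scale_right by (simp add: mult.commute)
  then have "inprod n x (mat_app n a x) \<le> t * inprod n x x" by (rule le)
  moreover have "l (k - 1) * inprod n x x \<le> inprod n x (mat_app n a x)"
    unfolding eigenbasis_forms[OF e] sum_distrib_left
    using e k by (intro sum_mono) (auto simp: xv eigendecomposition_def mult_right_mono)
  moreover have "inprod n x x > 0"
  proof -
    from c(1) obtain b where "b < k" "c b \<noteq> 0" by auto
    then show ?thesis
      unfolding eigenbasis_forms[OF e] using k by (intro sum_pos2[of _ b]) (auto simp: xv)
  qed
  ultimately have "l (k - 1) \<le> t" by (smt (verit) mult_le_cancel_right)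
  then show ?thesis using ordered_eigenvalue_eq[OF e k] by simp
qed

text \<open>The dual half: some nontrivial combination of \<open>k\<close> vectors is orthogonal to
  the first \<open>k - 1\<close> eigenvectors. Linear independence of the family is hidden in the
  demand that every nontrivial combination have positive norm.\<close>

lemma eigval_ge_of_family:
  assumes sym: "symm n a" and k: "k \<in> {1..n}"
    and ge: "\<And>c x. \<exists>b<k. c b \<noteq> 0 \<Longrightarrow> x = (\<lambda>i. \<Sum>b<k. c b * f b i) \<Longrightarrow>
      0 < inprod n x x \<and> t * inprod n x x \<le> inprod n x (mat_app n a x)"
  shows "t \<le> eigval k n a"
proof -
  obtain v l where e: "eigendecomposition n a v l"
    using eigendecomposition_exists[OF sym] by blast
  obtain c where c: "\<exists>b\<in>{..<k}. c b \<noteq> 0" "\<And>b. b < k - 1 \<Longrightarrow> (\<Sum>d<k. inprod n (f d) (v b) * c d) = 0"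
    using homogeneous_system_solution[of "{..<k}" "k - 1" "\<lambda>b d. inprod n (f d) (v b)"] k by auto
  define x where "x = (\<lambda>i. \<Sum>d<k. c d * f d i)"
  have x0: "inprod n x (v b) = 0" if "b < k - 1" for b
    using c(2)[OF that] unfolding x_def inprod_sum_left inprod_scale_left by (simp add: mult.commute)
  have "0 < inprod n x x" "t * inprod n x x \<le> inprod n x (mat_app n a x)"
    using ge[of c x] c(1) x_def by auto
  moreover have "inprod n x (mat_app n a x) \<le> l (k - 1) * inprod n x x"
    unfolding eigenbasis_forms[OF e] sum_distrib_left
  proof (rule sum_mono)
    fix b assume "b \<in> {..<n}"
    then show "l b * (inprod n x (v b))\<^sup>2 \<le> l (k - 1) * (inprod n x (v b))\<^sup>2"
      using e x0[of b] by (cases "b < k - 1") (auto simp: eigendecomposition_def mult_right_mono)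
  qed
  ultimately have "t \<le> l (k - 1)" by (smt (verit) mult_le_cancel_right)
  then show ?thesis using ordered_eigenvalue_eq[OF e k] by simp
qed

text \<open>Apply the upper bound to the negated matrix at rank \<open>m + 1\<close>, which is rank
  \<open>n - m\<close> of the original one.\<close>

lemma eigval_ge_of_constraints:
  assumes sym: "symm n a" and m: "m < n"
    and ge: "\<And>x. (\<And>b. b < m \<Longrightarrow> inprod n (g b) x = 0) \<Longrightarrow> t * inprod n x x \<le> inprod n x (mat_app n a x)"
  shows "t \<le> eigval (n - m) n a"
proof -
  have neg: "mat_app n (\<lambda>i j. - a i j) x = (\<lambda>i. - mat_app n a x i)" for x
    by (simp add: mat_app_def sum_negf fun_eq_iff)
  have "eigval (m + 1) n (\<lambda>i j. - a i j) \<le> - t"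
  proof (rule eigval_le_of_constraints[where g = g])
    fix x assume "\<And>b. b < m + 1 - 1 \<Longrightarrow> inprod n (g b) x = 0"
    then have "t * inprod n x x \<le> inprod n x (mat_app n a x)" by (intro ge) auto
    then show "inprod n x (mat_app n (\<lambda>i j. - a i j) x) \<le> - t * inprod n x x"
      by (simp add: neg inprod_def sum_negf)
  qed (use sym m in \<open>auto simp: symm_def\<close>)
  then show ?thesis using eigval_uminus[OF sym, of "m + 1"] m by simp
qed

text \<open>Orthogonality to the first \<open>k - 1\<close> eigenvectors of \<open>b\<close> serves
  as the constraint: under it the form of \<open>b\<close> is at most its \<open>k\<close>-th
  eigenvalue times the squared norm, and the form of \<open>a\<close> differs by at most
  \<open>t\<close> times the squared norm.\<close>

lemma weyl_inequality:
  assumes sym: "symm n a" "symm n b" and k: "k \<in> {1..n}"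
    and le: "\<And>x. \<bar>inprod n x (mat_app n a x) - inprod n x (mat_app n b x)\<bar> \<le> t * inprod n x x"
  shows "\<bar>eigval k n a - eigval k n b\<bar> \<le> t"
proof -
  have *: "eigval k n a \<le> eigval k n b + t"
    if sym: "symm n a" "symm n b"
      and le: "\<And>x. inprod n x (mat_app n a x) \<le> inprod n x (mat_app n b x) + t * inprod n x x" for a b
  proof -
    obtain v l where e: "eigendecomposition n b v l"
      using eigendecomposition_exists[OF sym(2)] by blast
    show ?thesis
    proof (rule eigval_le_of_constraints[where g = v, OF sym(1) k])
      fix x assume x: "\<And>b. b < k - 1 \<Longrightarrow> inprod n (v b) x = 0"
      have "inprod n x (mat_app n b x) \<le> l (k - 1) * inprod n x x"
        unfolding eigenbasis_forms[OF e] sum_distrib_left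
      proof (rule sum_mono)
        fix b assume "b \<in> {..<n}"
        then show "l b * (inprod n x (v b))\<^sup>2 \<le> l (k - 1) * (inprod n x (v b))\<^sup>2"
          using e x[of b]
          by (cases "b < k - 1") (auto simp: eigendecomposition_def mult_right_mono inprod_comm)
      qed
      then show "inprod n x (mat_app n a x) \<le> (eigval k n b + t) * inprod n x x"
        using le[of x] ordered_eigenvalue_eq[OF e k] by (simp add: distrib_right)
    qed
  qed
  have "eigval k n a \<le> eigval k n b + t"
    by (rule *[OF sym]) (use le in \<open>smt (verit)\<close>)
  moreover have "eigval k n b \<le> eigval k n a + t"
    by (rule *[OF sym(2) sym(1)]) (use le in \<open>smt (verit)\<close>)
  ultimately show ?thesis by linarith
qed

subsection \<open>Exponential bounds for independent edges\<close>

lemma finite_edges [simp]: "finite (edges n)"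
  by (rule finite_subset[of _ "{..<n} \<times> {..<n}"]) (auto simp: edges_def)

definition edge_prob :: "(nat \<Rightarrow> nat \<Rightarrow> real) \<Rightarrow> nat \<times> nat \<Rightarrow> real" where
  "edge_prob p e = p (fst e) (snd e)"

lemma edge_prob_bounds:
  assumes "edge_probabilities n p" "e \<in> edges n"
  shows "0 \<le> edge_prob p e" "edge_prob p e \<le> 1"
  using assms by (auto simp: edge_probabilities_def edges_def edge_prob_def)

text \<open>Exponential Markov inequality combined with prescribed edges. The indicator of the event
  is dominated by a product over edges, an indicator for edges in \<open>F\<close> and an
  exponential for the others, whose expectation factorises by independence; then 1 + x \<le> exp x.
  Light sums and discrepancy use it with empty \<open>F\<close>, degree patterns with the edges of
  the pattern.\<close>

lemma prob_edge_exponential_bound: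
  fixes y :: "nat \<times> nat \<Rightarrow> real"
  assumes p: "edge_probabilities n p"
    and F: "F \<subseteq> edges n" "\<And>e. e \<in> F \<Longrightarrow> y e = 0"
    and Q: "\<And>G. Q G \<Longrightarrow> (\<forall>e\<in>F. G e) \<and> c \<le> (\<Sum>e\<in>edges n. y e * of_bool (G e))"
  shows "measure_pmf.prob (random_graph n p) {G. Q G} \<le>
    (\<Prod>e\<in>F. edge_prob p e) * exp ((\<Sum>e\<in>edges n. edge_prob p e * (exp (y e) - 1)) - c)"
proof -
  let ?E = "edges n" and ?M = "random_graph n p"
  define f where "f e b = (if e \<in> F then of_bool b else exp (y e * of_bool b))" for e b
  have f_nonneg: "0 \<le> f e b" for e b by (simp add: f_def)
  have finM: "finite (set_pmf ?M)"
    unfolding random_graph_def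
    by (subst set_Pi_pmf) (simp, rule finite_PiE_dflt, auto)
  have "measure_pmf.prob ?M {G. Q G} = measure_pmf.expectation ?M (indicat_real {G. Q G})"
    by simp
  also have "\<dots> \<le> measure_pmf.expectation ?M (\<lambda>G. (\<Prod>e\<in>?E. f e (G e)) * exp (- c))"
  proof (rule integral_mono)
    fix G
    show "indicat_real {G. Q G} G \<le> (\<Prod>e\<in>?E. f e (G e)) * exp (- c)"
    proof (cases "Q G")
      case True
      have "f e (G e) = exp (y e * of_bool (G e))" if "e \<in> ?E" for e
        using Q[OF True] F(2) that by (auto simp: f_def)
      then have "(\<Prod>e\<in>?E. f e (G e)) = exp (\<Sum>e\<in>?E. y e * of_bool (G e))"
        unfolding exp_sum[OF finite_edges] by (intro prod.cong) auto
      then show ?thesis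
        using True Q[OF True] by (simp flip: exp_add)
    next
      case False
      then show ?thesis by (simp add: prod_nonneg f_nonneg)
    qed
  qed (auto intro: integrable_measure_pmf_finite[OF finM])
  also have "\<dots> = measure_pmf.expectation ?M (\<lambda>G. \<Prod>e\<in>?E. f e (G e)) * exp (- c)"
    by simp
  also have "measure_pmf.expectation ?M (\<lambda>G. \<Prod>e\<in>?E. f e (G e)) =
      (\<Prod>e\<in>?E. measure_pmf.expectation (case e of (i, j) \<Rightarrow> bernoulli_pmf (p i j)) (f e))"
    unfolding random_graph_def
    by (rule expectation_prod_Pi_pmf) (auto simp: f_nonneg intro: integrable_measure_pmf_finite)
  also have "\<dots> \<le> (\<Prod>e\<in>?E. (if e \<in> F then edge_prob p e else 1) * exp (edge_prob p e * (exp (y e) - 1)))"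
  proof (rule prod_mono)
    fix e assume e: "e \<in> ?E"
    note b = edge_prob_bounds[OF p e]
    have "measure_pmf.expectation (case e of (i, j) \<Rightarrow> bernoulli_pmf (p i j)) (f e) =
        edge_prob p e * f e True + (1 - edge_prob p e) * f e False"
      using b by (simp add: edge_prob_def case_prod_beta)
    also have "\<dots> \<le> (if e \<in> F then edge_prob p e else 1) * exp (edge_prob p e * (exp (y e) - 1))"
    proof (cases "e \<in> F")
      case False
      have "edge_prob p e * exp (y e) + (1 - edge_prob p e) = 1 + edge_prob p e * (exp (y e) - 1)"
        by (simp add: algebra_simps)
      also have "\<dots> \<le> exp (edge_prob p e * (exp (y e) - 1))" by (rule exp_ge_add_one_self)
      finally show ?thesis using False by (simp add: f_def)
    qed (simp add: f_def F(2))
    finally have "measure_pmf.expectation (case e of (i, j) \<Rightarrow> bernoulli_pmf (p i j)) (f e) \<le>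
        (if e \<in> F then edge_prob p e else 1) * exp (edge_prob p e * (exp (y e) - 1))" .
    moreover have "0 \<le> measure_pmf.expectation (case e of (i, j) \<Rightarrow> bernoulli_pmf (p i j)) (f e)"
      by (intro integral_nonneg_AE AE_pmfI f_nonneg)
    ultimately show "0 \<le> measure_pmf.expectation (case e of (i, j) \<Rightarrow> bernoulli_pmf (p i j)) (f e) \<and>
        measure_pmf.expectation (case e of (i, j) \<Rightarrow> bernoulli_pmf (p i j)) (f e) \<le>
        (if e \<in> F then edge_prob p e else 1) * exp (edge_prob p e * (exp (y e) - 1))" by blast
  qed
  also have "(\<Prod>e\<in>?E. (if e \<in> F then edge_prob p e else 1) * exp (edge_prob p e * (exp (y e) - 1))) =
      (\<Prod>e\<in>F. edge_prob p e) * exp (\<Sum>e\<in>?E. edge_prob p e * (exp (y e) - 1))"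
    using F(1) by (simp add: prod.distrib exp_sum prod.inter_restrict[symmetric] Int_absorb1)
  finally show ?thesis by (simp add: exp_diff exp_minus field_simps)
qed

lemma prob_Un_le:
  "measure_pmf.prob M {G. P G \<or> Q G} \<le> measure_pmf.prob M {G. P G} + measure_pmf.prob M {G. Q G}"
  using measure_Un_le[of "{G. P G}" "measure_pmf M" "{G. Q G}"]
  by (simp add: Collect_disj_eq)

lemma prob_UNION_le:
  assumes "finite I" "\<And>i. i \<in> I \<Longrightarrow> measure_pmf.prob M {G. P i G} \<le> B i"
  shows "measure_pmf.prob M {G. \<exists>i\<in>I. P i G} \<le> (\<Sum>i\<in>I. B i)"
proof -
  have "measure_pmf.prob M {G. \<exists>i\<in>I. P i G} = measure_pmf.prob M (\<Union>i\<in>I. {G. P i G})"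
    by (rule arg_cong[where f = "measure_pmf.prob M"]) auto
  also have "\<dots> \<le> (\<Sum>i\<in>I. measure_pmf.prob M {G. P i G})"
    by (rule measure_pmf.finite_measure_subadditive_finite) (use assms in auto)
  also have "\<dots> \<le> (\<Sum>i\<in>I. B i)" by (rule sum_mono) (rule assms)
  finally show ?thesis .
qed

lemma sum_edges_upper:
  fixes f :: "nat \<Rightarrow> nat \<Rightarrow> real"
  shows "(\<Sum>i<n. \<Sum>j<n. if i < j then f i j else 0) = (\<Sum>e\<in>edges n. if fst e < snd e then f (fst e) (snd e) else 0)"
proof -
  have "(\<Sum>i<n. \<Sum>j<n. if i < j then f i j else 0) =
      (\<Sum>e\<in>{..<n} \<times> {..<n}. if fst e < snd e then f (fst e) (snd e) else 0)"
    by (simp add: sum.cartesian_product case_prod_beta)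
  also have "\<dots> = (\<Sum>e\<in>edges n. if fst e < snd e then f (fst e) (snd e) else 0)"
    by (rule sum.mono_neutral_right) (auto simp: edges_def)
  finally show ?thesis .
qed

section \<open>Light couples\<close>

lemma exp_le_quadratic:
  fixes y :: real
  assumes "\<bar>y\<bar> \<le> 1"
  shows "exp y \<le> 1 + y + y\<^sup>2"
proof (cases "0 \<le> y")
  case True
  then show ?thesis using exp_bound[of y] assms by simp
next
  case False
  define x where "x = - y"
  have x: "0 \<le> x" using False by (simp add: x_def)
  \<comment> \<open>For negative arguments the claim is multiplied by exp x, which is then bounded
    below by its quadratic Taylor polynomial.\<close>
  have "1 \<le> (1 - x + x\<^sup>2) * (1 + x + x\<^sup>2 / 2)"
  proof -
    have "(1 - x + x\<^sup>2) * (1 + x + x\<^sup>2 / 2) = 1 + (x ^ 2 + x ^ 3 + x ^ 4) / 2"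
      by (simp add: field_simps power2_eq_square power3_eq_cube power4_eq_xxxx)
    then show ?thesis using x by simp
  qed
  also have "\<dots> \<le> (1 - x + x\<^sup>2) * exp x"
  proof (rule mult_left_mono)
    show "1 + x + x\<^sup>2 / 2 \<le> exp x" using exp_lower_Taylor_quadratic[OF x] by simp
    show "0 \<le> 1 - x + x\<^sup>2" using assms by (simp add: x_def)
  qed
  finally have "exp (- x) \<le> 1 - x + x\<^sup>2"
    by (simp add: exp_minus field_simps)
  then show ?thesis by (simp add: x_def)
qed

text \<open>In a symmetric matrix every edge occurs twice. The strict upper triangle keeps one copy,
  so that distinct entries are independent, and leaves the loops aside.\<close>

definition upper :: "graph \<Rightarrow> nat \<Rightarrow> nat \<Rightarrow> real" where
  "upper G i j = (if i < j then of_bool (G (i, j)) else 0)"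

definition upper_mean :: "(nat \<Rightarrow> nat \<Rightarrow> real) \<Rightarrow> nat \<Rightarrow> nat \<Rightarrow> real" where
  "upper_mean p i j = (if i < j then p i j else 0)"

definition grid :: "nat \<Rightarrow> (nat \<Rightarrow> int) set" where
  "grid n = {z. (\<Sum>i<n. (real_of_int (z i))\<^sup>2) \<le> 4 * real n}"

text \<open>Light couples are the pairs with \<open>\<bar>z\<^sub>i w\<^sub>j\<bar> \<le> sqrt D\<close>. Test vectors are not normalised: the integer
  vectors of \<open>grid n\<close> are \<open>sqrt n\<close> times the points of a net of the ball of radius 2.\<close>

definition light_sum :: "nat \<Rightarrow> (nat \<Rightarrow> nat \<Rightarrow> real) \<Rightarrow> real \<Rightarrow> graph \<Rightarrow> (nat \<Rightarrow> int) \<Rightarrow> (nat \<Rightarrow> int) \<Rightarrow> real" where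
  "light_sum n p D G z w = (\<Sum>i<n. \<Sum>j<n.
     if \<bar>real_of_int (z i) * real_of_int (w j)\<bar> \<le> sqrt D
     then (upper G i j - upper_mean p i j) * (real_of_int (z i) * real_of_int (w j)) else 0)"

lemma sum_half_power_abs:
  "(\<Sum>k\<in>{- int m..int m}. (1 / 2 :: real) ^ nat \<bar>k\<bar>) = 3 - 2 * (1 / 2) ^ m"
proof (induction m)
  case (Suc m)
  have "{- int (Suc m)..int (Suc m)} = insert (- int (Suc m)) (insert (int (Suc m)) {- int m..int m})"
    by auto
  then have "(\<Sum>k\<in>{- int (Suc m)..int (Suc m)}. (1 / 2 :: real) ^ nat \<bar>k\<bar>) =
      2 * (1 / 2) ^ Suc m + (\<Sum>k\<in>{- int m..int m}. (1 / 2) ^ nat \<bar>k\<bar>)"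
    by (simp add: nat_add_distrib)
  then show ?case using Suc by simp
qed simp

text \<open>Each grid point has weight exp (4n - |z|^2) \<ge> 1, so the total weight bounds the
  number of points. The sum over a box factorises into one-dimensional sums, each at most 3 \<le>
  exp 2, and 4 + 2 = 6. The box itself is crude and only provides finiteness.\<close>

lemma card_grid:
  "finite (grid n \<inter> ({..<n} \<rightarrow>\<^sub>E UNIV))"
  "real (card (grid n \<inter> ({..<n} \<rightarrow>\<^sub>E UNIV))) \<le> exp (6 * real n)"
proof -
  let ?Z = "grid n \<inter> ({..<n} \<rightarrow>\<^sub>E UNIV)"
  let ?R = "{- int (2 * n)..int (2 * n)}"
  have sub: "?Z \<subseteq> {..<n} \<rightarrow>\<^sub>E ?R"
  proof
    fix z assume z: "z \<in> ?Z"
    have "z i \<in> ?R" if "i < n" for i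
    proof -
      have "(real_of_int (z i))\<^sup>2 \<le> (\<Sum>i<n. (real_of_int (z i))\<^sup>2)"
        by (rule member_le_sum) (use that in auto)
      also have "\<dots> \<le> 4 * real n" using z by (simp add: grid_def)
      also have "\<dots> \<le> (2 * real n)\<^sup>2" using that by (simp add: power2_eq_square)
      finally have "\<bar>real_of_int (z i)\<bar> \<le> \<bar>2 * real n\<bar>"
        by (simp only: abs_le_square_iff)
      then show ?thesis by (auto simp: abs_le_iff)
    qed
    then show "z \<in> {..<n} \<rightarrow>\<^sub>E ?R" using z by (auto simp: PiE_iff)
  qed
  have fin: "finite ({..<n} \<rightarrow>\<^sub>E ?R)" by (simp add: finite_PiE)
  show "finite ?Z" by (rule finite_subset[OF sub fin])
  have g: "exp (- (real_of_int k)\<^sup>2) \<le> (1 / 2) ^ nat \<bar>k\<bar>" for k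
  proof -
    have "real (nat \<bar>k\<bar>) \<le> (real_of_int k)\<^sup>2"
    proof (cases "k = 0")
      case False
      then have "1 * \<bar>k\<bar> \<le> \<bar>k\<bar> * \<bar>k\<bar>" by (intro mult_right_mono) auto
      then have "real_of_int \<bar>k\<bar> \<le> real_of_int (\<bar>k\<bar> * \<bar>k\<bar>)" by (simp only: of_int_le_iff)
      then show ?thesis by (simp add: power2_eq_square)
    qed simp
    then have "exp (- (real_of_int k)\<^sup>2) \<le> exp (- 1) ^ nat \<bar>k\<bar>"
      by (simp flip: exp_of_nat_mult)
    also have "\<dots> \<le> (1 / 2) ^ nat \<bar>k\<bar>"
      using exp_ge_add_one_self[of 1] by (intro power_mono) (auto simp: exp_minus field_simps)
    finally show ?thesis .
  qed
  have "real (card ?Z) = (\<Sum>z\<in>?Z. 1)" by simp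
  also have "\<dots> \<le> (\<Sum>z\<in>?Z. exp (4 * real n) * (\<Prod>i<n. exp (- (real_of_int (z i))\<^sup>2)))"
  proof (rule sum_mono)
    fix z assume "z \<in> ?Z"
    then show "1 \<le> exp (4 * real n) * (\<Prod>i<n. exp (- (real_of_int (z i))\<^sup>2))"
      by (simp add: grid_def sum_negf flip: exp_sum exp_add)
  qed
  also have "\<dots> \<le> (\<Sum>z\<in>{..<n} \<rightarrow>\<^sub>E ?R. exp (4 * real n) * (\<Prod>i<n. exp (- (real_of_int (z i))\<^sup>2)))"
    by (rule sum_mono2[OF fin sub]) (intro mult_nonneg_nonneg prod_nonneg exp_ge_zero)
  also have "\<dots> = exp (4 * real n) * (\<Prod>i<n. \<Sum>k\<in>?R. exp (- (real_of_int k)\<^sup>2))"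
    unfolding sum_distrib_left[symmetric] by (subst prod_sum_PiE) simp_all
  also have "\<dots> \<le> exp (4 * real n) * (\<Prod>i<n. exp 2)"
  proof (intro mult_left_mono prod_mono conjI)
    have "(\<Sum>k\<in>?R. exp (- (real_of_int k)\<^sup>2)) \<le> (\<Sum>k\<in>?R. (1 / 2) ^ nat \<bar>k\<bar>)"
      by (rule sum_mono) (rule g)
    also have "\<dots> \<le> 3" by (subst sum_half_power_abs) simp
    also have "\<dots> \<le> exp 2" using exp_ge_add_one_self[of 2] by simp
    finally show "(\<Sum>k\<in>?R. exp (- (real_of_int k)\<^sup>2)) \<le> exp 2" .
  qed (auto intro!: sum_nonneg)
  also have "\<dots> = exp (6 * real n)" by (simp add: mult_exp_exp mult.commute flip: exp_of_nat_mult)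
  finally show "real (card ?Z) \<le> exp (6 * real n)" .
qed

text \<open>On light couples the coefficients divided by \<open>sqrt D\<close> lie in [-1, 1], where
  the exponential is at most quadratic. Since n p \<le> D, the quadratic term is at most |z|^2 |w|^2
  / n \<le> 16 n. The threshold 30 n leaves 16 - 30 = -14, enough to beat the exp (12 n) pairs of
  grid vectors.\<close>

lemma prob_light_sum_pair:
  assumes p: "edge_probabilities n p" and D: "D > 0" and z: "z \<in> grid n" "w \<in> grid n"
    and np: "\<And>i j. i < j \<Longrightarrow> j < n \<Longrightarrow> real n * p i j \<le> D"
  shows "measure_pmf.prob (random_graph n p) {G. light_sum n p D G z w > 30 * real n * sqrt D}
    \<le> exp (- 14 * real n)"
proof -
  let ?l = "\<lambda>i j. \<bar>real_of_int (z i) * real_of_int (w j)\<bar> \<le> sqrt D"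
  let ?x = "\<lambda>i j. real_of_int (z i) * real_of_int (w j)"
  define Y where "Y i j = (if ?l i j then ?x i j / sqrt D else 0)" for i j
  define y where "y e = (if fst e < snd e then Y (fst e) (snd e) else 0)" for e
  have y_abs: "\<bar>y e\<bar> \<le> 1" for e using D by (auto simp: y_def Y_def)
  have ls: "light_sum n p D G z w = sqrt D * (\<Sum>e\<in>edges n. (of_bool (G e) - edge_prob p e) * y e)" for G
  proof -
    have "light_sum n p D G z w =
      (\<Sum>i<n. \<Sum>j<n. if i < j then (of_bool (G (i, j)) - p i j) * (sqrt D * Y i j) else 0)"
      unfolding light_sum_def using D
      by (intro sum.cong refl) (auto simp: upper_def upper_mean_def Y_def)
    also have "\<dots> = (\<Sum>e\<in>edges n. if fst e < snd e then (of_bool (G (fst e, snd e)) - p (fst e) (snd e)) * (sqrt D * Y (fst e) (snd e)) else 0)"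
      by (rule sum_edges_upper)
    also have "\<dots> = sqrt D * (\<Sum>e\<in>edges n. (of_bool (G e) - edge_prob p e) * y e)"
      unfolding sum_distrib_left by (intro sum.cong refl) (auto simp: edge_prob_def y_def)
    finally show ?thesis .
  qed
  \<comment> \<open>Moving the mean into the threshold turns the exponent into the sum of p (exp y -
    1 - y).\<close>
  define c where "c = 30 * real n + (\<Sum>e\<in>edges n. edge_prob p e * y e)"
  have "measure_pmf.prob (random_graph n p) {G. light_sum n p D G z w > 30 * real n * sqrt D} \<le>
    (\<Prod>e\<in>{}. edge_prob p e) * exp ((\<Sum>e\<in>edges n. edge_prob p e * (exp (y e) - 1)) - c)"
  proof (rule prob_edge_exponential_bound[OF p])
    fix G assume "light_sum n p D G z w > 30 * real n * sqrt D"
    then have "sqrt D * (30 * real n) < sqrt D * (\<Sum>e\<in>edges n. (of_bool (G e) - edge_prob p e) * y e)"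
      unfolding ls by (simp add: mult_ac)
    then have "30 * real n < (\<Sum>e\<in>edges n. (of_bool (G e) - edge_prob p e) * y e)"
      using D by (simp only: mult_less_cancel_left_pos real_sqrt_gt_zero)
    also have "\<dots> = (\<Sum>e\<in>edges n. y e * of_bool (G e)) - (\<Sum>e\<in>edges n. edge_prob p e * y e)"
      unfolding sum_subtractf[symmetric] by (intro sum.cong refl) (simp add: algebra_simps)
    finally show "(\<forall>e\<in>{}. G e) \<and> c \<le> (\<Sum>e\<in>edges n. y e * of_bool (G e))"
      unfolding c_def by simp
  qed auto
  also have "\<dots> = exp ((\<Sum>e\<in>edges n. edge_prob p e * (exp (y e) - 1 - y e)) - 30 * real n)"
    by (simp add: c_def right_diff_distrib sum_subtractf)
  also have "\<dots> \<le> exp (16 * real n - 30 * real n)"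
  proof -
    have "(\<Sum>e\<in>edges n. edge_prob p e * (exp (y e) - 1 - y e)) \<le> (\<Sum>e\<in>edges n. edge_prob p e * (y e)\<^sup>2)"
      using exp_le_quadratic[OF y_abs] edge_prob_bounds[OF p]
      by (intro sum_mono mult_left_mono) (auto simp: algebra_simps)
    also have "\<dots> = (\<Sum>e\<in>edges n. if fst e < snd e then p (fst e) (snd e) * (Y (fst e) (snd e))\<^sup>2 else 0)"
      by (intro sum.cong refl) (auto simp: edge_prob_def y_def)
    also have "\<dots> = (\<Sum>i<n. \<Sum>j<n. if i < j then p i j * (Y i j)\<^sup>2 else 0)"
      by (rule sum_edges_upper[symmetric])
    also have "\<dots> \<le> (\<Sum>i<n. \<Sum>j<n. 1 / real n * ((real_of_int (z i))\<^sup>2 * (real_of_int (w j))\<^sup>2))"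
    proof (intro sum_mono)
      fix i j assume ij: "i \<in> {..<n}" "j \<in> {..<n}"
      show "(if i < j then p i j * (Y i j)\<^sup>2 else 0) \<le>
          1 / real n * ((real_of_int (z i))\<^sup>2 * (real_of_int (w j))\<^sup>2)"
      proof (cases "i < j")
        case True
        have "(Y i j)\<^sup>2 \<le> (?x i j)\<^sup>2 / D" using D by (auto simp: Y_def power_divide)
        moreover have "p i j \<le> D / real n" using np[of i j] True ij by (simp add: field_simps)
        moreover have "0 \<le> D / real n" using D by simp
        ultimately have "p i j * (Y i j)\<^sup>2 \<le> D / real n * ((?x i j)\<^sup>2 / D)"
          by (intro mult_mono) auto
        then show ?thesis using D True by (simp add: power_mult_distrib)
      qed simp
    qed
    also have "\<dots> = 1 / real n * ((\<Sum>i<n. (real_of_int (z i))\<^sup>2) * (\<Sum>j<n. (real_of_int (w j))\<^sup>2))"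
      by (simp only: sum_product) (simp only: sum_distrib_left)
    also have "\<dots> \<le> 1 / real n * ((4 * real n) * (4 * real n))"
      using z by (intro mult_left_mono mult_mono) (auto simp: grid_def intro: sum_nonneg)
    also have "\<dots> = 16 * real n" by simp
    finally show ?thesis by simp
  qed
  finally show ?thesis by simp
qed

lemma prob_light_sum:
  assumes p: "edge_probabilities n p" and D: "D > 0"
    and np: "\<And>i j. i < j \<Longrightarrow> j < n \<Longrightarrow> real n * p i j \<le> D"
  shows "measure_pmf.prob (random_graph n p)
      {G. \<exists>z\<in>grid n. \<exists>w\<in>grid n. light_sum n p D G z w > 30 * real n * sqrt D} \<le> exp (- 2 * real n)"
proof -
  let ?Z = "grid n \<inter> ({..<n} \<rightarrow>\<^sub>E UNIV)"
  \<comment> \<open>\<open>grid n\<close> is infinite because it leaves values outside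
    \<open>{..<n}\<close> free. A light sum does not see those values, so restricted vectors suffice
    for the union bound.\<close>
  have restr: "restrict z {..<n} \<in> ?Z" if "z \<in> grid n" for z
    using that by (auto simp: grid_def)
  have ls: "light_sum n p D G (restrict z {..<n}) (restrict w {..<n}) = light_sum n p D G z w" for z w G
    unfolding light_sum_def by (intro sum.cong refl) simp
  have "{G. \<exists>z\<in>grid n. \<exists>w\<in>grid n. light_sum n p D G z w > 30 * real n * sqrt D} \<subseteq>
      {G. \<exists>q\<in>?Z \<times> ?Z. light_sum n p D G (fst q) (snd q) > 30 * real n * sqrt D}"
  proof (rule Collect_mono, rule impI)
    fix G assume "\<exists>z\<in>grid n. \<exists>w\<in>grid n. light_sum n p D G z w > 30 * real n * sqrt D"
    then obtain z w where zw: "z \<in> grid n" "w \<in> grid n" "light_sum n p D G z w > 30 * real n * sqrt D"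
      by blast
    show "\<exists>q\<in>?Z \<times> ?Z. light_sum n p D G (fst q) (snd q) > 30 * real n * sqrt D"
    proof (rule bexI)
      show "(restrict z {..<n}, restrict w {..<n}) \<in> ?Z \<times> ?Z"
        using zw(1,2) by (intro SigmaI restr)
      show "light_sum n p D G (fst (restrict z {..<n}, restrict w {..<n})) (snd (restrict z {..<n}, restrict w {..<n})) > 30 * real n * sqrt D"
        unfolding fst_conv snd_conv ls by (rule zw(3))
    qed
  qed
  then have "measure_pmf.prob (random_graph n p)
      {G. \<exists>z\<in>grid n. \<exists>w\<in>grid n. light_sum n p D G z w > 30 * real n * sqrt D} \<le>
    measure_pmf.prob (random_graph n p)
      {G. \<exists>q\<in>?Z \<times> ?Z. light_sum n p D G (fst q) (snd q) > 30 * real n * sqrt D}"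
    by (intro measure_pmf.finite_measure_mono) simp_all
  also have "\<dots> \<le> (\<Sum>q\<in>?Z \<times> ?Z. exp (- 14 * real n))"
  proof (rule prob_UNION_le)
    show "finite (?Z \<times> ?Z)" by (intro finite_cartesian_product card_grid(1))
    show "measure_pmf.prob (random_graph n p)
        {G. light_sum n p D G (fst q) (snd q) > 30 * real n * sqrt D} \<le> exp (- 14 * real n)"
      if "q \<in> ?Z \<times> ?Z" for q
      by (rule prob_light_sum_pair[OF p D]) (use that np in auto)
  qed
  also have "\<dots> = real (card ?Z) * real (card ?Z) * exp (- 14 * real n)"
    by (simp add: card_cartesian_product)
  also have "\<dots> \<le> exp (6 * real n) * exp (6 * real n) * exp (- 14 * real n)"
    using card_grid(2)[of n] by (intro mult_right_mono mult_mono) auto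
  also have "\<dots> = exp (- 2 * real n)" by (simp flip: exp_add)
  finally show ?thesis .
qed

section \<open>Discrepancy of edge counts\<close>

definition edge_count :: "(nat \<Rightarrow> nat \<Rightarrow> real) \<Rightarrow> nat set \<Rightarrow> nat set \<Rightarrow> real" where
  "edge_count m S T = (\<Sum>i\<in>S. \<Sum>j\<in>T. m i j)"

text \<open>With \<open>exp (entropy n t)\<close> bounding the number of \<open>t\<close>-subsets of an \<open>n\<close>-set, this is the cost of the
  union bound in the discrepancy estimate.\<close>

definition entropy :: "nat \<Rightarrow> nat \<Rightarrow> real" where
  "entropy n t = real t * ln (exp 1 * real n / real t)"

text \<open>The factor \<open>exp 1\<close> keeps the logarithm at least 1 for
  \<open>t \<le> n\<close>; this absorbs the loss t - s that comes from ln x \<le> x - 1.\<close>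

lemma entropy_mono:
  assumes "1 \<le> s" "s \<le> t" "t \<le> n"
  shows "entropy n s \<le> entropy n t"
proof -
  have pos: "real s > 0" "real t > 0" "real n > 0" using assms by auto
  have eq: "ln (exp 1 * real n / real s) = ln (exp 1 * real n / real t) + ln (real t / real s)"
    using pos by (simp add: ln_div ln_mult)
  have "ln (real t / real s) \<le> real t / real s - 1"
    using pos by (intro ln_le_minus_one) simp
  then have "real s * ln (real t / real s) \<le> real s * (real t / real s - 1)"
    using pos by (intro mult_left_mono) auto
  also have "\<dots> = (real t - real s) * 1" using pos by (simp add: field_simps)
  also have "\<dots> \<le> (real t - real s) * ln (exp 1 * real n / real t)"
    using assms pos by (intro mult_left_mono) (auto simp: ln_mult ln_div)
  finally show ?thesis
    unfolding entropy_def eq by (simp add: algebra_simps)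
qed

text \<open>Keep a single term of the expansion of (1 + x)^n at x = s/n, and bound the whole power
  by exp s.\<close>

lemma binomial_le_exp_entropy:
  assumes "1 \<le> s" "s \<le> n"
  shows "real (n choose s) \<le> exp (entropy n s)"
proof -
  have pos: "real s > 0" "real n > 0" using assms by auto
  define x where "x = real s / real n"
  have x: "x > 0" using pos by (simp add: x_def)
  have "real (n choose s) * x ^ s \<le> (\<Sum>k\<le>n. real (n choose k) * x ^ k)"
    by (rule member_le_sum) (use assms x in auto)
  also have "\<dots> = (1 + x) ^ n"
    using binomial_ring[of x 1 n] by (simp add: add.commute)
  also have "\<dots> \<le> exp x ^ n"
    using x by (intro power_mono) (auto simp: exp_ge_add_one_self)
  also have "\<dots> = exp (real s)"
    using pos by (simp add: x_def flip: exp_of_nat_mult)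
  finally have "real (n choose s) \<le> exp (real s) / x ^ s" using x by (simp add: field_simps)
  also have "x ^ s = exp (real s * ln x)"
    using x by (simp add: exp_of_nat_mult)
  also have "exp (real s) / exp (real s * ln x) = exp (entropy n s)"
    using pos by (simp add: entropy_def x_def ln_div ln_mult algebra_simps flip: exp_diff)
  finally show ?thesis .
qed

lemma card_nonempty_subset:
  assumes "S \<in> Pow {..<n} - {{}}"
  shows "finite S" "1 \<le> card S" "card S \<le> n"
proof -
  show f: "finite S" using assms finite_subset by auto
  show "1 \<le> card S" using assms f by (simp add: Suc_le_eq card_gt_0_iff)
  show "card S \<le> n" using assms card_mono[of "{..<n}" S] by simp
qed

text \<open>One factor of the two pays for the number of sets of a given size. The other is at most
  1/n by comparison with size 1, and there are n sizes.\<close>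

lemma sum_subsets_exp_entropy:
  assumes "n > 0"
  shows "(\<Sum>S\<in>Pow {..<n} - {{}}. exp (- 2 * entropy n (card S))) \<le> 1"
proof -
  have e1: "entropy n 1 = 1 + ln (real n)" using assms by (simp add: entropy_def ln_mult)
  have "(\<Sum>S\<in>Pow {..<n} - {{}}. exp (- 2 * entropy n (card S))) =
      (\<Sum>s\<in>{1..n}. \<Sum>S\<in>{S \<in> Pow {..<n} - {{}}. card S = s}. exp (- 2 * entropy n (card S)))"
  proof (rule sum.group[symmetric])
    show "card ` (Pow {..<n} - {{}}) \<subseteq> {1..n}"
      using card_nonempty_subset by (intro image_subsetI) (simp del: Pow_iff)
  qed auto
  also have "\<dots> \<le> (\<Sum>s\<in>{1..n}. 1 / real n)"
  proof (rule sum_mono)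
    fix s assume s: "s \<in> {1..n}"
    have "{S \<in> Pow {..<n} - {{}}. card S = s} = {S. S \<subseteq> {..<n} \<and> card S = s}"
      using s by auto
    then have card: "card {S \<in> Pow {..<n} - {{}}. card S = s} = n choose s"
      using n_subsets[of "{..<n}" s] by simp
    have "(\<Sum>S\<in>{S \<in> Pow {..<n} - {{}}. card S = s}. exp (- 2 * entropy n (card S))) =
        real (card {S \<in> Pow {..<n} - {{}}. card S = s}) * exp (- 2 * entropy n s)"
      by simp
    also note card
    also have "real (n choose s) * exp (- 2 * entropy n s) \<le> exp (entropy n s) * exp (- 2 * entropy n s)"
      using binomial_le_exp_entropy[of s n] s by (intro mult_right_mono) auto
    also have "\<dots> = exp (- entropy n s)" by (simp flip: exp_add)
    also have "\<dots> \<le> exp (- ln (real n))"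
      using entropy_mono[of 1 s n] s e1 by simp
    also have "\<dots> = 1 / real n" using assms by (simp add: exp_minus divide_inverse)
    finally show "(\<Sum>S\<in>{S \<in> Pow {..<n} - {{}}. card S = s}. exp (- 2 * entropy n (card S))) \<le> 1 / real n" .
  qed
  also have "\<dots> = 1" using assms by simp
  finally show ?thesis .
qed

text \<open>The negation of the Feige-Ofek alternative: an edge count is either comparable to \<mu>
  or controlled by the entropy. When n p \<le> D, \<mu> is an upper bound for the mean count rather
  than the mean itself, which makes the condition insensitive to how the probabilities vary.\<close>

definition discrepancy_violated :: "nat \<Rightarrow> real \<Rightarrow> (nat \<Rightarrow> nat \<Rightarrow> real) \<Rightarrow> nat set \<Rightarrow> nat set \<Rightarrow> bool" where
  "discrepancy_violated n D m S T \<longleftrightarrow>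
     (let e = edge_count m S T; \<mu> = D * real (card S) * real (card T) / real n
      in e > exp 2 * \<mu> \<and> e * ln (e / \<mu>) > 14 * entropy n (max (card S) (card T)))"

text \<open>Fixing the edge count \<open>k\<close> allows the optimal tilt ln (k / \<mu>). It
  exceeds 2, so the exponent k - \<theta> k is at most -\<theta> k / 2, and half of the constant 14
  is what remains.\<close>

lemma prob_discrepancy_pair:
  assumes p: "edge_probabilities n p" and D: "D > 0"
    and np: "\<And>i j. i < j \<Longrightarrow> j < n \<Longrightarrow> real n * p i j \<le> D"
    and ST: "S \<subseteq> {..<n}" "T \<subseteq> {..<n}" "S \<noteq> {}" "T \<noteq> {}"
  shows "measure_pmf.prob (random_graph n p)
      {G. edge_count (upper G) S T = real k \<and> discrepancy_violated n D (upper G) S T}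
    \<le> exp (- 7 * entropy n (max (card S) (card T)))"
proof -
  define \<mu> where "\<mu> = D * real (card S) * real (card T) / real n"
  define L where "L = entropy n (max (card S) (card T))"
  have fin: "finite S" "finite T" using ST finite_subset by auto
  have n: "n > 0" using ST by (cases n) auto
  have \<mu>: "\<mu> > 0" using D n ST fin by (simp add: \<mu>_def card_gt_0_iff)
  show ?thesis
  proof (cases "real k > exp 2 * \<mu> \<and> real k * ln (real k / \<mu>) > 14 * L")
    case False
    then have "{G. edge_count (upper G) S T = real k \<and> discrepancy_violated n D (upper G) S T} = {}"
      by (auto simp: discrepancy_violated_def Let_def \<mu>_def L_def)
    then show ?thesis by (simp only: measure_empty exp_ge_zero)
  next
    case True
    define \<theta> where "\<theta> = ln (real k / \<mu>)"
    have "exp 2 < real k / \<mu>" using True \<mu> by (simp add: field_simps)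
    moreover from this have "0 < real k / \<mu>" using exp_gt_zero[of "2 :: real"] by linarith
    ultimately have "exp 2 < exp \<theta>" and e\<theta>: "exp \<theta> = real k / \<mu>"
      by (simp_all add: \<theta>_def)
    then have \<theta>: "\<theta> > 2" "exp \<theta> = real k / \<mu>"
      by (metis exp_less_cancel_iff) (rule e\<theta>)
    define y where "y e = (if fst e < snd e then (if fst e \<in> S \<and> snd e \<in> T then \<theta> else 0) else 0)" for e
    have cnt: "(\<Sum>e\<in>edges n. if fst e < snd e then (if fst e \<in> S \<and> snd e \<in> T then f (fst e) (snd e) else 0) else 0)
        = (\<Sum>i\<in>S. \<Sum>j\<in>T. if i < j then f i j else 0)" for f :: "nat \<Rightarrow> nat \<Rightarrow> real"
    proof -
      have "(\<Sum>i\<in>S. \<Sum>j\<in>T. if i < j then f i j else 0) =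
          (\<Sum>i<n. if i \<in> S then (\<Sum>j<n. if j \<in> T then (if i < j then f i j else 0) else 0) else 0)"
        using ST(1,2) by (simp add: sum.inter_restrict[symmetric] Int_absorb1)
      also have "\<dots> = (\<Sum>i<n. \<Sum>j<n. if i < j then (if i \<in> S \<and> j \<in> T then f i j else 0) else 0)"
        by (intro sum.cong refl) (auto intro!: sum.cong sum.neutral)
      finally have "(\<Sum>i\<in>S. \<Sum>j\<in>T. if i < j then f i j else 0) = \<dots>" .
      then show ?thesis
        using sum_edges_upper[of "\<lambda>i j. if i \<in> S \<and> j \<in> T then f i j else 0" n] by simp
    qed
    have "measure_pmf.prob (random_graph n p)
      {G. edge_count (upper G) S T = real k \<and> discrepancy_violated n D (upper G) S T} \<le>
      (\<Prod>e\<in>{}. edge_prob p e) * exp ((\<Sum>e\<in>edges n. edge_prob p e * (exp (y e) - 1)) - \<theta> * real k)"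
    proof (rule prob_edge_exponential_bound[OF p])
      fix G assume G: "edge_count (upper G) S T = real k \<and> discrepancy_violated n D (upper G) S T"
      have "(\<Sum>e\<in>edges n. y e * of_bool (G e)) =
          (\<Sum>e\<in>edges n. if fst e < snd e then (if fst e \<in> S \<and> snd e \<in> T then \<theta> * of_bool (G (fst e, snd e)) else 0) else 0)"
        by (intro sum.cong refl) (auto simp: y_def)
      also have "\<dots> = \<theta> * edge_count (upper G) S T"
        unfolding cnt[of "\<lambda>i j. \<theta> * of_bool (G (i, j))"] edge_count_def sum_distrib_left by (intro sum.cong refl) (auto simp: upper_def)
      finally show "(\<forall>e\<in>{}. G e) \<and> \<theta> * real k \<le> (\<Sum>e\<in>edges n. y e * of_bool (G e))"
        using G by simp
    qed auto
    also have "\<dots> \<le> exp (- 7 * L)"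
    proof -
      have "(\<Sum>e\<in>edges n. edge_prob p e * (exp (y e) - 1)) =
          (\<Sum>e\<in>edges n. if fst e < snd e then (if fst e \<in> S \<and> snd e \<in> T then p (fst e) (snd e) * (exp \<theta> - 1) else 0) else 0)"
        by (intro sum.cong refl) (auto simp: y_def edge_prob_def)
      also have "\<dots> \<le> (\<Sum>i\<in>S. \<Sum>j\<in>T. D / real n * exp \<theta>)"
        unfolding cnt[of "\<lambda>i j. p i j * (exp \<theta> - 1)"]
      proof (intro sum_mono)
        fix i j assume "i \<in> S" "j \<in> T"
        then have "i < j \<Longrightarrow> p i j \<le> D / real n \<and> 0 \<le> p i j"
          using np[of i j] ST n p by (auto simp: field_simps edge_probabilities_def)
        moreover have "0 \<le> exp \<theta> - 1" using \<theta>(1) by simp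
        ultimately show "(if i < j then p i j * (exp \<theta> - 1) else 0) \<le> D / real n * exp \<theta>"
          using D mult_mono[of "p i j" "D / real n" "exp \<theta> - 1" "exp \<theta>"] by (cases "i < j") auto
      qed
      also have "\<dots> = \<mu> * exp \<theta>" by (simp add: \<mu>_def)
      also have "\<dots> = real k" using \<mu> by (simp add: \<theta>(2))
      finally have "(\<Sum>e\<in>edges n. edge_prob p e * (exp (y e) - 1)) - \<theta> * real k \<le> real k - \<theta> * real k" by simp
      also have "\<dots> \<le> - (\<theta> * real k) / 2"
        using mult_right_mono[of 2 \<theta> "real k"] \<theta>(1) by simp
      also have "\<dots> \<le> - 7 * L" using True by (simp add: \<theta>_def mult.commute)
      finally show ?thesis by simp
    qed
    finally show ?thesis by (simp add: L_def)
  qed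
qed

text \<open>The exponent 7 splits as 2 + 2 + 3: two units for each of the sums over \<open>S\<close>
  and over \<open>T\<close>, and three units of \<open>entropy n 1 = 1 + ln n\<close>, giving the
  factor n^(-3) against the n^2 + 1 possible edge counts.\<close>

lemma prob_discrepancy:
  assumes p: "edge_probabilities n p" and D: "D > 0" and n: "n \<ge> 1"
    and np: "\<And>i j. i < j \<Longrightarrow> j < n \<Longrightarrow> real n * p i j \<le> D"
  shows "measure_pmf.prob (random_graph n p)
      {G. \<exists>S\<subseteq>{..<n}. \<exists>T\<subseteq>{..<n}. S \<noteq> {} \<and> T \<noteq> {} \<and> discrepancy_violated n D (upper G) S T}
    \<le> 1 / real n"
proof -
  let ?P = "Pow {..<n} - {{}}"
  let ?I = "(?P \<times> ?P) \<times> {..n * n}"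
  let ?Q = "\<lambda>q G. edge_count (upper G) (fst (fst q)) (snd (fst q)) = real (snd q) \<and>
    discrepancy_violated n D (upper G) (fst (fst q)) (snd (fst q))"
  have card: "\<exists>k\<le>n * n. edge_count (upper G) S T = real k" if "S \<subseteq> {..<n}" "T \<subseteq> {..<n}" for G S T
  proof -
    have fin: "finite S" "finite T" using that finite_subset by auto
    have "edge_count (upper G) S T = real (\<Sum>i\<in>S. \<Sum>j\<in>T. if i < j then of_bool (G (i, j)) else 0)"
      by (simp add: edge_count_def upper_def if_distrib cong: if_cong)
    moreover have "(\<Sum>i\<in>S. \<Sum>j\<in>T. if i < j then of_bool (G (i, j)) else 0) \<le> (\<Sum>i\<in>S. \<Sum>j\<in>T. 1 :: nat)"
      by (intro sum_mono) auto
    moreover have "card S \<le> n" "card T \<le> n" using that card_mono[of "{..<n}"] by auto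
    then have "(\<Sum>i\<in>S. \<Sum>j\<in>T. 1 :: nat) \<le> n * n" by (simp add: mult_mono)
    ultimately show ?thesis using le_trans by blast
  qed
  have "{G. \<exists>S\<subseteq>{..<n}. \<exists>T\<subseteq>{..<n}. S \<noteq> {} \<and> T \<noteq> {} \<and> discrepancy_violated n D (upper G) S T}
      \<subseteq> {G. \<exists>q\<in>?I. ?Q q G}"
  proof clarify
    fix G S T assume ST: "S \<subseteq> {..<n}" "T \<subseteq> {..<n}" "S \<noteq> {}" "T \<noteq> {}" "discrepancy_violated n D (upper G) S T"
    obtain k where "k \<le> n * n" "edge_count (upper G) S T = real k" using card ST by blast
    then show "\<exists>q\<in>?I. ?Q q G" using ST by (intro bexI[of _ "((S, T), k)"]) auto
  qed
  then have "measure_pmf.prob (random_graph n p)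
      {G. \<exists>S\<subseteq>{..<n}. \<exists>T\<subseteq>{..<n}. S \<noteq> {} \<and> T \<noteq> {} \<and> discrepancy_violated n D (upper G) S T} \<le>
    measure_pmf.prob (random_graph n p) {G. \<exists>q\<in>?I. ?Q q G}"
    by (intro measure_pmf.finite_measure_mono) auto
  also have "\<dots> \<le> (\<Sum>q\<in>?I. exp (- 7 * entropy n (max (card (fst (fst q))) (card (snd (fst q))))))"
  proof (rule prob_UNION_le)
    fix q assume q: "q \<in> ?I"
    show "measure_pmf.prob (random_graph n p) {G. ?Q q G} \<le>
        exp (- 7 * entropy n (max (card (fst (fst q))) (card (snd (fst q)))))"
      by (rule prob_discrepancy_pair[OF p D np]) (use q in auto)
  qed auto
  also have "\<dots> = real (n * n + 1) * (\<Sum>S\<in>?P. \<Sum>T\<in>?P. exp (- 7 * entropy n (max (card S) (card T))))"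
    by (simp add: sum.cartesian_product' sum_distrib_left mult.commute)
  also have "\<dots> \<le> real (n * n + 1) * (\<Sum>S\<in>?P. \<Sum>T\<in>?P. (exp (- 2 * entropy n (card S)) * exp (- 2 * entropy n (card T))) * exp (- 3 * (1 + ln (real n))))"
  proof (intro mult_left_mono sum_mono)
    fix S T assume "S \<in> ?P" "T \<in> ?P"
    then have "1 \<le> card S" "card S \<le> n" "1 \<le> card T" "card T \<le> n"
      using card_nonempty_subset[of S n] card_nonempty_subset[of T n] by blast+
    moreover define L where "L = entropy n (max (card S) (card T))"
    ultimately have "entropy n (card S) \<le> L" "entropy n (card T) \<le> L" "entropy n 1 \<le> L"
      by (auto intro!: entropy_mono)
    moreover have "entropy n 1 = 1 + ln (real n)" using n by (simp add: entropy_def ln_mult)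
    ultimately have "1 + ln (real n) \<le> L" "entropy n (card S) \<le> L" "entropy n (card T) \<le> L"
      by simp_all
    moreover have "a \<le> L \<Longrightarrow> b \<le> L \<Longrightarrow> c \<le> L \<Longrightarrow> - 7 * L \<le> - 2 * b + - 2 * c + - 3 * a" for a b c :: real
      by linarith
    ultimately have "- 7 * L \<le> - 2 * entropy n (card S) + - 2 * entropy n (card T) + - 3 * (1 + ln (real n))"
      by blast
    then show "exp (- 7 * entropy n (max (card S) (card T))) \<le>
        (exp (- 2 * entropy n (card S)) * exp (- 2 * entropy n (card T))) * exp (- 3 * (1 + ln (real n)))"
      unfolding exp_add[symmetric] exp_le_cancel_iff L_def .
  qed simp
  also have "\<dots> = real (n * n + 1) * ((\<Sum>S\<in>?P. exp (- 2 * entropy n (card S))) * (\<Sum>T\<in>?P. exp (- 2 * entropy n (card T)))) * exp (- 3 * (1 + ln (real n)))"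
    unfolding sum_product by (simp only: sum_distrib_right mult.assoc)
  also have "\<dots> \<le> real (n * n + 1) * (1 * 1) * exp (- 3 * (1 + ln (real n)))"
    using sum_subsets_exp_entropy[of n] n
    by (intro mult_right_mono mult_left_mono mult_mono) (auto intro!: sum_nonneg)
  also have "\<dots> = real (n * n + 1) * exp (- 3) / real n ^ 3"
  proof -
    have "exp (3 * ln (real n)) = real n ^ 3"
      using n exp_of_nat_mult[of 3 "ln (real n)"] by simp
    moreover have "- 3 * (1 + ln (real n)) = - 3 - 3 * ln (real n)" by simp
    ultimately have "exp (- 3 * (1 + ln (real n))) = exp (- 3) / real n ^ 3"
      by (simp only: exp_diff)
    then show ?thesis by simp
  qed
  also have "\<dots> \<le> 1 / real n"
  proof -
    have "1 * 1 \<le> real n * real n" using n by (intro mult_mono) auto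
    then have "real (n * n + 1) \<le> 2 * real n ^ 2" by (simp add: power2_eq_square)
    moreover have "exp (- 3) \<le> (1 / 2 :: real)"
      using exp_ge_add_one_self[of 3] by (simp add: exp_minus field_simps)
    ultimately have "real (n * n + 1) * exp (- 3) \<le> 2 * real n ^ 2 * (1 / 2)"
      by (intro mult_mono) auto
    then have "real (n * n + 1) * exp (- 3) / real n ^ 3 \<le> real n ^ 2 / real n ^ 3"
      by (intro divide_right_mono) auto
    then show ?thesis using n by (simp add: power2_eq_square power3_eq_cube)
  qed
  finally show ?thesis .
qed

section \<open>Prescribed edges together with large degrees\<close>

lemma edge_between_inj: "inj_on (\<lambda>(w, x). (min w x, max w x)) (W \<times> (V - W))"
  by (auto simp: inj_on_def min_def max_def split: if_splits)

text \<open>Given the edges of \<open>F\<close> inside \<open>T\<close>, the degrees of the vertices of \<open>W\<close> are large because of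
  the edges leaving \<open>T\<close>, which are independent of \<open>F\<close> and of each other.\<close>

lemma prob_large_degrees:
  assumes p: "edge_probabilities n p" and \<theta>: "\<theta> \<ge> 0"
    and W: "W \<subseteq> T" and T: "T \<subseteq> {..<n}"
    and F: "F \<subseteq> edges n" "\<And>e. e \<in> F \<Longrightarrow> fst e \<in> T \<and> snd e \<in> T"
    and d: "\<And>w. w \<in> W \<Longrightarrow> (\<Sum>j<n. p w j) \<le> d"
  shows "measure_pmf.prob (random_graph n p)
      {G. (\<forall>e\<in>F. G e) \<and> (\<forall>w\<in>W. K \<le> vertex_degree n G w)}
    \<le> (\<Prod>e\<in>F. edge_prob p e) * exp (real (card W) * (d * exp \<theta> - \<theta> * (K - real (card T))))"
proof -
  let ?V = "{..<n}" and ?g = "\<lambda>(w, x). (min w x, max w x)"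
  \<comment> \<open>Every edge of \<open>B\<close> has exactly one endpoint in \<open>T\<close>. It
    therefore determines its vertex in \<open>W\<close>, so no edge is counted for two vertices, and
    it cannot belong to \<open>F\<close>. At most \<open>card T\<close> edges at each vertex are
    given up.\<close>
  define B where "B = ?g ` (W \<times> (?V - T))"
  have fin: "finite T" "finite W" using T W finite_subset by (auto dest: finite_subset)
  have B_edges: "B \<subseteq> edges n"
    using W T by (auto simp: B_def edges_def min_def max_def)
  have B_sum: "(\<Sum>e\<in>B. f e) = (\<Sum>w\<in>W. \<Sum>x\<in>?V - T. f (min w x, max w x))" for f :: "nat \<times> nat \<Rightarrow> real"
  proof -
    have "inj_on ?g (W \<times> (?V - T))"
      by (rule inj_on_subset[OF edge_between_inj[of W ?V]]) (use W in auto)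
    then show ?thesis
      unfolding B_def by (subst sum.reindex) (auto simp: sum.cartesian_product case_prod_beta)
  qed
  define y where "y e = (if e \<in> B then \<theta> else 0)" for e
  have y_sum: "(\<Sum>e\<in>edges n. h e * (if e \<in> B then c else 0)) = (\<Sum>e\<in>B. h e * c)" for h :: "nat \<times> nat \<Rightarrow> real" and c
    using B_edges by (intro sum.mono_neutral_cong_right) auto
  have "measure_pmf.prob (random_graph n p)
      {G. (\<forall>e\<in>F. G e) \<and> (\<forall>w\<in>W. K \<le> vertex_degree n G w)} \<le>
    (\<Prod>e\<in>F. edge_prob p e) * exp ((\<Sum>e\<in>edges n. edge_prob p e * (exp (y e) - 1)) - \<theta> * (real (card W) * (K - real (card T))))"
  proof (rule prob_edge_exponential_bound[OF p F(1)])
    fix e assume "e \<in> F"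
    then show "y e = 0" using F(2)[of e] by (auto simp: y_def B_def min_def max_def split: if_splits)
  next
    fix G assume G: "(\<forall>e\<in>F. G e) \<and> (\<forall>w\<in>W. K \<le> vertex_degree n G w)"
    have "real (card W) * (K - real (card T)) = (\<Sum>w\<in>W. K - real (card T))" by simp
    also have "\<dots> \<le> (\<Sum>w\<in>W. \<Sum>x\<in>?V - T. of_bool (G (min w x, max w x)))"
    proof (rule sum_mono)
      fix w assume w: "w \<in> W"
      have "K \<le> (\<Sum>x\<in>?V. of_bool (G (min w x, max w x)) :: real)"
        using G w W T by (auto simp: vertex_degree_def adjacency_matrix_def subset_iff)
      also have "\<dots> = (\<Sum>x\<in>?V - T. of_bool (G (min w x, max w x))) + (\<Sum>x\<in>T. of_bool (G (min w x, max w x)))"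
        by (rule sum.subset_diff[OF T]) simp
      also have "(\<Sum>x\<in>T. of_bool (G (min w x, max w x)) :: real) \<le> (\<Sum>x\<in>T. 1)"
        by (intro sum_mono) auto
      finally show "K - real (card T) \<le> (\<Sum>x\<in>?V - T. of_bool (G (min w x, max w x)))" by simp
    qed
    finally have "\<theta> * (real (card W) * (K - real (card T))) \<le> \<theta> * (\<Sum>e\<in>B. of_bool (G e))"
      unfolding B_sum using \<theta> by (intro mult_left_mono)
    also have "\<dots> = (\<Sum>e\<in>B. of_bool (G e) * \<theta>)"
      by (simp only: sum_distrib_left mult.commute[of \<theta>])
    also have "\<dots> = (\<Sum>e\<in>edges n. of_bool (G e) * (if e \<in> B then \<theta> else 0))"
      by (rule y_sum[symmetric])
    also have "\<dots> = (\<Sum>e\<in>edges n. y e * of_bool (G e))"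
      by (intro sum.cong refl) (simp add: y_def)
    finally show "(\<forall>e\<in>F. G e) \<and>
        \<theta> * (real (card W) * (K - real (card T))) \<le> (\<Sum>e\<in>edges n. y e * of_bool (G e))"
      using G by blast
  qed
  also have "(\<Sum>e\<in>edges n. edge_prob p e * (exp (y e) - 1)) = (\<Sum>e\<in>edges n. edge_prob p e * (if e \<in> B then exp \<theta> - 1 else 0))"
    by (intro sum.cong refl) (simp add: y_def)
  also have "\<dots> = (\<Sum>w\<in>W. \<Sum>x\<in>?V - T. edge_prob p (min w x, max w x) * (exp \<theta> - 1))"
    unfolding y_sum B_sum ..
  also have "(\<Prod>e\<in>F. edge_prob p e) * exp (\<dots> - \<theta> * (real (card W) * (K - real (card T)))) \<le>
      (\<Prod>e\<in>F. edge_prob p e) * exp (real (card W) * (d * exp \<theta>) - \<theta> * (real (card W) * (K - real (card T))))"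
  proof (rule mult_left_mono)
    have "(\<Sum>x\<in>?V - T. edge_prob p (min w x, max w x) * (exp \<theta> - 1)) \<le> d * exp \<theta>" if w: "w \<in> W" for w
    proof -
      have wn: "w < n" using w W T by auto
      then have nn: "0 \<le> p w x" if "x < n" for x using p that by (auto simp: edge_probabilities_def)
      have "(\<Sum>x\<in>?V - T. edge_prob p (min w x, max w x) * (exp \<theta> - 1)) = (\<Sum>x\<in>?V - T. p w x) * (exp \<theta> - 1)"
        unfolding sum_distrib_right using p wn
        by (intro sum.cong refl) (auto simp: edge_prob_def min_def max_def edge_probabilities_def)
      also have "\<dots> \<le> (\<Sum>x\<in>?V. p w x) * (exp \<theta> - 1)"
        using \<theta> nn by (intro mult_right_mono sum_mono2) auto
      also have "\<dots> \<le> d * exp \<theta>"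
      proof (rule mult_mono)
        show "0 \<le> d" using d[OF w] sum_nonneg[of ?V "p w"] nn by fastforce
      qed (use d[OF w] \<theta> in auto)
      finally show ?thesis .
    qed
    then have "(\<Sum>w\<in>W. \<Sum>x\<in>?V - T. edge_prob p (min w x, max w x) * (exp \<theta> - 1)) \<le> real (card W) * (d * exp \<theta>)"
      by (rule sum_bounded_above)
    then show "exp ((\<Sum>w\<in>W. \<Sum>x\<in>?V - T. edge_prob p (min w x, max w x) * (exp \<theta> - 1)) - \<theta> * (real (card W) * (K - real (card T))))
      \<le> exp (real (card W) * (d * exp \<theta>) - \<theta> * (real (card W) * (K - real (card T))))" by simp
    show "0 \<le> (\<Prod>e\<in>F. edge_prob p e)" using edge_prob_bounds[OF p] F(1) by (intro prod_nonneg) auto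
  qed
  finally show ?thesis by (simp add: algebra_simps)
qed

subsection \<open>Heavy couples\<close>

text \<open>The function e ln (e / \<mu>) increases for e above \<mu>, so deleting edges cannot
  create a violation. The random estimate for the full graph thus covers every subgraph, however it
  is chosen.\<close>

lemma discrepancy_violated_mono:
  assumes m: "\<And>i j. i \<in> S \<Longrightarrow> j \<in> T \<Longrightarrow> m i j \<le> m' i j" and D: "D > 0"
    and ST: "S \<subseteq> {..<n}" "T \<subseteq> {..<n}" "S \<noteq> {}" "T \<noteq> {}"
    and v: "discrepancy_violated n D m S T"
  shows "discrepancy_violated n D m' S T"
proof -
  define \<mu> where "\<mu> = D * real (card S) * real (card T) / real n"
  have "n > 0" "finite S" "finite T" using ST finite_subset by (cases n; auto)+
  then have \<mu>: "\<mu> > 0" using D ST by (simp add: \<mu>_def card_gt_0_iff)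
  define e where "e = edge_count m S T"
  define e' where "e' = edge_count m' S T"
  have le: "e \<le> e'" unfolding e_def e'_def edge_count_def by (intro sum_mono m)
  have e: "e > exp 2 * \<mu>" "e * ln (e / \<mu>) > 14 * entropy n (max (card S) (card T))"
    using v by (auto simp: discrepancy_violated_def Let_def e_def \<mu>_def)
  have "1 * \<mu> \<le> exp 2 * \<mu>" using \<mu> by (intro mult_right_mono) auto
  then have e\<mu>: "e > \<mu>" using e by linarith
  have "e * ln (e / \<mu>) \<le> e' * ln (e' / \<mu>)"
    using e\<mu> le \<mu> by (intro mult_mono) (auto simp: divide_right_mono)
  then show ?thesis
    using e le by (auto simp: discrepancy_violated_def Let_def e'_def[symmetric] \<mu>_def[symmetric])
qed

text \<open>\<open>A\<close> and \<open>B\<close> are the dyadic sizes of the two test vectors on sets of \<open>s\<close> and \<open>t\<close> indices with \<open>e\<close> edges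
  between them. The four terms are the four regimes of the Feige-Ofek argument; each of them can be
  summed over all dyadic levels, geometrically in one index and against the norm in the other.\<close>

lemma heavy_level_bound:
  fixes A B s t n D e :: real
  assumes A: "A \<ge> 1" and B: "B \<ge> 1" and s: "s \<ge> 1" and st: "s \<le> t" and tn: "t \<le> n" and D: "D > 0"
    and e: "e \<ge> 0" and R: "R = sqrt D" and act: "R < 4 * A * B" and \<mu>: "\<mu> = D * s * t / n"
    and disc: "e \<le> exp 2 * \<mu> \<or> e * ln (e / \<mu>) \<le> 14 * (t * ln (exp 1 * n / t))"
  shows "e * A * B \<le> 56 * (R * A\<^sup>2 * B\<^sup>2 * s * t / n + t * A * B + (if A \<le> 2 * R then t * A * B\<^sup>2 else 0) + R * A\<^sup>2 * s / B)"
proof -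
  define X1 where "X1 = R * A\<^sup>2 * B\<^sup>2 * s * t / n"
  define X2 where "X2 = t * A * B"
  define X3 where "X3 = (if A \<le> 2 * R then t * A * B\<^sup>2 else 0)"
  define X4 where "X4 = R * A\<^sup>2 * s / B"
  have pos: "t > 0" "n > 0" "R > 0" "\<mu> > 0" "A > 0" "B > 0" "s > 0" using assms by auto
  have RR: "R * R = D" using D R by simp
  have X: "X1 \<ge> 0" "X2 \<ge> 0" "X3 \<ge> 0" "X4 \<ge> 0"
    using pos by (auto simp: X1_def X2_def X3_def X4_def)
  have small: "e * A * B \<le> c * X1" if "e \<le> r * \<mu>" "r * R \<le> c * (A * B)" for r c
  proof -
    have "e * A * B \<le> r * \<mu> * A * B" using that pos by (intro mult_right_mono) auto
    also have "\<dots> = (r * R) * (R * A * B * s * t / n)" by (simp add: \<mu> RR[symmetric] field_simps)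
    also have "\<dots> \<le> (c * (A * B)) * (R * A * B * s * t / n)"
      using that pos by (intro mult_right_mono) auto
    finally show ?thesis by (simp add: X1_def power2_eq_square mult_ac)
  qed
  have "e * A * B \<le> 56 * (X1 + X2 + X3 + X4)"
  proof (cases "e \<le> exp 2 * \<mu>")
    case True
    \<comment> \<open>Here the edge count is comparable to \<mu>: exp 2 \<le> 9, and heaviness R < 4
      A B gives the constant 36.\<close>
    have "exp 2 = exp 1 * exp (1::real)" by (simp flip: exp_add)
    also have "\<dots> \<le> 3 * 3" using exp_le by (intro mult_mono) auto
    finally have "exp 2 * R \<le> 9 * (4 * A * B)" using act pos by (intro mult_mono) auto
    then have "e * A * B \<le> 36 * X1" using True by (intro small[of "exp 2"]) auto
    then show ?thesis using X unfolding distrib_left by linarith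
  next
    case False
    define r where "r = e / \<mu>"
    have e_r: "e = r * \<mu>" using pos by (simp add: r_def)
    have "exp 2 * \<mu> < r * \<mu>" using False e_r by simp
    then have r_gt: "r > exp 2" using pos by simp
    have r0: "r > 0" using r_gt exp_gt_zero[of "2::real"] by linarith
    have "ln (exp 2) < ln r" using r_gt r0 by (subst ln_less_cancel_iff) auto
    then have lnr: "ln r > 2" by simp
    \<comment> \<open>The fourth root of n/t. If ln r stays below a quarter of the logarithm
      \<Lambda>, then exponentiating gives r \<le> 2 q, and \<Lambda> = 1 + 4 ln q grows only
      logarithmically in q.\<close>
    define q where "q = exp (ln (n / t) / 4)"
    have q4: "q ^ 4 = n / t"
      using pos by (simp add: q_def flip: exp_of_nat_mult)
    have q1: "q \<ge> 1" using pos tn by (simp add: q_def)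
    define \<Lambda> where "\<Lambda> = ln (exp 1 * n / t)"
    have \<Lambda>: "\<Lambda> = 1 + 4 * ln q" using pos by (simp add: \<Lambda>_def q_def ln_mult ln_div)
    have \<Lambda>1: "\<Lambda> \<ge> 1" unfolding \<Lambda> using q1 by simp
    have disc: "e * ln r \<le> 14 * (t * \<Lambda>)" using disc False by (simp add: r_def \<Lambda>_def)
    show ?thesis
    proof (cases "ln r \<ge> \<Lambda> / 4")
      case True
      have "e * (\<Lambda> / 4) \<le> e * ln r" using True e by (intro mult_left_mono)
      then have "e * \<Lambda> \<le> (56 * t) * \<Lambda>" using disc by simp
      then have "e \<le> 56 * t" using \<Lambda>1 by (subst (asm) mult_le_cancel_right_pos) auto
      then have "e * A * B \<le> 56 * t * A * B" using pos by (intro mult_right_mono) auto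
      also have "\<dots> = 56 * X2" by (simp add: X2_def)
      finally have "e * A * B \<le> 56 * X2" .
      then show ?thesis using X unfolding distrib_left by linarith
    next
      case lnr_small: False
      have "r = exp (ln r)" using r0 by simp
      also have "\<dots> \<le> exp (1 / 4 + ln q)" using lnr_small by (simp add: \<Lambda>)
      also have "\<dots> = exp (1 / 4) * q" using q1 by (simp add: exp_add)
      also have "exp (1 / 4) \<le> (2 :: real)"
        using exp_bound[of "1/4"] by (simp add: power2_eq_square)
      finally have rq: "r \<le> 2 * q" using q1 by simp
      show ?thesis
      proof (cases "q \<le> B")
        case True
        show ?thesis
        proof (cases "r * R \<le> 1 * (A * B)")
          case rR: True
          then have "e * A * B \<le> 1 * X1" by (rule small[rotated]) (simp add: e_r)
          then show ?thesis using X unfolding distrib_left by linarith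
        next
          case False
          \<comment> \<open>Failure of r R \<le> A B with r \<le> 2 q \<le> 2 B forces A \<le> 2 R,
            the guard of the third term. Since ln r > 2, the discrepancy bound then gives e \<le> 14
            t \<Lambda> with \<Lambda> \<le> 4 B.\<close>
          have "r * R \<le> 2 * B * R" using rq True pos by (intro mult_right_mono) auto
          then have "A * B < (2 * R) * B" using False by (simp add: mult_ac)
          then have AR: "A \<le> 2 * R" using pos by simp
          have "e * 1 \<le> e * ln r" using lnr e by (intro mult_left_mono) auto
          then have "e \<le> 14 * (t * \<Lambda>)" using disc by linarith
          also have "\<Lambda> \<le> 4 * B"
          proof -
            have "ln q \<le> q - 1" using q1 by (intro ln_le_minus_one) auto
            then show ?thesis using True unfolding \<Lambda> by linarith
          qed
          finally have "e \<le> 14 * (t * (4 * B))" using pos by simp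
          then have "e * A * B \<le> 14 * (t * (4 * B)) * A * B" using pos by (intro mult_right_mono) auto
          then have "e * A * B \<le> 56 * X3" using AR by (simp add: X3_def power2_eq_square mult_ac)
          then show ?thesis using X unfolding distrib_left by linarith
        qed
      next
        case False
        have "e * A * B \<le> (2 * q * \<mu>) * A * B"
          unfolding e_r using rq pos by (intro mult_right_mono) auto
        also have "\<dots> = (2 * q * A * B * R * s) * (R * t / n)" by (simp add: \<mu> RR[symmetric] field_simps)
        \<comment> \<open>Heaviness trades one factor R for 4 A B. Then t/n = q^(-4) leaves the
          fourth term times 8 (B/q)^3, and B < q in this case.\<close>
        also have "\<dots> \<le> (2 * q * A * B * R * s) * (4 * A * B * t / n)"
          using act pos q1 by (intro mult_left_mono divide_right_mono mult_right_mono) auto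
        also have "\<dots> = (2 * q * A * B * R * s) * (4 * A * B) * (t / n)" by simp
        also have "\<dots> = (2 * q * A * B * R * s) * (4 * A * B) * (1 / q ^ 4)"
          using q4 pos by simp
        also have "\<dots> = 8 * X4 * (B / q) ^ 3"
          using q1 pos by (simp add: X4_def field_simps power2_eq_square power3_eq_cube power4_eq_xxxx)
        also have "\<dots> \<le> 8 * X4 * 1 ^ 3"
          using False X(4) pos q1 by (intro mult_left_mono power_mono) auto
        finally have "e * A * B \<le> 8 * X4" by simp
        then show ?thesis using X unfolding distrib_left by linarith
      qed
    qed
  qed
  then show ?thesis by (simp only: X1_def X2_def X3_def X4_def)
qed

lemma sum_powers_of_two_le:
  fixes Y :: real
  assumes "0 \<le> Y"
  shows "(\<Sum>a\<le>N. if 2 ^ a \<le> Y then 2 ^ a else 0 :: real) \<le> 2 * Y"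
proof (induction N)
  case 0
  then show ?case using assms by (cases "1 \<le> Y") simp_all
next
  case (Suc N)
  show ?case
  proof (cases "2 ^ Suc N \<le> Y")
    case True
    have "(\<Sum>a\<le>Suc N. if 2 ^ a \<le> Y then 2 ^ a else 0 :: real) \<le> (\<Sum>a\<le>Suc N. 2 ^ a)"
      by (intro sum_mono) auto
    also have "\<dots> = 2 ^ (Suc (Suc N)) - 1" by (induction N) auto
    also have "\<dots> \<le> 2 * Y" using True by simp
    finally show ?thesis .
  qed (use Suc in simp)
qed

lemma sum_inverse_powers_of_two_le: "(\<Sum>b\<le>N. 1 / 2 ^ b :: real) \<le> 2"
proof -
  have "(\<Sum>b\<le>N. 1 / 2 ^ b :: real) = 2 - 1 / 2 ^ N" by (induction N) auto
  then show ?thesis by simp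
qed

text \<open>Here \<alpha> and \<beta> are the shares of the levels in the squared norms, with totals
  at most 4 n. Each guard turns one of the two sums into a geometric series, leaving a total of
  \<alpha> or of \<beta>. The constants are 16 for the product, twice 16 + 16 + 8 for the remaining
  terms, and 56 * 96 = 5376.\<close>

lemma sum_heavy_levels:
  fixes \<alpha> \<beta> :: "nat \<Rightarrow> real" and E :: "nat \<Rightarrow> nat \<Rightarrow> real"
  assumes R: "R > 0" and n: "n > 0"
    and \<alpha>: "\<And>a. \<alpha> a \<ge> 0" "(\<Sum>a\<le>N. \<alpha> a) \<le> 4 * n" and \<beta>: "\<And>b. \<beta> b \<ge> 0" "(\<Sum>b\<le>N. \<beta> b) \<le> 4 * n"
    and E: "\<And>a b. E a b \<le> 56 * (R * \<alpha> a * \<beta> b / n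
       + (if 2 ^ a \<le> 2 * R * 2 ^ b then \<beta> b * 2 ^ a / 2 ^ b else 0)
       + (if 2 ^ a \<le> 2 * R then \<beta> b * 2 ^ a else 0) + R * \<alpha> a / 2 ^ b
       + (if 2 ^ b \<le> 2 * R * 2 ^ a then \<alpha> a * 2 ^ b / 2 ^ a else 0)
       + (if 2 ^ b \<le> 2 * R then \<alpha> a * 2 ^ b else 0) + R * \<beta> b / 2 ^ a)"
  shows "(\<Sum>a\<le>N. \<Sum>b\<le>N. E a b) \<le> 5376 * n * R"
proof -
  have half: "(\<Sum>a\<le>N. \<Sum>b\<le>N. if 2 ^ a \<le> 2 * R * 2 ^ b then g b * 2 ^ a / 2 ^ b else 0) \<le> 16 * n * R"
    "(\<Sum>a\<le>N. \<Sum>b\<le>N. if 2 ^ a \<le> 2 * R then g b * 2 ^ a else 0) \<le> 16 * n * R"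
    "(\<Sum>a\<le>N. \<Sum>b\<le>N. R * g b / 2 ^ a) \<le> 8 * n * R"
    if g: "\<And>b. g b \<ge> 0" "(\<Sum>b\<le>N. g b) \<le> 4 * n" for g :: "nat \<Rightarrow> real"
  proof -
    have "(\<Sum>a\<le>N. \<Sum>b\<le>N. if 2 ^ a \<le> 2 * R * 2 ^ b then g b * 2 ^ a / 2 ^ b else 0) =
      (\<Sum>b\<le>N. g b / 2 ^ b * (\<Sum>a\<le>N. if 2 ^ a \<le> 2 * R * 2 ^ b then 2 ^ a else 0))"
      unfolding sum_distrib_left by (subst sum.swap) (auto intro!: sum.cong)
    also have "\<dots> \<le> (\<Sum>b\<le>N. g b / 2 ^ b * (2 * (2 * R * 2 ^ b)))"
      using R g by (intro sum_mono mult_left_mono sum_powers_of_two_le) auto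
    also have "\<dots> = (\<Sum>b\<le>N. g b) * (4 * R)" unfolding sum_distrib_right by (intro sum.cong) auto
    also have "\<dots> \<le> 4 * n * (4 * R)" using R g by (intro mult_right_mono) auto
    finally show "(\<Sum>a\<le>N. \<Sum>b\<le>N. if 2 ^ a \<le> 2 * R * 2 ^ b then g b * 2 ^ a / 2 ^ b else 0) \<le> 16 * n * R" by simp
    have "(\<Sum>a\<le>N. \<Sum>b\<le>N. if 2 ^ a \<le> 2 * R then g b * 2 ^ a else 0) =
      (\<Sum>b\<le>N. g b * (\<Sum>a\<le>N. if 2 ^ a \<le> 2 * R then 2 ^ a else 0))"
      unfolding sum_distrib_left by (subst sum.swap) (auto intro!: sum.cong)
    also have "\<dots> \<le> (\<Sum>b\<le>N. g b * (2 * (2 * R)))"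
      using R g by (intro sum_mono mult_left_mono sum_powers_of_two_le) auto
    also have "\<dots> = (\<Sum>b\<le>N. g b) * (4 * R)" unfolding sum_distrib_right by (intro sum.cong) auto
    also have "\<dots> \<le> 4 * n * (4 * R)" using R g by (intro mult_right_mono) auto
    finally show "(\<Sum>a\<le>N. \<Sum>b\<le>N. if 2 ^ a \<le> 2 * R then g b * 2 ^ a else 0) \<le> 16 * n * R" by simp
    have "(\<Sum>a\<le>N. \<Sum>b\<le>N. R * g b / 2 ^ a) = R * (\<Sum>b\<le>N. g b) * (\<Sum>a\<le>N. 1 / 2 ^ a)"
      unfolding sum_distrib_left sum_distrib_right by (intro sum.cong) auto
    also have "\<dots> \<le> R * (4 * n) * 2"
      using R g n by (intro mult_mono sum_inverse_powers_of_two_le) (auto intro!: sum_nonneg)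
    finally show "(\<Sum>a\<le>N. \<Sum>b\<le>N. R * g b / 2 ^ a) \<le> 8 * n * R" by (simp add: mult_ac)
  qed
  have "(\<Sum>a\<le>N. \<Sum>b\<le>N. R * \<alpha> a * \<beta> b / n) = R / n * ((\<Sum>a\<le>N. \<alpha> a) * (\<Sum>b\<le>N. \<beta> b))"
    unfolding sum_product by (simp add: sum_distrib_left mult_ac)
  also have "\<dots> \<le> R / n * ((4 * n) * (4 * n))"
    using R n \<alpha> \<beta> by (intro mult_left_mono mult_mono) (auto intro!: sum_nonneg)
  also have "\<dots> = 16 * n * R" using n by simp
  finally have prod: "(\<Sum>a\<le>N. \<Sum>b\<le>N. R * \<alpha> a * \<beta> b / n) \<le> 16 * n * R" .
  have "(\<Sum>a\<le>N. \<Sum>b\<le>N. E a b) \<le> (\<Sum>a\<le>N. \<Sum>b\<le>N. 56 * (R * \<alpha> a * \<beta> b / n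
       + (if 2 ^ a \<le> 2 * R * 2 ^ b then \<beta> b * 2 ^ a / 2 ^ b else 0)
       + (if 2 ^ a \<le> 2 * R then \<beta> b * 2 ^ a else 0) + R * \<alpha> a / 2 ^ b
       + (if 2 ^ b \<le> 2 * R * 2 ^ a then \<alpha> a * 2 ^ b / 2 ^ a else 0)
       + (if 2 ^ b \<le> 2 * R then \<alpha> a * 2 ^ b else 0) + R * \<beta> b / 2 ^ a))"
    by (intro sum_mono E)
  also have "\<dots> = 56 * ((\<Sum>a\<le>N. \<Sum>b\<le>N. R * \<alpha> a * \<beta> b / n)
       + (\<Sum>a\<le>N. \<Sum>b\<le>N. if 2 ^ a \<le> 2 * R * 2 ^ b then \<beta> b * 2 ^ a / 2 ^ b else 0)
       + (\<Sum>a\<le>N. \<Sum>b\<le>N. if 2 ^ a \<le> 2 * R then \<beta> b * 2 ^ a else 0) + (\<Sum>b\<le>N. \<Sum>a\<le>N. R * \<alpha> a / 2 ^ b)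
       + (\<Sum>b\<le>N. \<Sum>a\<le>N. if 2 ^ b \<le> 2 * R * 2 ^ a then \<alpha> a * 2 ^ b / 2 ^ a else 0)
       + (\<Sum>b\<le>N. \<Sum>a\<le>N. if 2 ^ b \<le> 2 * R then \<alpha> a * 2 ^ b else 0) + (\<Sum>a\<le>N. \<Sum>b\<le>N. R * \<beta> b / 2 ^ a))"
    by (simp only: sum_distrib_left[symmetric] sum.distrib sum.swap[of "\<lambda>b a. R * \<alpha> a / 2 ^ b"]
      sum.swap[of "\<lambda>b a. if 2 ^ b \<le> 2 * R * 2 ^ a then \<alpha> a * 2 ^ b / 2 ^ a else 0"]
      sum.swap[of "\<lambda>b a. if 2 ^ b \<le> 2 * R then \<alpha> a * 2 ^ b else 0"])
  also have "\<dots> \<le> 56 * (16 * n * R + 16 * n * R + 16 * n * R + 8 * n * R + 16 * n * R + 16 * n * R + 8 * n * R)"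
    using prod half[OF \<alpha>] half[OF \<beta>] unfolding distrib_left by linarith
  finally show ?thesis by (simp add: mult_ac)
qed

section \<open>Dyadic decomposition of grid vectors\<close>

definition dyadic_level :: "int \<Rightarrow> nat" where
  "dyadic_level k = (SOME a. 2 ^ a \<le> nat \<bar>k\<bar> \<and> nat \<bar>k\<bar> < 2 ^ (a + 1))"

lemma dyadic_level:
  assumes "k \<noteq> 0"
  shows "2 ^ dyadic_level k \<le> \<bar>real_of_int k\<bar>" "\<bar>real_of_int k\<bar> < 2 * 2 ^ dyadic_level k"
proof -
  have "\<exists>a. 2 ^ a \<le> nat \<bar>k\<bar> \<and> nat \<bar>k\<bar> < 2 ^ (a + 1)"
    using assms by (intro ex_power_ivl1) auto
  then have *: "2 ^ dyadic_level k \<le> nat \<bar>k\<bar>" "nat \<bar>k\<bar> < 2 ^ (dyadic_level k + 1)"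
    unfolding dyadic_level_def by (rule someI2_ex, simp)+
  have "real (2 ^ dyadic_level k) \<le> real (nat \<bar>k\<bar>)" "real (nat \<bar>k\<bar>) < real (2 ^ (dyadic_level k + 1))"
    using * by (simp_all only: of_nat_le_iff of_nat_less_iff)
  then show "2 ^ dyadic_level k \<le> \<bar>real_of_int k\<bar>" "\<bar>real_of_int k\<bar> < 2 * 2 ^ dyadic_level k"
    by simp_all
qed

text \<open>Zero coordinates belong to no level: \<open>dyadic_level\<close> is unspecified at 0,
  and they contribute nothing to the sums.\<close>

definition level_set :: "nat \<Rightarrow> (nat \<Rightarrow> int) \<Rightarrow> nat \<Rightarrow> nat set" where
  "level_set n z a = {i. i < n \<and> z i \<noteq> 0 \<and> dyadic_level (z i) = a}"

lemma level_set_subset: "level_set n z a \<subseteq> {..<n}" "finite (level_set n z a)"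
  by (auto simp: level_set_def)

text \<open>A very crude bound suffices, because the sums over levels are bounded independently of
  the number of levels.\<close>

lemma grid_level_le:
  assumes "z \<in> grid n" "i < n" "z i \<noteq> 0"
  shows "dyadic_level (z i) \<le> 4 * n"
proof -
  have "real (dyadic_level (z i)) \<le> 2 ^ dyadic_level (z i)"
    using of_nat_less_two_power less_imp_le by blast
  also have "\<dots> \<le> \<bar>real_of_int (z i)\<bar>" using dyadic_level assms by blast
  also have "\<dots> \<le> (real_of_int (z i))\<^sup>2"
  proof -
    have "1 \<le> \<bar>real_of_int (z i)\<bar>" using assms(3) by linarith
    then have "\<bar>real_of_int (z i)\<bar> * 1 \<le> \<bar>real_of_int (z i)\<bar> * \<bar>real_of_int (z i)\<bar>" by (intro mult_left_mono) auto
    then show ?thesis by (simp add: power2_eq_square)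
  qed
  also have "\<dots> \<le> (\<Sum>i<n. (real_of_int (z i))\<^sup>2)"
    by (rule member_le_sum) (use assms in auto)
  also have "\<dots> \<le> real (4 * n)" using assms(1) by (simp add: grid_def)
  finally show ?thesis by (simp only: of_nat_le_iff)
qed

lemma sum_level_sets:
  fixes g :: "nat \<Rightarrow> real"
  assumes "z \<in> grid n" "\<And>i. i < n \<Longrightarrow> z i = 0 \<Longrightarrow> g i = 0"
  shows "(\<Sum>i<n. g i) = (\<Sum>a\<le>4 * n. \<Sum>i\<in>level_set n z a. g i)"
proof -
  have "(\<Sum>i<n. g i) = (\<Sum>i\<in>{i. i < n \<and> z i \<noteq> 0}. g i)"
    using assms by (intro sum.mono_neutral_right) auto
  also have "\<dots> = (\<Sum>a\<le>4 * n. \<Sum>i\<in>{i \<in> {i. i < n \<and> z i \<noteq> 0}. dyadic_level (z i) = a}. g i)"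
    by (rule sum.group[symmetric]) (use grid_level_le[OF assms(1)] in auto)
  also have "\<dots> = (\<Sum>a\<le>4 * n. \<Sum>i\<in>level_set n z a. g i)"
    by (intro sum.cong) (auto simp: level_set_def)
  finally show ?thesis .
qed

lemma sum_level_weights:
  assumes "z \<in> grid n"
  shows "(\<Sum>a\<le>4 * n. (2 ^ a)\<^sup>2 * real (card (level_set n z a))) \<le> 4 * real n"
proof -
  have "(\<Sum>a\<le>4 * n. (2 ^ a)\<^sup>2 * real (card (level_set n z a))) = (\<Sum>a\<le>4 * n. \<Sum>i\<in>level_set n z a. (2 ^ a)\<^sup>2)"
    by (simp add: mult.commute)
  also have "\<dots> \<le> (\<Sum>a\<le>4 * n. \<Sum>i\<in>level_set n z a. (real_of_int (z i))\<^sup>2)"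
  proof (intro sum_mono)
    fix a i assume "i \<in> level_set n z a"
    then have "(2 ^ a)\<^sup>2 \<le> \<bar>real_of_int (z i)\<bar>\<^sup>2"
      using dyadic_level(1)[of "z i"] by (intro power_mono) (auto simp: level_set_def)
    then show "(2 ^ a)\<^sup>2 \<le> (real_of_int (z i))\<^sup>2" by simp
  qed
  also have "\<dots> = (\<Sum>i<n. (real_of_int (z i))\<^sup>2)"
    by (rule sum_level_sets[symmetric]) (use assms in auto)
  also have "\<dots> \<le> 4 * real n" using assms by (simp add: grid_def)
  finally show ?thesis .
qed

text \<open>The estimate for one pair of levels wants the smaller set first. Adding the terms of
  both orders gives an expression that holds in either case. The conditions in \<open>act\<close>
  insert the guards without which the terms such as t A B could not be summed over the
  levels.\<close>

lemma heavy_level_sets_bound: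
  assumes D: "D > 0" and m: "\<And>i j. i < n \<Longrightarrow> j < n \<Longrightarrow> 0 \<le> m i j"
    and disc: "\<And>S T. S \<subseteq> {..<n} \<Longrightarrow> T \<subseteq> {..<n} \<Longrightarrow> S \<noteq> {} \<Longrightarrow> T \<noteq> {} \<Longrightarrow> \<not> discrepancy_violated n D m S T"
    and ST: "S \<subseteq> {..<n}" "T \<subseteq> {..<n}"
    and act: "sqrt D < 4 * 2 ^ a * 2 ^ b" "2 ^ a \<le> 2 * sqrt D * 2 ^ b" "2 ^ b \<le> 2 * sqrt D * 2 ^ a"
    and \<alpha>: "\<alpha> = (2 ^ a)\<^sup>2 * real (card S)" and \<beta>: "\<beta> = (2 ^ b)\<^sup>2 * real (card T)"
  shows "edge_count m S T * 2 ^ a * 2 ^ b \<le> 56 * (sqrt D * \<alpha> * \<beta> / real n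
       + (if 2 ^ a \<le> 2 * sqrt D * 2 ^ b then \<beta> * 2 ^ a / 2 ^ b else 0)
       + (if 2 ^ a \<le> 2 * sqrt D then \<beta> * 2 ^ a else 0) + sqrt D * \<alpha> / 2 ^ b
       + (if 2 ^ b \<le> 2 * sqrt D * 2 ^ a then \<alpha> * 2 ^ b / 2 ^ a else 0)
       + (if 2 ^ b \<le> 2 * sqrt D then \<alpha> * 2 ^ b else 0) + sqrt D * \<beta> / 2 ^ a)"
    (is "?e * _ * _ \<le> 56 * (?Y1 + ?Y2 + ?Y3 + ?Y4 + ?Y5 + ?Y6 + ?Y7)")
proof -
  have Y: "?Y1 \<ge> 0" "?Y2 \<ge> 0" "?Y3 \<ge> 0" "?Y4 \<ge> 0" "?Y5 \<ge> 0" "?Y6 \<ge> 0" "?Y7 \<ge> 0"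
    using D by (auto simp: \<alpha> \<beta>)
  have fin: "finite S" "finite T" using ST finite_subset by auto
  have e0: "0 \<le> ?e" unfolding edge_count_def using m ST by (intro sum_nonneg) auto
  show ?thesis
  proof (cases "S = {} \<or> T = {}")
    case True
    then have "?e = 0" by (auto simp: edge_count_def)
    then show ?thesis using Y by simp
  next
    case False
    then have ne: "S \<noteq> {}" "T \<noteq> {}" by auto
    let ?s = "real (card S)" and ?t = "real (card T)"
    have card: "1 \<le> ?s" "?s \<le> real n" "1 \<le> ?t" "?t \<le> real n"
      using ne fin ST card_mono[of "{..<n}"] by (auto simp: Suc_le_eq card_gt_0_iff)
    define \<mu> where "\<mu> = D * ?s * ?t / real n"
    have d: "?e \<le> exp 2 * \<mu> \<or> ?e * ln (?e / \<mu>) \<le> 14 * entropy n (max (card S) (card T))"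
      using disc[OF ST ne] by (auto simp: discrepancy_violated_def Let_def \<mu>_def not_less)
    show ?thesis
    proof (cases "card S \<le> card T")
      case True
      have "?e * 2 ^ a * 2 ^ b \<le> 56 * (sqrt D * (2 ^ a)\<^sup>2 * (2 ^ b)\<^sup>2 * ?s * ?t / real n + ?t * 2 ^ a * 2 ^ b +
          (if 2 ^ a \<le> 2 * sqrt D then ?t * 2 ^ a * (2 ^ b)\<^sup>2 else 0) + sqrt D * (2 ^ a)\<^sup>2 * ?s / 2 ^ b)"
        by (rule heavy_level_bound[where D = D and \<mu> = \<mu>])
          (use True card D e0 act d in \<open>auto simp: \<mu>_def entropy_def max_def\<close>)
      also have "\<dots> = 56 * (?Y1 + ?Y2 + ?Y3 + ?Y4)"
        using act by (simp add: \<alpha> \<beta> power2_eq_square mult_ac)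
      also have "\<dots> \<le> 56 * (?Y1 + ?Y2 + ?Y3 + ?Y4 + ?Y5 + ?Y6 + ?Y7)"
        by (intro mult_left_mono add_increasing2 order_refl Y) auto
      finally show ?thesis .
    next
      case False
      have "?e * 2 ^ b * 2 ^ a \<le> 56 * (sqrt D * (2 ^ b)\<^sup>2 * (2 ^ a)\<^sup>2 * ?t * ?s / real n + ?s * 2 ^ b * 2 ^ a +
          (if 2 ^ b \<le> 2 * sqrt D then ?s * 2 ^ b * (2 ^ a)\<^sup>2 else 0) + sqrt D * (2 ^ b)\<^sup>2 * ?t / 2 ^ a)"
        by (rule heavy_level_bound[where D = D and \<mu> = \<mu>])
          (use False card D e0 act d in \<open>auto simp: \<mu>_def entropy_def max_def mult_ac\<close>)
      also have "\<dots> = 56 * (?Y1 + ?Y5 + ?Y6 + ?Y7)"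
        using act by (simp add: \<alpha> \<beta> power2_eq_square mult_ac)
      also have "\<dots> \<le> 56 * (?Y1 + ?Y2 + ?Y3 + ?Y4 + ?Y5 + ?Y6 + ?Y7)"
        using Y(2-4) by simp
      finally show ?thesis by (simp only: mult_ac)
    qed
  qed
qed

text \<open>Replacing coordinates by the powers of two below them costs a factor 4 in the product
  and weakens the three conditions to \<open>act\<close>; hence 4 * 5376 = 21504.\<close>

lemma middle_sum_bound:
  fixes m :: "nat \<Rightarrow> nat \<Rightarrow> real"
  assumes D: "D > 0" and n: "n \<ge> 1" and m: "\<And>i j. i < n \<Longrightarrow> j < n \<Longrightarrow> 0 \<le> m i j"
    and disc: "\<And>S T. S \<subseteq> {..<n} \<Longrightarrow> T \<subseteq> {..<n} \<Longrightarrow> S \<noteq> {} \<Longrightarrow> T \<noteq> {} \<Longrightarrow> \<not> discrepancy_violated n D m S T"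
    and z: "z \<in> grid n" "w \<in> grid n"
    and x: "x = (\<lambda>i. \<bar>real_of_int (z i)\<bar>)" and y: "y = (\<lambda>i. \<bar>real_of_int (w i)\<bar>)"
  shows "(\<Sum>i<n. \<Sum>j<n. if sqrt D < x i * y j \<and> x i < sqrt D * y j \<and> y j < sqrt D * x i then m i j * (x i * y j) else 0)
    \<le> 21504 * real n * sqrt D"
proof -
  let ?R = "sqrt D" and ?N = "4 * n"
  let ?S = "level_set n z" and ?T = "level_set n w"
  let ?g = "\<lambda>i j. if ?R < x i * y j \<and> x i < ?R * y j \<and> y j < ?R * x i then m i j * (x i * y j) else 0"
  define act where "act a b \<longleftrightarrow> ?R < 4 * 2 ^ a * 2 ^ b \<and> 2 ^ a \<le> 2 * ?R * 2 ^ b \<and> 2 ^ b \<le> 2 * ?R * 2 ^ a" for a b :: nat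
  define E where "E a b = (if act a b then edge_count m (?S a) (?T b) * 2 ^ a * 2 ^ b else 0)" for a b
  define \<alpha> where "\<alpha> a = (2 ^ a)\<^sup>2 * real (card (?S a))" for a
  define \<beta> where "\<beta> b = (2 ^ b)\<^sup>2 * real (card (?T b))" for b
  have R: "?R > 0" using D by simp
  have "(\<Sum>i<n. \<Sum>j<n. ?g i j) = (\<Sum>a\<le>?N. \<Sum>i\<in>?S a. \<Sum>j<n. ?g i j)"
    by (rule sum_level_sets[OF z(1)]) (use R in \<open>auto simp: x\<close>)
  also have "\<dots> = (\<Sum>a\<le>?N. \<Sum>i\<in>?S a. \<Sum>b\<le>?N. \<Sum>j\<in>?T b. ?g i j)"
    by (intro sum.cong refl sum_level_sets[OF z(2)]) (use R in \<open>auto simp: y\<close>)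
  also have "\<dots> = (\<Sum>a\<le>?N. \<Sum>b\<le>?N. \<Sum>i\<in>?S a. \<Sum>j\<in>?T b. ?g i j)"
    by (intro sum.cong refl sum.swap)
  also have "\<dots> \<le> (\<Sum>a\<le>?N. \<Sum>b\<le>?N. 4 * E a b)"
  proof (intro sum_mono)
    fix a b
    have "(\<Sum>i\<in>?S a. \<Sum>j\<in>?T b. ?g i j) \<le> (\<Sum>i\<in>?S a. \<Sum>j\<in>?T b. if act a b then m i j * (4 * 2 ^ a * 2 ^ b) else 0)"
    proof (intro sum_mono)
      fix i j assume "i \<in> ?S a" "j \<in> ?T b"
      then have ij: "i < n" "j < n" "2 ^ a \<le> x i" "x i < 2 * 2 ^ a" "2 ^ b \<le> y j" "y j < 2 * 2 ^ b"
        using dyadic_level[of "z i"] dyadic_level[of "w j"] by (auto simp: level_set_def x y)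
      have pos: "0 < x i" "0 < y j" using ij(3,5) by (smt (verit) zero_less_power)+
      show "?g i j \<le> (if act a b then m i j * (4 * 2 ^ a * 2 ^ b) else 0)"
      proof (cases "?R < x i * y j \<and> x i < ?R * y j \<and> y j < ?R * x i")
        case True
        have xy: "x i * y j \<le> (2 * 2 ^ a) * (2 * 2 ^ b)"
          using ij pos by (intro mult_mono) auto
        moreover have "?R * y j \<le> ?R * (2 * 2 ^ b)" "?R * x i \<le> ?R * (2 * 2 ^ a)"
          using ij R by (auto intro!: mult_left_mono)
        ultimately have "act a b" using True ij unfolding act_def by (simp add: mult_ac)
        moreover have "m i j * (x i * y j) \<le> m i j * (4 * 2 ^ a * 2 ^ b)"
          using xy m[OF ij(1,2)] by (intro mult_left_mono) auto
        ultimately show ?thesis using True by simp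
      qed (use m[OF ij(1,2)] in auto)
    qed
    also have "\<dots> = 4 * E a b"
      by (simp add: E_def edge_count_def sum_distrib_left sum_distrib_right mult_ac)
    finally show "(\<Sum>i\<in>?S a. \<Sum>j\<in>?T b. ?g i j) \<le> 4 * E a b" .
  qed
  also have "\<dots> = 4 * (\<Sum>a\<le>?N. \<Sum>b\<le>?N. E a b)" by (simp add: sum_distrib_left)
  also have "(\<Sum>a\<le>?N. \<Sum>b\<le>?N. E a b) \<le> 5376 * real n * ?R"
  proof (rule sum_heavy_levels)
    fix a b
    show "E a b \<le> 56 * (?R * \<alpha> a * \<beta> b / real n
       + (if 2 ^ a \<le> 2 * ?R * 2 ^ b then \<beta> b * 2 ^ a / 2 ^ b else 0)
       + (if 2 ^ a \<le> 2 * ?R then \<beta> b * 2 ^ a else 0) + ?R * \<alpha> a / 2 ^ b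
       + (if 2 ^ b \<le> 2 * ?R * 2 ^ a then \<alpha> a * 2 ^ b / 2 ^ a else 0)
       + (if 2 ^ b \<le> 2 * ?R then \<alpha> a * 2 ^ b else 0) + ?R * \<beta> b / 2 ^ a)"
    proof (cases "act a b")
      case True
      have "edge_count m (?S a) (?T b) * 2 ^ a * 2 ^ b \<le> 56 * (?R * \<alpha> a * \<beta> b / real n
       + (if 2 ^ a \<le> 2 * ?R * 2 ^ b then \<beta> b * 2 ^ a / 2 ^ b else 0)
       + (if 2 ^ a \<le> 2 * ?R then \<beta> b * 2 ^ a else 0) + ?R * \<alpha> a / 2 ^ b
       + (if 2 ^ b \<le> 2 * ?R * 2 ^ a then \<alpha> a * 2 ^ b / 2 ^ a else 0)
       + (if 2 ^ b \<le> 2 * ?R then \<alpha> a * 2 ^ b else 0) + ?R * \<beta> b / 2 ^ a)"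
        by (rule heavy_level_sets_bound[OF D m disc])
          (use True level_set_subset in \<open>auto simp: act_def \<alpha>_def \<beta>_def\<close>)
      then show ?thesis using True by (simp only: E_def if_True)
    next
      case False
      have "0 \<le> \<alpha> a" "0 \<le> \<beta> b" by (simp_all add: \<alpha>_def \<beta>_def)
      then show ?thesis using R False unfolding E_def by (auto intro!: mult_nonneg_nonneg add_nonneg_nonneg)
    qed
  qed (use R n sum_level_weights[OF z(1)] sum_level_weights[OF z(2)] in \<open>auto simp: \<alpha>_def \<beta>_def\<close>)
  finally show ?thesis by simp
qed

text \<open>If one coordinate is at least R times the other, then the product is at most the larger
  square divided by R, and a row or column sum at most D = R^2 gives R times the squared norm. This
  is the place where the bound on the row sums enters. The two unbalanced regimes add 4 + 4 to
  21504.\<close>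

lemma heavy_sum_bound:
  fixes m :: "nat \<Rightarrow> nat \<Rightarrow> real"
  assumes D: "D > 0" and n: "n \<ge> 1" and m: "\<And>i j. i < n \<Longrightarrow> j < n \<Longrightarrow> 0 \<le> m i j"
    and row: "\<And>i. i < n \<Longrightarrow> (\<Sum>j<n. m i j) \<le> D" and col: "\<And>j. j < n \<Longrightarrow> (\<Sum>i<n. m i j) \<le> D"
    and disc: "\<And>S T. S \<subseteq> {..<n} \<Longrightarrow> T \<subseteq> {..<n} \<Longrightarrow> S \<noteq> {} \<Longrightarrow> T \<noteq> {} \<Longrightarrow> \<not> discrepancy_violated n D m S T"
    and z: "z \<in> grid n" "w \<in> grid n"
  shows "(\<Sum>i<n. \<Sum>j<n. if sqrt D < \<bar>real_of_int (z i) * real_of_int (w j)\<bar>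
      then m i j * (real_of_int (z i) * real_of_int (w j)) else 0) \<le> 21512 * real n * sqrt D"
proof -
  let ?R = "sqrt D"
  define x where "x = (\<lambda>i. \<bar>real_of_int (z i)\<bar>)"
  define y where "y = (\<lambda>i. \<bar>real_of_int (w i)\<bar>)"
  have R: "?R > 0" and RR: "D / ?R = ?R" using D by (auto simp: real_div_sqrt)
  have sq: "(\<Sum>i<n. (x i)\<^sup>2) \<le> 4 * real n" "(\<Sum>i<n. (y i)\<^sup>2) \<le> 4 * real n"
    using z by (simp_all add: x_def y_def grid_def)
  let ?g = "\<lambda>i j. if ?R < x i * y j \<and> x i < ?R * y j \<and> y j < ?R * x i then m i j * (x i * y j) else 0"
  have "(\<Sum>i<n. \<Sum>j<n. if ?R < \<bar>real_of_int (z i) * real_of_int (w j)\<bar>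
      then m i j * (real_of_int (z i) * real_of_int (w j)) else 0) \<le>
    (\<Sum>i<n. \<Sum>j<n. m i j * ((x i)\<^sup>2 / ?R) + m i j * ((y j)\<^sup>2 / ?R) + ?g i j)"
  proof (intro sum_mono)
    fix i j assume "i \<in> {..<n}" "j \<in> {..<n}"
    then have m0: "0 \<le> m i j" using m by auto
    have xy: "0 \<le> x i" "0 \<le> y j" "\<bar>real_of_int (z i) * real_of_int (w j)\<bar> = x i * y j"
      by (simp_all add: x_def y_def abs_mult)
    have nn: "0 \<le> m i j * ((x i)\<^sup>2 / ?R)" "0 \<le> m i j * ((y j)\<^sup>2 / ?R)" "0 \<le> ?g i j"
      using m0 R xy by auto
    have "x i * y j \<le> (x i)\<^sup>2 / ?R" if "?R * y j \<le> x i"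
      using mult_left_mono[OF that xy(1)] R by (simp add: field_simps power2_eq_square)
    moreover have "x i * y j \<le> (y j)\<^sup>2 / ?R" if "?R * x i \<le> y j"
      using mult_left_mono[OF that xy(2)] R by (simp add: field_simps power2_eq_square)
    ultimately have "?R < x i * y j \<Longrightarrow> m i j * (x i * y j) \<le> m i j * ((x i)\<^sup>2 / ?R) + m i j * ((y j)\<^sup>2 / ?R) + ?g i j"
      using nn m0 mult_left_mono[of "x i * y j" "(x i)\<^sup>2 / ?R" "m i j"]
        mult_left_mono[of "x i * y j" "(y j)\<^sup>2 / ?R" "m i j"] by (smt (verit))
    moreover have "m i j * (real_of_int (z i) * real_of_int (w j)) \<le> m i j * (x i * y j)"
      using m0 xy(3) by (intro mult_left_mono) auto
    ultimately show "(if ?R < \<bar>real_of_int (z i) * real_of_int (w j)\<bar>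
      then m i j * (real_of_int (z i) * real_of_int (w j)) else 0) \<le>
        m i j * ((x i)\<^sup>2 / ?R) + m i j * ((y j)\<^sup>2 / ?R) + ?g i j"
      using nn unfolding xy(3) by (smt (verit))
  qed
  also have "\<dots> = (\<Sum>i<n. (\<Sum>j<n. m i j) * ((x i)\<^sup>2 / ?R)) + (\<Sum>j<n. (\<Sum>i<n. m i j) * ((y j)\<^sup>2 / ?R)) + (\<Sum>i<n. \<Sum>j<n. ?g i j)"
    unfolding sum.distrib sum_distrib_right by (subst (2) sum.swap) (rule refl)
  also have "\<dots> \<le> (\<Sum>i<n. D * ((x i)\<^sup>2 / ?R)) + (\<Sum>j<n. D * ((y j)\<^sup>2 / ?R)) + 21504 * real n * ?R"
    using R row col middle_sum_bound[OF D n m disc z x_def y_def]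
    by (intro add_mono sum_mono mult_right_mono) auto
  also have "\<dots> = ?R * (\<Sum>i<n. (x i)\<^sup>2) + ?R * (\<Sum>j<n. (y j)\<^sup>2) + 21504 * real n * ?R"
  proof -
    have "D * (t / ?R) = ?R * t" for t using RR by (metis times_divide_eq_left times_divide_eq_right)
    then show ?thesis by (simp add: sum_distrib_left)
  qed
  also have "\<dots> \<le> ?R * (4 * real n) + ?R * (4 * real n) + 21504 * real n * ?R"
    using R sq by (intro add_mono mult_left_mono) auto
  finally show ?thesis by (simp add: mult_ac)
qed

subsection \<open>The quadratic form of the centered adjacency matrix\<close>

text \<open>Since the objective is linear, every coordinate may be rounded in the favourable direction, so
  no convexity or covering argument is needed.\<close>

lemma grid_rounding:
  assumes x: "inprod n x x \<le> real n"
  shows "\<exists>z\<in>grid n. inprod n x g \<le> inprod n (\<lambda>i. real_of_int (z i)) g"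
proof
  define z where "z i = (if 0 \<le> g i then \<lceil>x i\<rceil> else \<lfloor>x i\<rfloor>)" for i
  have near: "\<bar>real_of_int (z i) - x i\<bar> \<le> 1" for i
    by (simp add: z_def) linarith
  \<comment> \<open>Rounding moves a coordinate by at most 1, so the squared norm becomes at most 2
    n + 2 n, which is the radius chosen in \<open>grid\<close>.\<close>
  have "(real_of_int (z i))\<^sup>2 \<le> 2 * (x i * x i) + 2" for i
  proof -
    have "(real_of_int (z i) - x i)\<^sup>2 \<le> 1"
      using near[of i] by (simp add: abs_square_le_1)
    moreover have "(real_of_int (z i))\<^sup>2 \<le> 2 * (x i * x i) + 2 * (real_of_int (z i) - x i)\<^sup>2"
      using zero_le_power2[of "real_of_int (z i) - 2 * x i"] by (simp add: power2_eq_square algebra_simps)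
    ultimately show ?thesis by linarith
  qed
  then have "(\<Sum>i<n. (real_of_int (z i))\<^sup>2) \<le> (\<Sum>i<n. 2 * (x i * x i) + 2)"
    by (intro sum_mono)
  also have "\<dots> = 2 * inprod n x x + 2 * real n"
    by (simp add: inprod_def sum.distrib sum_distrib_left)
  also have "\<dots> \<le> 4 * real n" using x by simp
  finally show "z \<in> grid n" by (simp add: grid_def)
  have "x i * g i \<le> real_of_int (z i) * g i" for i
  proof (cases "0 \<le> g i")
    case True
    then show ?thesis by (intro mult_right_mono) (auto simp: z_def)
  next
    case False
    then show ?thesis by (intro mult_right_mono_neg) (auto simp: z_def)
  qed
  then show "inprod n x g \<le> inprod n (\<lambda>i. real_of_int (z i)) g"
    unfolding inprod_def by (intro sum_mono)
qed

lemma inprod_app_transpose: "inprod n x (mat_app n a y) = inprod n y (mat_app n (\<lambda>i j. a j i) x)"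
proof -
  have "inprod n x (mat_app n a y) = (\<Sum>i<n. \<Sum>j<n. x i * (a i j * y j))"
    by (simp add: inprod_def mat_app_def sum_distrib_left)
  also have "\<dots> = (\<Sum>j<n. \<Sum>i<n. x i * (a i j * y j))" by (rule sum.swap)
  also have "\<dots> = inprod n y (mat_app n (\<lambda>i j. a j i) x)"
    by (simp add: inprod_def mat_app_def sum_distrib_left mult_ac)
  finally show ?thesis .
qed

text \<open>The form is linear in each argument separately, so the left vector is rounded with the
  right one fixed and then the right one against the rounded left one. This is why grid vectors are
  tested in pairs although only the quadratic form is wanted.\<close>

lemma form_bound_of_grid:
  assumes n: "n \<ge> 1"
    and grid: "\<And>z w. z \<in> grid n \<Longrightarrow> w \<in> grid n \<Longrightarrow>
      inprod n (\<lambda>i. real_of_int (z i)) (mat_app n a (\<lambda>j. real_of_int (w j))) \<le> C * real n"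
  shows "\<bar>inprod n x (mat_app n a x)\<bar> \<le> C * inprod n x x"
proof -
  have round: "inprod n x (mat_app n a y) \<le> C * real n" if x: "inprod n x x \<le> real n" and y: "inprod n y y \<le> real n" for x y
  proof -
    obtain z where z: "z \<in> grid n" "inprod n x (mat_app n a y) \<le> inprod n (\<lambda>i. real_of_int (z i)) (mat_app n a y)"
      using grid_rounding[OF x] by blast
    let ?g = "mat_app n (\<lambda>i j. a j i) (\<lambda>i. real_of_int (z i))"
    obtain w where w: "w \<in> grid n" "inprod n y ?g \<le> inprod n (\<lambda>i. real_of_int (w i)) ?g"
      using grid_rounding[OF y] by blast
    have "inprod n (\<lambda>i. real_of_int (z i)) (mat_app n a y) = inprod n y ?g" by (rule inprod_app_transpose)
    also have "\<dots> \<le> inprod n (\<lambda>i. real_of_int (w i)) ?g" by (rule w(2))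
    also have "\<dots> = inprod n (\<lambda>i. real_of_int (z i)) (mat_app n a (\<lambda>j. real_of_int (w j)))"
      by (rule inprod_app_transpose[symmetric])
    also have "\<dots> \<le> C * real n" by (rule grid[OF z(1) w(1)])
    finally show ?thesis using z(2) by linarith
  qed
  define s where "s = inprod n x x"
  show ?thesis
  proof (cases "s = 0")
    case True
    then have "x i = 0" if "i < n" for i using inprod_pos[OF that, of x] by (auto simp: s_def)
    then have "inprod n x (mat_app n a x) = 0" by (simp add: inprod_def)
    then show ?thesis using True by (simp add: s_def)
  next
    case False
    then have s: "s > 0" using inprod_nonneg[of n x] by (simp add: s_def)
    \<comment> \<open>Scaling to squared norm \<open>n\<close>, the size for which rounding is set
      up. Changing the sign of the left argument alone gives the lower bound.\<close>
    define c where "c = sqrt (real n / s)"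
    have cc: "c * c = real n / s" using s by (simp add: c_def)
    have cx: "inprod n (\<lambda>i. c * x i) (\<lambda>i. c * x i) = real n" "inprod n (\<lambda>i. - c * x i) (\<lambda>i. - c * x i) = real n"
      unfolding inprod_scale_left inprod_scale_right s_def[symmetric] using s cc by (simp_all flip: mult.assoc)
    have "mat_app n a (\<lambda>i. c * x i) = (\<lambda>i. c * mat_app n a x i)" by (simp add: fun_eq_iff mat_app_scale)
    then have form: "inprod n (\<lambda>i. c * x i) (mat_app n a (\<lambda>i. c * x i)) = real n / s * inprod n x (mat_app n a x)"
      "inprod n (\<lambda>i. - c * x i) (mat_app n a (\<lambda>i. c * x i)) = - (real n / s * inprod n x (mat_app n a x))"
      by (simp_all only: inprod_scale_left inprod_scale_right) (simp_all only: cc[symmetric] mult.assoc mult_minus_left)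
    have "real n / s * inprod n x (mat_app n a x) \<le> C * real n"
      using round[of "\<lambda>i. c * x i" "\<lambda>i. c * x i"] unfolding form cx by simp
    moreover have "- (real n / s * inprod n x (mat_app n a x)) \<le> C * real n"
      using round[of "\<lambda>i. - c * x i" "\<lambda>i. c * x i"] unfolding form cx by simp
    ultimately have "\<bar>real n / s * inprod n x (mat_app n a x)\<bar> \<le> C * real n" by linarith
    then have "real n / s * \<bar>inprod n x (mat_app n a x)\<bar> \<le> C * real n" using s by (simp add: abs_mult)
    then have "real n * \<bar>inprod n x (mat_app n a x)\<bar> \<le> real n * (C * s)" using s by (simp add: field_simps)
    then show ?thesis using n unfolding s_def[symmetric] by simp
  qed
qed

text \<open>Light couples are compared with the light sum of the full graph, at a cost of
  \<open>sqrt D\<close> per deleted edge. Heavy couples are split into the edge part and the mean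
  part; in the latter |y| \<le> y^2 / sqrt D and n p \<le> D give 16 n \<open>sqrt D\<close>. The
  total 30 + 1 + 21512 + 16 = 21559 is rounded up.\<close>

lemma centered_form_bound:
  assumes p: "edge_probabilities n p" and D: "D > 0" and n: "n \<ge> 1"
    and np: "\<And>i j. i < j \<Longrightarrow> j < n \<Longrightarrow> real n * p i j \<le> D"
    and light: "\<And>z w. z \<in> grid n \<Longrightarrow> w \<in> grid n \<Longrightarrow> light_sum n p D G z w \<le> 30 * real n * sqrt D"
    and disc: "\<And>S T. S \<subseteq> {..<n} \<Longrightarrow> T \<subseteq> {..<n} \<Longrightarrow> S \<noteq> {} \<Longrightarrow> T \<noteq> {} \<Longrightarrow> \<not> discrepancy_violated n D (upper G) S T"
    and m: "\<And>i j. i < n \<Longrightarrow> j < n \<Longrightarrow> 0 \<le> m i j \<and> m i j \<le> upper G i j"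
    and row: "\<And>i. i < n \<Longrightarrow> (\<Sum>j<n. m i j) \<le> D" and col: "\<And>j. j < n \<Longrightarrow> (\<Sum>i<n. m i j) \<le> D"
    and removed: "(\<Sum>i<n. \<Sum>j<n. upper G i j - m i j) \<le> real n"
  shows "\<bar>inprod n x (mat_app n (\<lambda>i j. m i j - upper_mean p i j) x)\<bar> \<le> 21600 * sqrt D * inprod n x x"
proof (rule form_bound_of_grid[OF n])
  fix z w assume zw: "z \<in> grid n" "w \<in> grid n"
  let ?R = "sqrt D"
  define y where "y i j = real_of_int (z i) * real_of_int (w j)" for i j
  have R: "?R > 0" using D by simp
  have "inprod n (\<lambda>i. real_of_int (z i)) (mat_app n (\<lambda>i j. m i j - upper_mean p i j) (\<lambda>j. real_of_int (w j)))
      = (\<Sum>i<n. \<Sum>j<n. (m i j - upper_mean p i j) * y i j)"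
    by (simp add: inprod_def mat_app_def sum_distrib_left y_def mult_ac)
  also have "\<dots> \<le> (\<Sum>i<n. \<Sum>j<n. (if \<bar>y i j\<bar> \<le> ?R then (upper G i j - upper_mean p i j) * y i j else 0)
      + ?R * (upper G i j - m i j)
      + (if ?R < \<bar>y i j\<bar> then m i j * y i j else 0)
      + 1 / real n * ?R * ((real_of_int (z i))\<^sup>2 * (real_of_int (w j))\<^sup>2))"
  proof (intro sum_mono)
    fix i j assume "i \<in> {..<n}" "j \<in> {..<n}"
    then have ij: "i < n" "j < n" by auto
    define M where "M = upper_mean p i j"
    have M: "0 \<le> M" "M \<le> D / real n"
      using np[of i j] ij p D n by (auto simp: M_def upper_mean_def edge_probabilities_def field_simps)
    have sq: "(real_of_int (z i))\<^sup>2 * (real_of_int (w j))\<^sup>2 = (y i j)\<^sup>2"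
      by (simp add: y_def power_mult_distrib)
    have q0: "0 \<le> 1 / real n * ?R * (y i j)\<^sup>2" using R by simp
    show "(m i j - upper_mean p i j) * y i j \<le>
      (if \<bar>y i j\<bar> \<le> ?R then (upper G i j - upper_mean p i j) * y i j else 0)
      + ?R * (upper G i j - m i j)
      + (if ?R < \<bar>y i j\<bar> then m i j * y i j else 0)
      + 1 / real n * ?R * ((real_of_int (z i))\<^sup>2 * (real_of_int (w j))\<^sup>2)"
    proof (cases "\<bar>y i j\<bar> \<le> ?R")
      case True
      have "- y i j * (upper G i j - m i j) \<le> ?R * (upper G i j - m i j)"
        using m[OF ij] True by (intro mult_right_mono) auto
      then show ?thesis using True q0 unfolding sq M_def[symmetric] by (simp add: algebra_simps)
    next
      case False
      have "M * - y i j \<le> M * ((y i j)\<^sup>2 / ?R)"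
      proof (rule mult_left_mono)
        have "?R * \<bar>y i j\<bar> \<le> \<bar>y i j\<bar> * \<bar>y i j\<bar>" using False by (intro mult_right_mono) auto
        then have "\<bar>y i j\<bar> \<le> (y i j)\<^sup>2 / ?R" using R by (simp add: field_simps power2_eq_square)
        then show "- y i j \<le> (y i j)\<^sup>2 / ?R" by linarith
      qed (rule M)
      also have "\<dots> \<le> D / real n * ((y i j)\<^sup>2 / ?R)" using M R by (intro mult_right_mono) auto
      also have "\<dots> = 1 / real n * (D / ?R) * (y i j)\<^sup>2" by simp
      also have "D / ?R = ?R" using D by (simp add: real_div_sqrt)
      finally have "M * - y i j \<le> 1 / real n * ?R * (y i j)\<^sup>2" .
      moreover have "0 \<le> ?R * (upper G i j - m i j)" using R m[OF ij] by simp
      ultimately show ?thesis using False unfolding sq M_def[symmetric] by (simp add: left_diff_distrib)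
    qed
  qed
  also have "\<dots> = light_sum n p D G z w + ?R * (\<Sum>i<n. \<Sum>j<n. upper G i j - m i j)
      + (\<Sum>i<n. \<Sum>j<n. if ?R < \<bar>y i j\<bar> then m i j * y i j else 0)
      + 1 / real n * ?R * ((\<Sum>i<n. (real_of_int (z i))\<^sup>2) * (\<Sum>j<n. (real_of_int (w j))\<^sup>2))"
    unfolding sum_product by (simp only: sum.distrib light_sum_def y_def sum_distrib_left)
  also have "\<dots> \<le> 30 * real n * ?R + ?R * real n + 21512 * real n * ?R + 1 / real n * ?R * ((4 * real n) * (4 * real n))"
  proof (intro add_mono)
    show "light_sum n p D G z w \<le> 30 * real n * ?R" by (rule light[OF zw])
    show "?R * (\<Sum>i<n. \<Sum>j<n. upper G i j - m i j) \<le> ?R * real n" using R removed by (intro mult_left_mono) auto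
    show "(\<Sum>i<n. \<Sum>j<n. if ?R < \<bar>y i j\<bar> then m i j * y i j else 0) \<le> 21512 * real n * ?R"
      unfolding y_def
    proof (rule heavy_sum_bound[OF D n _ row col _ zw])
      fix S T assume ST: "S \<subseteq> {..<n}" "T \<subseteq> {..<n}" "S \<noteq> {}" "T \<noteq> {}"
      show "\<not> discrepancy_violated n D m S T"
      proof
        assume "discrepancy_violated n D m S T"
        then have "discrepancy_violated n D (upper G) S T"
          by (rule discrepancy_violated_mono[OF _ D ST, rotated]) (use m ST in blast)
        then show False using disc[OF ST] by blast
      qed
    qed (use m in auto)
    show "1 / real n * ?R * ((\<Sum>i<n. (real_of_int (z i))\<^sup>2) * (\<Sum>j<n. (real_of_int (w j))\<^sup>2))
        \<le> 1 / real n * ?R * ((4 * real n) * (4 * real n))"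
      using R zw by (intro mult_left_mono mult_mono) (auto simp: grid_def intro!: sum_nonneg)
  qed
  also have "\<dots> = 21559 * (real n * ?R)" using n by simp
  also have "\<dots> \<le> 21600 * (real n * ?R)" using R by (intro mult_right_mono) auto
  finally show "inprod n (\<lambda>i. real_of_int (z i)) (mat_app n (\<lambda>i j. m i j - upper_mean p i j) (\<lambda>j. real_of_int (w j)))
      \<le> 21600 * ?R * real n" by (simp add: mult_ac)
qed

section \<open>From the upper triangle to the adjacency matrix\<close>

definition adj :: "graph \<Rightarrow> nat \<Rightarrow> nat \<Rightarrow> real" where
  "adj G i j = of_bool (G (min i j, max i j))"

lemma adj_symm: "adj G i j = adj G j i"
  by (simp add: adj_def min.commute max.commute)

lemma adj_bounds: "0 \<le> adj G i j" "adj G i j \<le> 1"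
  by (simp_all add: adj_def)

lemma adjacency_matrix_adj: "adjacency_matrix n G = mat n n (\<lambda>(i, j). adj G i j)"
  by (simp add: adjacency_matrix_def adj_def)

lemma vertex_degree_adj: "i < n \<Longrightarrow> vertex_degree n G i = (\<Sum>j<n. adj G i j)"
  by (simp add: vertex_degree_def adjacency_matrix_adj)

lemma form_sum: "inprod n x (mat_app n a x) = (\<Sum>i<n. \<Sum>j<n. a i j * (x i * x j))"
  by (simp add: inprod_def mat_app_def sum_distrib_left mult_ac)

lemma symm_form_upper:
  assumes "symm n b"
  shows "inprod n x (mat_app n b x) = 2 * inprod n x (mat_app n (\<lambda>i j. if i < j then b i j else 0) x) + (\<Sum>i<n. b i i * (x i)\<^sup>2)"
proof -
  have "inprod n x (mat_app n b x) = (\<Sum>i<n. \<Sum>j<n. (if i < j then b i j else 0) * (x i * x j)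
      + (if j < i then b j i else 0) * (x j * x i) + of_bool (i = j) * (b i i * (x i)\<^sup>2))"
    unfolding form_sum
  proof (intro sum.cong refl)
    fix i j assume "i \<in> {..<n}" "j \<in> {..<n}"
    then have "b i j = b j i" using assms by (simp add: symm_def)
    then show "b i j * (x i * x j) = (if i < j then b i j else 0) * (x i * x j)
      + (if j < i then b j i else 0) * (x j * x i) + of_bool (i = j) * (b i i * (x i)\<^sup>2)"
      by (cases i j rule: linorder_cases) (simp_all add: power2_eq_square)
  qed
  also have "\<dots> = inprod n x (mat_app n (\<lambda>i j. if i < j then b i j else 0) x)
      + (\<Sum>i<n. \<Sum>j<n. (if j < i then b j i else 0) * (x j * x i))
      + (\<Sum>i<n. \<Sum>j<n. of_bool (i = j) * (b i i * (x i)\<^sup>2))"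
    unfolding form_sum sum.distrib ..
  also have "(\<Sum>i<n. \<Sum>j<n. (if j < i then b j i else 0) * (x j * x i)) =
      inprod n x (mat_app n (\<lambda>i j. if i < j then b i j else 0) x)"
    unfolding form_sum by (rule sum.swap)
  also have "(\<Sum>i<n. \<Sum>j<n. of_bool (i = j) * (b i i * (x i)\<^sup>2)) = (\<Sum>i<n. b i i * (x i)\<^sup>2)"
    by (intro sum.cong refl) (simp add: sum_of_bool_eq_mult)
  finally show ?thesis by simp
qed

lemma form_diff: "inprod n x (mat_app n (\<lambda>i j. a i j - b i j) x) = inprod n x (mat_app n a x) - inprod n x (mat_app n b x)"
  unfolding form_sum by (simp add: left_diff_distrib sum_subtractf)

text \<open>Schur's test: each product is split into two squares, and the row sums bound both
  halves. This is the source of the summand d in part (a).\<close>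

lemma mean_form_bound:
  assumes p: "edge_probabilities n p" and d: "\<And>i. i < n \<Longrightarrow> (\<Sum>j<n. p i j) \<le> d"
  shows "\<bar>inprod n x (mat_app n p x)\<bar> \<le> d * inprod n x x"
proof -
  have "\<bar>inprod n x (mat_app n p x)\<bar> \<le> (\<Sum>i<n. \<Sum>j<n. \<bar>p i j * (x i * x j)\<bar>)"
    unfolding form_sum by (intro order_trans[OF sum_abs] sum_mono sum_abs)
  also have "\<dots> \<le> (\<Sum>i<n. \<Sum>j<n. p i j * ((x i)\<^sup>2 / 2) + p j i * ((x j)\<^sup>2 / 2))"
  proof (intro sum_mono)
    fix i j assume "i \<in> {..<n}" "j \<in> {..<n}"
    then have pij: "0 \<le> p i j" "p j i = p i j" using p by (auto simp: edge_probabilities_def)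
    have "\<bar>x i * x j\<bar> \<le> (x i)\<^sup>2 / 2 + (x j)\<^sup>2 / 2"
      using sum_squares_bound[of "\<bar>x i\<bar>" "\<bar>x j\<bar>"] by (simp add: abs_mult)
    then have "p i j * \<bar>x i * x j\<bar> \<le> p i j * ((x i)\<^sup>2 / 2 + (x j)\<^sup>2 / 2)"
      using pij by (intro mult_left_mono)
    then show "\<bar>p i j * (x i * x j)\<bar> \<le> p i j * ((x i)\<^sup>2 / 2) + p j i * ((x j)\<^sup>2 / 2)"
      using pij by (simp add: abs_mult[of "p i j"] distrib_left)
  qed
  also have "\<dots> = (\<Sum>i<n. (\<Sum>j<n. p i j) * ((x i)\<^sup>2 / 2)) + (\<Sum>j<n. (\<Sum>i<n. p j i) * ((x j)\<^sup>2 / 2))"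
    unfolding sum.distrib sum_distrib_right by (subst (2) sum.swap) (rule refl)
  also have "\<dots> \<le> (\<Sum>i<n. d * ((x i)\<^sup>2 / 2)) + (\<Sum>j<n. d * ((x j)\<^sup>2 / 2))"
    using d by (intro add_mono sum_mono mult_right_mono) auto
  also have "\<dots> = d * inprod n x x"
    by (simp add: inprod_def power2_eq_square sum_distrib_left flip: sum_divide_distrib)
  finally show ?thesis .
qed

definition quasirandom :: "nat \<Rightarrow> (nat \<Rightarrow> nat \<Rightarrow> real) \<Rightarrow> real \<Rightarrow> graph \<Rightarrow> bool" where
  "quasirandom n p D G \<longleftrightarrow> (\<forall>z\<in>grid n. \<forall>w\<in>grid n. light_sum n p D G z w \<le> 30 * real n * sqrt D) \<and>
     (\<forall>S\<subseteq>{..<n}. \<forall>T\<subseteq>{..<n}. S \<noteq> {} \<longrightarrow> T \<noteq> {} \<longrightarrow> \<not> discrepancy_violated n D (upper G) S T)"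

lemma prob_not_quasirandom:
  assumes p: "edge_probabilities n p" and D: "D > 0" and n: "n \<ge> 1"
    and np: "\<And>i j. i < j \<Longrightarrow> j < n \<Longrightarrow> real n * p i j \<le> D"
  shows "measure_pmf.prob (random_graph n p) {G. \<not> quasirandom n p D G} \<le> exp (- 2 * real n) + 1 / real n"
proof -
  have eq: "{G. \<not> quasirandom n p D G} =
    {G. (\<exists>z\<in>grid n. \<exists>w\<in>grid n. light_sum n p D G z w > 30 * real n * sqrt D) \<or>
     (\<exists>S\<subseteq>{..<n}. \<exists>T\<subseteq>{..<n}. S \<noteq> {} \<and> T \<noteq> {} \<and> discrepancy_violated n D (upper G) S T)}"
    unfolding quasirandom_def by (intro Collect_cong) (simp only: not_le[symmetric], blast)
  note prob_Un_le[of "random_graph n p"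
      "\<lambda>G. \<exists>z\<in>grid n. \<exists>w\<in>grid n. light_sum n p D G z w > 30 * real n * sqrt D"
      "\<lambda>G. \<exists>S\<subseteq>{..<n}. \<exists>T\<subseteq>{..<n}. S \<noteq> {} \<and> T \<noteq> {} \<and> discrepancy_violated n D (upper G) S T"]
  moreover have "measure_pmf.prob (random_graph n p)
      {G. \<exists>z\<in>grid n. \<exists>w\<in>grid n. light_sum n p D G z w > 30 * real n * sqrt D} \<le> exp (- 2 * real n)"
    by (rule prob_light_sum[OF p D np])
  moreover have "measure_pmf.prob (random_graph n p)
      {G. \<exists>S\<subseteq>{..<n}. \<exists>T\<subseteq>{..<n}. S \<noteq> {} \<and> T \<noteq> {} \<and> discrepancy_violated n D (upper G) S T} \<le> 1 / real n"
    by (rule prob_discrepancy[OF p D n np])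
  ultimately show ?thesis unfolding eq by linarith
qed

text \<open>\<open>s\<close> is the part of the graph that is split off. The factor 2 * 21600 comes
  from the two triangles. Loops are never split off, and the diagonal entries, differences of
  numbers in [0, 1], account for the additive 1.\<close>

lemma adj_form_bound:
  assumes p: "edge_probabilities n p" and D: "D > 0" and n: "n \<ge> 1"
    and np: "\<And>i j. i < j \<Longrightarrow> j < n \<Longrightarrow> real n * p i j \<le> D"
    and quasi: "quasirandom n p D G"
    and s: "\<And>i j. s i j = s j i" "\<And>i j. 0 \<le> s i j \<and> s i j \<le> adj G i j" "\<And>i. s i i = 0"
    and row: "\<And>i. i < n \<Longrightarrow> (\<Sum>j<n. adj G i j - s i j) \<le> D"
    and removed: "(\<Sum>i<n. \<Sum>j<n. s i j) \<le> real n"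
  shows "\<bar>inprod n x (mat_app n (adj G) x) - inprod n x (mat_app n s x) - inprod n x (mat_app n p x)\<bar> \<le> (43200 * sqrt D + 1) * inprod n x x"
proof -
  define m where "m i j = (if i < j then adj G i j - s i j else 0)" for i j
  define b where "b i j = adj G i j - s i j - p i j" for i j
  have up: "upper G i j = (if i < j then adj G i j else 0)" for i j
    by (simp add: upper_def adj_def min_def max_def)
  have m_le: "0 \<le> m i j" "m i j \<le> adj G i j - s i j" for i j
    using s(2)[of i j] by (auto simp: m_def)
  have "\<bar>inprod n x (mat_app n (\<lambda>i j. m i j - upper_mean p i j) x)\<bar> \<le> 21600 * sqrt D * inprod n x x"
  proof (rule centered_form_bound[OF p D n np])
    fix i assume i: "i < n"
    have "(\<Sum>j<n. m i j) \<le> (\<Sum>j<n. adj G i j - s i j)" by (intro sum_mono m_le)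
    then show "(\<Sum>j<n. m i j) \<le> D" using row[OF i] by linarith
    have "(\<Sum>j<n. m j i) \<le> (\<Sum>j<n. adj G i j - s i j)"
      by (intro sum_mono) (metis m_le(2) adj_symm s(1))
    then show "(\<Sum>j<n. m j i) \<le> D" using row[OF i] by linarith
  next
    have "(\<Sum>i<n. \<Sum>j<n. upper G i j - m i j) \<le> (\<Sum>i<n. \<Sum>j<n. s i j)"
      using s(2) by (intro sum_mono) (auto simp: up m_def)
    then show "(\<Sum>i<n. \<Sum>j<n. upper G i j - m i j) \<le> real n" using removed by linarith
  next
    fix i j
    show "0 \<le> m i j \<and> m i j \<le> upper G i j" using s(2)[of i j] by (auto simp: up m_def)
  qed (use quasi in \<open>auto simp: quasirandom_def\<close>)
  moreover have "symm n b"
    using s(1) p by (auto simp: symm_def b_def adj_symm edge_probabilities_def)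
  then have "inprod n x (mat_app n b x) = 2 * inprod n x (mat_app n (\<lambda>i j. m i j - upper_mean p i j) x) + (\<Sum>i<n. b i i * (x i)\<^sup>2)"
    using symm_form_upper[of n b x]
    by (simp add: b_def m_def upper_mean_def if_distrib cong: if_cong)
  moreover have "\<bar>\<Sum>i<n. b i i * (x i)\<^sup>2\<bar> \<le> inprod n x x"
  proof -
    have "\<bar>\<Sum>i<n. b i i * (x i)\<^sup>2\<bar> \<le> (\<Sum>i<n. \<bar>b i i * (x i)\<^sup>2\<bar>)" by (rule sum_abs)
    also have "\<dots> \<le> (\<Sum>i<n. 1 * (x i)\<^sup>2)"
    proof (intro sum_mono)
      fix i assume "i \<in> {..<n}"
      then have "0 \<le> p i i" "p i i \<le> 1" using p by (auto simp: edge_probabilities_def)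
      then have "\<bar>b i i\<bar> \<le> 1" using adj_bounds[of G i i] s(3)[of i] by (simp add: b_def)
      then show "\<bar>b i i * (x i)\<^sup>2\<bar> \<le> 1 * (x i)\<^sup>2"
        unfolding abs_mult by (intro mult_mono) auto
    qed
    finally show ?thesis by (simp add: inprod_def power2_eq_square)
  qed
  moreover have "inprod n x (mat_app n b x) = inprod n x (mat_app n (adj G) x) - inprod n x (mat_app n s x) - inprod n x (mat_app n p x)"
    unfolding b_def form_diff ..
  ultimately show ?thesis by (simp add: distrib_right)
qed

subsection \<open>Disjoint stars\<close>

text \<open>Leaves avoid all centres and are not shared, so \<open>star_adj\<close> is a
  vertex-disjoint union of stars and its form splits over the centres.\<close>

locale stars =
  fixes n :: nat and U :: "nat set" and N :: "nat \<Rightarrow> nat set"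
  assumes U: "U \<subseteq> {..<n}"
    and N: "\<And>u. u \<in> U \<Longrightarrow> N u \<subseteq> {..<n} - U"
    and disj: "\<And>u w. u \<in> U \<Longrightarrow> w \<in> U \<Longrightarrow> u \<noteq> w \<Longrightarrow> N u \<inter> N w = {}"
begin

definition star_adj :: "nat \<Rightarrow> nat \<Rightarrow> real" where
  "star_adj i j = of_bool (i \<in> U \<and> j \<in> N i \<or> j \<in> U \<and> i \<in> N j)"

lemma finite_U: "finite U"
  using U by (rule finite_subset) simp

lemma finite_N: "u \<in> U \<Longrightarrow> finite (N u)"
  using N by (rule finite_subset) simp_all

lemma star_form: "inprod n x (mat_app n star_adj x) = 2 * (\<Sum>u\<in>U. \<Sum>v\<in>N u. x u * x v)"
proof -
  let ?h = "\<lambda>i j. of_bool (i \<in> U \<and> j \<in> N i) * (x i * x j)"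
  have "inprod n x (mat_app n star_adj x) = (\<Sum>i<n. \<Sum>j<n. ?h i j + ?h j i)"
    unfolding form_sum
  proof (intro sum.cong refl)
    fix i j
    have "\<not> ((i \<in> U \<and> j \<in> N i) \<and> (j \<in> U \<and> i \<in> N j))" using N by blast
    then show "star_adj i j * (x i * x j) = ?h i j + ?h j i"
      by (auto simp: star_adj_def)
  qed
  also have "\<dots> = (\<Sum>i<n. \<Sum>j<n. ?h i j) + (\<Sum>i<n. \<Sum>j<n. ?h j i)"
    by (simp only: sum.distrib)
  also have "(\<Sum>i<n. \<Sum>j<n. ?h j i) = (\<Sum>i<n. \<Sum>j<n. ?h i j)" by (rule sum.swap)
  also have "(\<Sum>i<n. \<Sum>j<n. ?h i j) = (\<Sum>i\<in>U. \<Sum>j<n. ?h i j)"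
    using U by (intro sum.mono_neutral_right) auto
  also have "\<dots> = (\<Sum>u\<in>U. \<Sum>v\<in>N u. x u * x v)"
    using N by (intro sum.cong refl sum.mono_neutral_cong_right) auto
  finally show ?thesis by simp
qed

lemma sum_stars:
  fixes h :: "nat \<Rightarrow> real"
  shows "(\<Sum>u\<in>U. h u + (\<Sum>v\<in>N u. h v)) = sum h (U \<union> (\<Union>u\<in>U. N u))"
proof -
  have "sum h (\<Union>u\<in>U. N u) = (\<Sum>u\<in>U. \<Sum>v\<in>N u. h v)"
    by (rule sum.UNION_disjoint) (use finite_U finite_N disj in auto)
  moreover have "U \<inter> (\<Union>u\<in>U. N u) = {}" using N by blast
  then have "sum h (U \<union> (\<Union>u\<in>U. N u)) = sum h U + sum h (\<Union>u\<in>U. N u)"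
    by (intro sum.union_disjoint) (use finite_U finite_N in auto)
  ultimately show ?thesis by (simp add: sum.distrib)
qed

text \<open>Weighted arithmetic-geometric mean: 2 |x_u x_v| \<le> x_u^2 / sqrt c + sqrt c x_v^2,
  summed over at most c leaves. Centres where x vanishes may have any number of leaves; this is what
  the constraints in the min-max argument exploit.\<close>

lemma star_form_le:
  assumes \<sigma>: "\<bar>\<sigma>\<bar> = 1" and c: "0 \<le> c" "\<And>u. u \<in> U \<Longrightarrow> x u \<noteq> 0 \<Longrightarrow> real (card (N u)) \<le> c"
  shows "\<sigma> * inprod n x (mat_app n star_adj x) \<le> sqrt c * inprod n x x"
proof -
  have "\<sigma> * inprod n x (mat_app n star_adj x) = (\<Sum>u\<in>U. \<Sum>v\<in>N u. \<sigma> * (2 * (x u * x v)))"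
    unfolding star_form sum_distrib_left ..
  also have "\<dots> \<le> (\<Sum>u\<in>U. sqrt c * (x u)\<^sup>2 + (\<Sum>v\<in>N u. sqrt c * (x v)\<^sup>2))"
  proof (rule sum_mono)
    fix u assume u: "u \<in> U"
    show "(\<Sum>v\<in>N u. \<sigma> * (2 * (x u * x v))) \<le> sqrt c * (x u)\<^sup>2 + (\<Sum>v\<in>N u. sqrt c * (x v)\<^sup>2)"
    \<comment> \<open>For c = 0 the weight 1 / sqrt c is useless, but then a centre with x u
      \<noteq> 0 has no leaves at all.\<close>
    proof (cases "x u = 0 \<or> c = 0")
      case True
      have "(\<Sum>v\<in>N u. \<sigma> * (2 * (x u * x v))) = 0"
      proof (cases "x u = 0")
        case False
        then have "card (N u) = 0" using True c(2)[OF u] by simp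
        then have "N u = {}" using finite_N[OF u] by simp
        then show ?thesis by simp
      qed simp
      then show ?thesis using c by (simp add: sum_nonneg)
    next
      case False
      then have c0: "c > 0" using c by simp
      have "\<sigma> * (2 * (x u * x v)) \<le> (x u)\<^sup>2 / sqrt c + sqrt c * (x v)\<^sup>2" for v
      proof -
        define q where "q = sqrt (sqrt c)"
        have q: "q > 0" "q * q = sqrt c" using c0 by (simp_all add: q_def)
        have s2: "\<sigma> * \<sigma> = 1" using \<sigma> by (auto simp: abs_if split: if_splits)
        have "0 \<le> (x u / q - \<sigma> * q * x v)\<^sup>2" by simp
        also have "\<dots> = (x u)\<^sup>2 / (q * q) + (\<sigma> * \<sigma>) * (q * q) * (x v)\<^sup>2 - \<sigma> * (2 * (x u * x v))"
          using q(1) by (simp add: power2_eq_square field_simps)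
        finally show ?thesis unfolding q(2) s2 by simp
      qed
      then have "(\<Sum>v\<in>N u. \<sigma> * (2 * (x u * x v))) \<le> (\<Sum>v\<in>N u. (x u)\<^sup>2 / sqrt c + sqrt c * (x v)\<^sup>2)"
        by (intro sum_mono)
      also have "\<dots> = real (card (N u)) * ((x u)\<^sup>2 / sqrt c) + (\<Sum>v\<in>N u. sqrt c * (x v)\<^sup>2)"
        by (simp add: sum.distrib)
      also have "real (card (N u)) * ((x u)\<^sup>2 / sqrt c) \<le> c * ((x u)\<^sup>2 / sqrt c)"
        using c(2)[OF u] False c0 by (intro mult_right_mono) auto
      also have "c * ((x u)\<^sup>2 / sqrt c) = sqrt c * (x u)\<^sup>2"
        using c0 by (metis less_imp_le real_div_sqrt times_divide_eq_left times_divide_eq_right)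
      finally show ?thesis by simp
    qed
  qed
  also have "\<dots> = sqrt c * sum (\<lambda>i. (x i)\<^sup>2) (U \<union> (\<Union>u\<in>U. N u))"
    unfolding sum_stars[symmetric] by (simp add: sum_distrib_left distrib_left)
  also have "\<dots> \<le> sqrt c * (\<Sum>i<n. (x i)\<^sup>2)"
    using c U N by (intro mult_left_mono sum_mono2) auto
  finally show ?thesis by (simp add: inprod_def power2_eq_square)
qed

text \<open>For nonempty \<open>N u\<close> and \<sigma> = 1 or -1 this is the eigenvector of the
  star for the eigenvalue \<sigma> sqrt |N u|, normalised to 1 at the centre, with squared norm
  2.\<close>

definition star_vec :: "real \<Rightarrow> nat \<Rightarrow> nat \<Rightarrow> real" where
  "star_vec \<sigma> u i = of_bool (i = u) + \<sigma> * of_bool (i \<in> N u) / sqrt (real (card (N u)))"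

text \<open>Different stars have disjoint supports, so norm and form are sums over centres. Only an
  inequality is claimed for the norm because a star without leaves contributes 1 instead of
  2.\<close>

lemma star_form_ge:
  fixes \<pi> :: "nat \<Rightarrow> nat"
  assumes \<sigma>: "\<bar>\<sigma>\<bar> = 1" and \<pi>: "inj_on \<pi> {..<k}" "\<pi> ` {..<k} \<subseteq> U"
    and c: "0 \<le> c" "\<And>b. b < k \<Longrightarrow> c \<le> real (card (N (\<pi> b)))"
    and x: "x = (\<lambda>i. \<Sum>b<k. a b * star_vec \<sigma> (\<pi> b) i)" and a: "\<exists>b<k. a b \<noteq> 0"
  shows "0 < inprod n x x" "sqrt c * inprod n x x \<le> \<sigma> * inprod n x (mat_app n star_adj x)"
proof -
  \<comment> \<open>The coefficients, reindexed from ranks to centres; zero at centres outside the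
    family.\<close>
  define \<gamma> where "\<gamma> u = (\<Sum>b<k. of_bool (\<pi> b = u) * a b)" for u
  have s2: "\<sigma> * \<sigma> = 1" using \<sigma> by (auto simp: abs_if split: if_splits)
  have \<gamma>_\<pi>: "\<gamma> (\<pi> b) = a b" if "b < k" for b
  proof -
    have "\<gamma> (\<pi> b) = (\<Sum>b'<k. of_bool (b' = b) * a b')"
      unfolding \<gamma>_def using \<pi>(1) that by (intro sum.cong) (auto simp: inj_on_def)
    also have "\<dots> = a b" using that by (subst sum_of_bool_eq_mult) auto
    finally show ?thesis .
  qed
  have \<gamma>0: "\<gamma> u = 0" if "u \<notin> \<pi> ` {..<k}" for u
    unfolding \<gamma>_def using that by (intro sum.neutral) auto
  have x_U: "x u = \<gamma> u" if "u \<in> U" for u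
    unfolding x \<gamma>_def
  proof (intro sum.cong refl)
    fix b assume "b \<in> {..<k}"
    then have "u \<notin> N (\<pi> b)" using \<pi>(2) N that by blast
    then show "a b * star_vec \<sigma> (\<pi> b) u = of_bool (\<pi> b = u) * a b"
      by (auto simp: star_vec_def)
  qed
  have x_N: "x v = \<sigma> * \<gamma> u / sqrt (real (card (N u)))" if "u \<in> U" "v \<in> N u" for u v
  proof -
    have "x v = (\<Sum>b<k. \<sigma> / sqrt (real (card (N u))) * (of_bool (\<pi> b = u) * a b))"
      unfolding x
    proof (intro sum.cong refl)
      fix b assume b: "b \<in> {..<k}"
      then have \<pi>b: "\<pi> b \<in> U" using \<pi>(2) by auto
      then have "v \<noteq> \<pi> b" "v \<in> N (\<pi> b) \<longleftrightarrow> \<pi> b = u" using N[OF that(1)] that disj by blast+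
      then show "a b * star_vec \<sigma> (\<pi> b) v = \<sigma> / sqrt (real (card (N u))) * (of_bool (\<pi> b = u) * a b)"
        by (auto simp: star_vec_def)
    qed
    also have "\<dots> = \<sigma> / sqrt (real (card (N u))) * \<gamma> u"
      by (simp only: \<gamma>_def sum_distrib_left)
    finally show ?thesis by simp
  qed
  have x_out: "x i = 0" if "i \<notin> U \<union> (\<Union>u\<in>U. N u)" for i
    unfolding x
  proof (intro sum.neutral ballI)
    fix b assume "b \<in> {..<k}"
    then have "\<pi> b \<in> U" using \<pi>(2) by auto
    then show "a b * star_vec \<sigma> (\<pi> b) i = 0" using that by (auto simp: star_vec_def)
  qed
  have "inprod n x x = (\<Sum>i<n. (x i)\<^sup>2)" by (simp add: inprod_def power2_eq_square)
  also have "\<dots> = sum (\<lambda>i. (x i)\<^sup>2) (U \<union> (\<Union>u\<in>U. N u))"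
    using U N x_out by (intro sum.mono_neutral_right) auto
  also have "\<dots> = (\<Sum>u\<in>U. (x u)\<^sup>2 + (\<Sum>v\<in>N u. (x v)\<^sup>2))" by (rule sum_stars[symmetric])
  also have "\<dots> \<le> (\<Sum>u\<in>U. 2 * (\<gamma> u)\<^sup>2)"
  proof (rule sum_mono)
    fix u assume u: "u \<in> U"
    have "(\<Sum>v\<in>N u. (x v)\<^sup>2) = (\<Sum>v\<in>N u. (\<sigma> * \<sigma>) * ((\<gamma> u)\<^sup>2 / real (card (N u))))"
      by (intro sum.cong refl) (simp add: x_N[OF u] power2_eq_square)
    also have "\<dots> \<le> (\<gamma> u)\<^sup>2" by (cases "card (N u) = 0") (simp_all add: s2)
    finally show "(x u)\<^sup>2 + (\<Sum>v\<in>N u. (x v)\<^sup>2) \<le> 2 * (\<gamma> u)\<^sup>2" by (simp add: x_U[OF u])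
  qed
  finally have norm: "inprod n x x \<le> (\<Sum>u\<in>U. 2 * (\<gamma> u)\<^sup>2)" .
  have "sqrt c * inprod n x x \<le> sqrt c * (\<Sum>u\<in>U. 2 * (\<gamma> u)\<^sup>2)"
    using norm c by (intro mult_left_mono) auto
  also have "\<dots> = (\<Sum>u\<in>U. sqrt c * (2 * (\<gamma> u)\<^sup>2))" by (rule sum_distrib_left)
  also have "\<dots> \<le> (\<Sum>u\<in>U. 2 * \<sigma> * (\<Sum>v\<in>N u. x u * x v))"
  proof (rule sum_mono)
    fix u assume u: "u \<in> U"
    have "(\<Sum>v\<in>N u. x u * x v) = (\<Sum>v\<in>N u. \<sigma> * (\<gamma> u)\<^sup>2 / sqrt (real (card (N u))))"
      by (intro sum.cong refl) (simp add: x_U[OF u] x_N[OF u] power2_eq_square)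
    also have "\<dots> = \<sigma> * (\<gamma> u)\<^sup>2 * (real (card (N u)) / sqrt (real (card (N u))))" by simp
    also have "\<dots> = \<sigma> * (\<gamma> u)\<^sup>2 * sqrt (real (card (N u)))" by (simp add: real_div_sqrt)
    finally have "2 * \<sigma> * (\<Sum>v\<in>N u. x u * x v) = (\<sigma> * \<sigma>) * (sqrt (real (card (N u))) * (2 * (\<gamma> u)\<^sup>2))"
      by (simp add: mult_ac)
    moreover have "sqrt c * (2 * (\<gamma> u)\<^sup>2) \<le> sqrt (real (card (N u))) * (2 * (\<gamma> u)\<^sup>2)"
    proof (cases "u \<in> \<pi> ` {..<k}")
      case True
      then show ?thesis using c by (intro mult_right_mono) auto
    qed (simp add: \<gamma>0)
    ultimately show "sqrt c * (2 * (\<gamma> u)\<^sup>2) \<le> 2 * \<sigma> * (\<Sum>v\<in>N u. x u * x v)" by (simp add: s2)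
  qed
  also have "\<dots> = \<sigma> * inprod n x (mat_app n star_adj x)"
    unfolding star_form by (simp add: sum_distrib_left mult_ac)
  finally show "sqrt c * inprod n x x \<le> \<sigma> * inprod n x (mat_app n star_adj x)" .
  from a obtain b where b: "b < k" "a b \<noteq> 0" by blast
  then have "\<pi> b \<in> U" using \<pi>(2) by auto
  then show "0 < inprod n x x" using b U by (intro inprod_pos[of "\<pi> b"]) (auto simp: x_U \<gamma>_\<pi>)
qed

lemma star_adj_le:
  assumes G: "\<And>u v. u \<in> U \<Longrightarrow> v \<in> N u \<Longrightarrow> adj G u v = 1"
  shows "star_adj i j = star_adj j i" "0 \<le> star_adj i j \<and> star_adj i j \<le> adj G i j" "star_adj i i = 0"
proof -
  show "star_adj i j = star_adj j i" by (auto simp: star_adj_def)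
  show "star_adj i i = 0" using N by (auto simp: star_adj_def)
  have "adj G i j = 1" if "i \<in> U \<and> j \<in> N i \<or> j \<in> U \<and> i \<in> N j"
    using that G adj_symm[of G i j] by auto
  then show "0 \<le> star_adj i j \<and> star_adj i j \<le> adj G i j"
    using adj_bounds[of G i j] by (auto simp: star_adj_def)
qed

text \<open>Upper bound: make the test vector vanish at the \<open>k - 1\<close> vertices of largest
  degree; the other centres have at most \<open>deg (\<pi> (k - 1))\<close> leaves. Lower bound: if
  this degree is at least K, the first \<open>k\<close> vertices are centres and their star vectors
  lose at most sqrt K. Otherwise it is enough that the eigenvalue is at least -\<tau>: vectors
  vanishing on \<open>U\<close> annihilate the star form, so this holds up to rank n - |U|.\<close>

lemma star_eigenvalue_estimate:
  assumes \<sigma>: "\<bar>\<sigma>\<bar> = 1"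
    and deg: "decreasing_perm n deg \<pi>" "\<And>i. i < n \<Longrightarrow> 0 \<le> deg i"
    and U_deg: "\<And>i. i < n \<Longrightarrow> K \<le> deg i \<Longrightarrow> i \<in> U"
    and N_deg: "\<And>u. u \<in> U \<Longrightarrow> real (card (N u)) \<le> deg u \<and> deg u \<le> real (card (N u)) + K"
    and symm: "symm n A"
    and form: "\<And>x. \<bar>inprod n x (mat_app n A x) - inprod n x (mat_app n star_adj x)\<bar> \<le> \<tau> * inprod n x x"
    and k: "1 \<le> k" "k + card U \<le> n" and K: "0 \<le> K"
  shows "\<bar>eigval k n (\<lambda>i j. \<sigma> * A i j) - sqrt (deg (\<pi> (k - 1)))\<bar> \<le> \<tau> + sqrt K"
proof -
  let ?A = "\<lambda>i j. \<sigma> * A i j" and ?dk = "deg (\<pi> (k - 1))"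
  have kn: "k \<in> {1..n}" using k by auto
  have symm': "symm n ?A" using symm by (auto simp: symm_def)
  have \<pi>: "\<pi> b < n" if "b < n" for b
    using deg(1) that by (auto simp: decreasing_perm_def bij_betw_def)
  have \<pi>_le: "deg (\<pi> c) \<le> deg (\<pi> b)" if "b \<le> c" "c < n" for b c
    using deg(1) that by (auto simp: decreasing_perm_def)
  have dk: "0 \<le> ?dk" using deg(2) \<pi> k by auto
  have sform: "\<bar>inprod n x (mat_app n ?A x) - \<sigma> * inprod n x (mat_app n star_adj x)\<bar> \<le> \<tau> * inprod n x x" for x
  proof -
    have "mat_app n ?A x = (\<lambda>i. \<sigma> * mat_app n A x i)" by (simp add: mat_app_def fun_eq_iff sum_distrib_left mult_ac)
    then have "inprod n x (mat_app n ?A x) - \<sigma> * inprod n x (mat_app n star_adj x) = \<sigma> * (inprod n x (mat_app n A x) - inprod n x (mat_app n star_adj x))"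
      by (simp add: inprod_scale_right right_diff_distrib)
    then show ?thesis using form[of x] \<sigma> by (simp add: abs_mult)
  qed
  have "eigval k n ?A \<le> sqrt ?dk + \<tau>"
  proof (rule eigval_le_of_constraints[where g = "\<lambda>b i. of_bool (i = \<pi> b)", OF symm' kn])
    fix x assume x0: "\<And>b. b < k - 1 \<Longrightarrow> inprod n (\<lambda>i. of_bool (i = \<pi> b)) x = 0"
    have "\<sigma> * inprod n x (mat_app n star_adj x) \<le> sqrt ?dk * inprod n x x"
    proof (rule star_form_le[OF \<sigma> dk])
      fix u assume u: "u \<in> U" "x u \<noteq> 0"
      then have "u < n" using U by auto
      moreover have "\<pi> ` {..<n} = {..<n}" using deg(1) by (simp add: decreasing_perm_def bij_betw_def)
      ultimately have "u \<in> \<pi> ` {..<n}" by simp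
      then obtain j where j: "j < n" "u = \<pi> j" by auto
      have "\<not> j < k - 1"
      proof
        assume "j < k - 1"
        then have "x (\<pi> j) = 0" using x0[of j] \<pi>[OF j(1)] by (simp add: inprod_def sum_of_bool_eq_mult)
        then show False using u j by simp
      qed
      then have "deg u \<le> ?dk" using \<pi>_le[of "k - 1" j] j by simp
      then show "real (card (N u)) \<le> ?dk" using N_deg[OF u(1)] by linarith
    qed
    then show "inprod n x (mat_app n ?A x) \<le> (sqrt ?dk + \<tau>) * inprod n x x"
      using sform[of x] by (simp add: distrib_right)
  qed
  moreover have "sqrt ?dk - sqrt K - \<tau> \<le> eigval k n ?A"
  proof (cases "K \<le> ?dk")
    case True
    have \<pi>U: "\<pi> b \<in> U" "?dk \<le> deg (\<pi> b)" if "b < k" for b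
    proof -
      have "b \<le> k - 1" "k - 1 < n" "b < n" using that k by auto
      then show "?dk \<le> deg (\<pi> b)" "\<pi> b \<in> U"
        using \<pi>_le[of b "k - 1"] True U_deg[of "\<pi> b"] \<pi>[of b] by auto
    qed
    have "sqrt (?dk - K) - \<tau> \<le> eigval k n ?A"
    proof (rule eigval_ge_of_family[OF symm' kn])
      fix a :: "nat \<Rightarrow> real" and x assume a: "\<exists>b<k. a b \<noteq> 0" and x: "x = (\<lambda>i. \<Sum>b<k. a b * star_vec \<sigma> (\<pi> b) i)"
      have inj: "inj_on \<pi> {..<k}"
        using deg(1) k by (auto simp: decreasing_perm_def bij_betw_def intro: inj_on_subset)
      have c: "?dk - K \<le> real (card (N (\<pi> b)))" if "b < k" for b
        using \<pi>U[OF that] N_deg[of "\<pi> b"] by fastforce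
      have "\<pi> ` {..<k} \<subseteq> U" "0 \<le> ?dk - K" using \<pi>U True by auto
      note star_form_ge[OF \<sigma> inj this c x a]
      then show "0 < inprod n x x \<and> (sqrt (?dk - K) - \<tau>) * inprod n x x \<le> inprod n x (mat_app n ?A x)"
        using sform[of x] by (auto simp: left_diff_distrib)
    qed
    moreover have "sqrt ?dk \<le> sqrt (?dk - K) + sqrt K"
      using sqrt_add_le_add_sqrt[of "?dk - K" K] True K by simp
    ultimately show ?thesis by linarith
  next
    case False
    define m where "m = card U"
    obtain e where e: "bij_betw e {..<m} U"
      using ex_bij_betw_nat_finite[OF finite_U] by (auto simp: m_def lessThan_atLeast0)
    have "- \<tau> \<le> eigval (n - m) n ?A"
    proof (rule eigval_ge_of_constraints[where g = "\<lambda>b i. of_bool (i = e b)", OF symm'])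
      show "m < n" using k by (simp add: m_def)
      fix x assume x0: "\<And>b. b < m \<Longrightarrow> inprod n (\<lambda>i. of_bool (i = e b)) x = 0"
      have "x u = 0" if "u \<in> U" for u
      proof -
        obtain b where b: "b < m" "u = e b" using e \<open>u \<in> U\<close> by (auto simp: bij_betw_def)
        have "u < n" using that U by auto
        then show ?thesis using x0[OF b(1)] b(2) by (simp add: inprod_def sum_of_bool_eq_mult)
      qed
      then have "inprod n x (mat_app n star_adj x) = 0" by (simp add: star_form)
      then show "- \<tau> * inprod n x x \<le> inprod n x (mat_app n ?A x)" using sform[of x] by simp
    qed
    also have "\<dots> \<le> eigval k n ?A"
      by (rule eigval_antimono[OF symm']) (use k in \<open>auto simp: m_def\<close>)
    finally have "- \<tau> \<le> eigval k n ?A" .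
    moreover have "sqrt ?dk \<le> sqrt K" using False by simp
    ultimately show ?thesis by linarith
  qed
  moreover have "0 \<le> sqrt K" using K by simp
  ultimately show ?thesis by linarith
qed

end

subsection \<open>Local structure around vertices of large degree\<close>

definition edge :: "nat \<Rightarrow> nat \<Rightarrow> nat \<times> nat" where
  "edge u v = (min u v, max u v)"

lemma edge_eq_iff: "edge u v = edge u' v' \<longleftrightarrow> u = u' \<and> v = v' \<or> u = v' \<and> v = u'"
  by (auto simp: edge_def min_def max_def split: if_splits)

lemma adj_edge: "adj G u v = of_bool (G (edge u v))"
  by (simp add: adj_def edge_def)

definition distinct_lists :: "nat \<Rightarrow> nat \<Rightarrow> nat list set" where
  "distinct_lists n m = {xs. set xs \<subseteq> {..<n} \<and> length xs = m \<and> distinct xs}"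

text \<open>First moment bound over at most n^m placements. All prescribed edges join distinct
  vertices, so a bound on off-diagonal probabilities is enough.\<close>

lemma prob_pattern:
  fixes F :: "nat list \<Rightarrow> (nat \<times> nat) set" and W :: "nat list \<Rightarrow> nat set"
  assumes p: "edge_probabilities n p" and \<theta>: "\<theta> \<ge> 0"
    and d: "\<And>w. w < n \<Longrightarrow> (\<Sum>j<n. p w j) \<le> d"
    and q: "\<And>i j. i < n \<Longrightarrow> j < n \<Longrightarrow> i \<noteq> j \<Longrightarrow> p i j \<le> q" and q0: "0 \<le> q"
    and W: "\<And>xs. xs \<in> distinct_lists n m \<Longrightarrow> W xs \<subseteq> set xs \<and> card (W xs) = c"
    and F: "\<And>xs. xs \<in> distinct_lists n m \<Longrightarrow> card (F xs) = f \<and>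
      (\<forall>e\<in>F xs. \<exists>u\<in>set xs. \<exists>v\<in>set xs. u \<noteq> v \<and> e = edge u v)"
  shows "measure_pmf.prob (random_graph n p)
      {G. \<exists>xs\<in>distinct_lists n m. (\<forall>e\<in>F xs. G e) \<and> (\<forall>w\<in>W xs. K \<le> vertex_degree n G w)}
    \<le> real n ^ m * (q ^ f * exp (real c * (d * exp \<theta> - \<theta> * (K - real m))))"
proof -
  let ?B = "q ^ f * exp (real c * (d * exp \<theta> - \<theta> * (K - real m)))"
  have eq: "{xs. set xs \<subseteq> {..<n} \<and> length xs = m} \<supseteq> distinct_lists n m"
    by (auto simp: distinct_lists_def)
  have fin: "finite {xs. set xs \<subseteq> {..<n} \<and> length xs = m}" by (rule finite_lists_length_eq) simp
  have "card (distinct_lists n m) \<le> n ^ m"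
    using card_mono[OF fin eq] card_lists_length_eq[of "{..<n}" m] by simp
  then have card: "real (card (distinct_lists n m)) \<le> real n ^ m"
    by (metis of_nat_le_iff of_nat_power)
  have bound: "measure_pmf.prob (random_graph n p)
      {G. (\<forall>e\<in>F xs. G e) \<and> (\<forall>w\<in>W xs. K \<le> vertex_degree n G w)} \<le> ?B" if xs: "xs \<in> distinct_lists n m" for xs
  proof -
    have xs': "set xs \<subseteq> {..<n}" "card (set xs) = m"
      using xs by (auto simp: distinct_lists_def distinct_card)
    have Fe: "e \<in> edges n \<and> fst e \<in> set xs \<and> snd e \<in> set xs \<and> 0 \<le> edge_prob p e \<and> edge_prob p e \<le> q" if e: "e \<in> F xs" for e
    proof -
      obtain u v where uv: "u \<in> set xs" "v \<in> set xs" "u \<noteq> v" "e = edge u v" using F[OF xs] e by blast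
      then have "u < n" "v < n" using xs' by auto
      then show ?thesis
        using uv p q[of u v] q[of v u] by (auto simp: edge_def edges_def edge_prob_def min_def max_def edge_probabilities_def)
    qed
    have "measure_pmf.prob (random_graph n p)
        {G. (\<forall>e\<in>F xs. G e) \<and> (\<forall>w\<in>W xs. K \<le> vertex_degree n G w)} \<le>
      (\<Prod>e\<in>F xs. edge_prob p e) * exp (real (card (W xs)) * (d * exp \<theta> - \<theta> * (K - real (card (set xs)))))"
      by (rule prob_large_degrees[OF p \<theta>]) (use W[OF xs] xs' Fe d in auto)
    also have "(\<Prod>e\<in>F xs. edge_prob p e) \<le> (\<Prod>e\<in>F xs. q)"
      using Fe by (intro prod_mono) auto
    also have "\<dots> = q ^ f" using F[OF xs] by simp
    finally show ?thesis using W[OF xs] xs' by simp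
  qed
  have "measure_pmf.prob (random_graph n p)
      {G. \<exists>xs\<in>distinct_lists n m. (\<forall>e\<in>F xs. G e) \<and> (\<forall>w\<in>W xs. K \<le> vertex_degree n G w)} \<le> (\<Sum>xs\<in>distinct_lists n m. ?B)"
    by (rule prob_UNION_le) (use finite_subset[OF eq fin] bound in auto)
  also have "\<dots> = real (card (distinct_lists n m)) * ?B" by simp
  also have "\<dots> \<le> real n ^ m * ?B"
    using card q0 by (intro mult_right_mono) auto
  finally show ?thesis .
qed

text \<open>Configurations are encoded by lists: \<open>xs ! 0\<close> is the centre and the next \<open>r\<close> entries are its
  neighbours; in \<open>bipath_edges\<close> the last \<open>r\<close> entries are the endpoints of the paths of length 2. In
  \<open>codegree_edges\<close> both \<open>xs ! 0\<close> and \<open>xs ! 1\<close> are joined to the last three entries.\<close>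

definition bipath_edges :: "nat \<Rightarrow> nat list \<Rightarrow> (nat \<times> nat) set" where
  "bipath_edges r xs = (\<lambda>i. edge (xs ! 0) (xs ! (i + 1))) ` {..<r} \<union> (\<lambda>i. edge (xs ! (i + 1)) (xs ! (i + 1 + r))) ` {..<r}"

definition star_edges :: "nat \<Rightarrow> nat list \<Rightarrow> (nat \<times> nat) set" where
  "star_edges r xs = (\<lambda>i. edge (xs ! 0) (xs ! (i + 1))) ` {..<r}"

definition codegree_edges :: "nat list \<Rightarrow> (nat \<times> nat) set" where
  "codegree_edges xs = (\<lambda>i. edge (xs ! 0) (xs ! (i + 2))) ` {..<3} \<union> (\<lambda>i. edge (xs ! 1) (xs ! (i + 2))) ` {..<3}"

lemma card_bipath_edges:
  assumes "xs \<in> distinct_lists n (2 * r + 1)"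
  shows "card (bipath_edges r xs) = 2 * r"
    "\<forall>e\<in>bipath_edges r xs. \<exists>u\<in>set xs. \<exists>v\<in>set xs. u \<noteq> v \<and> e = edge u v"
    "(\<lambda>i. xs ! (i + 1 + r)) ` {..<r} \<subseteq> set xs" "card ((\<lambda>i. xs ! (i + 1 + r)) ` {..<r}) = r"
proof -
  have len: "length xs = 2 * r + 1" and dist: "distinct xs" using assms by (auto simp: distinct_lists_def)
  have nth: "xs ! i = xs ! j \<longleftrightarrow> i = j" if "i \<le> 2 * r" "j \<le> 2 * r" for i j
    using nth_eq_iff_index_eq[OF dist] len that by auto
  have inj: "inj_on (\<lambda>i. edge (xs ! 0) (xs ! (i + 1))) {..<r}" "inj_on (\<lambda>i. edge (xs ! (i + 1)) (xs ! (i + 1 + r))) {..<r}"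
    "inj_on (\<lambda>i. xs ! (i + 1 + r)) {..<r}"
    by (auto simp: inj_on_def edge_eq_iff nth)
  have "(\<lambda>i. edge (xs ! 0) (xs ! (i + 1))) ` {..<r} \<inter> (\<lambda>i. edge (xs ! (i + 1)) (xs ! (i + 1 + r))) ` {..<r} = {}"
    by (auto simp: edge_eq_iff nth)
  then show "card (bipath_edges r xs) = 2 * r"
    unfolding bipath_edges_def using card_image[OF inj(1)] card_image[OF inj(2)] by (simp add: card_Un_disjoint)
  show "\<forall>e\<in>bipath_edges r xs. \<exists>u\<in>set xs. \<exists>v\<in>set xs. u \<noteq> v \<and> e = edge u v"
    unfolding bipath_edges_def
  proof (rule ballI, elim UnE imageE)
    fix e i assume "e = edge (xs ! 0) (xs ! (i + 1))" "i \<in> {..<r}"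
    then show "\<exists>u\<in>set xs. \<exists>v\<in>set xs. u \<noteq> v \<and> e = edge u v"
      using len by (intro bexI[of _ "xs ! 0"] bexI[of _ "xs ! (i + 1)"]) (auto simp: nth)
  next
    fix e i assume "e = edge (xs ! (i + 1)) (xs ! (i + 1 + r))" "i \<in> {..<r}"
    then show "\<exists>u\<in>set xs. \<exists>v\<in>set xs. u \<noteq> v \<and> e = edge u v"
      using len by (intro bexI[of _ "xs ! (i + 1)"] bexI[of _ "xs ! (i + 1 + r)"]) (auto simp: nth)
  qed
  show "(\<lambda>i. xs ! (i + 1 + r)) ` {..<r} \<subseteq> set xs" using len by auto
  show "card ((\<lambda>i. xs ! (i + 1 + r)) ` {..<r}) = r" using card_image[OF inj(3)] by simp
qed

lemma card_star_edges:
  assumes "xs \<in> distinct_lists n (r + 1)"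
  shows "card (star_edges r xs) = r"
    "\<forall>e\<in>star_edges r xs. \<exists>u\<in>set xs. \<exists>v\<in>set xs. u \<noteq> v \<and> e = edge u v"
    "(\<lambda>i. xs ! (i + 1)) ` {..<r} \<subseteq> set xs" "card ((\<lambda>i. xs ! (i + 1)) ` {..<r}) = r"
proof -
  have len: "length xs = r + 1" and dist: "distinct xs" using assms by (auto simp: distinct_lists_def)
  have nth: "xs ! i = xs ! j \<longleftrightarrow> i = j" if "i \<le> r" "j \<le> r" for i j
    using nth_eq_iff_index_eq[OF dist] len that by auto
  have inj: "inj_on (\<lambda>i. edge (xs ! 0) (xs ! (i + 1))) {..<r}" "inj_on (\<lambda>i. xs ! (i + 1)) {..<r}"
    by (auto simp: inj_on_def edge_eq_iff nth)
  show "card (star_edges r xs) = r"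
    unfolding star_edges_def using card_image[OF inj(1)] by simp
  show "\<forall>e\<in>star_edges r xs. \<exists>u\<in>set xs. \<exists>v\<in>set xs. u \<noteq> v \<and> e = edge u v"
    unfolding star_edges_def
  proof (rule ballI, elim imageE)
    fix e i assume "e = edge (xs ! 0) (xs ! (i + 1))" "i \<in> {..<r}"
    then show "\<exists>u\<in>set xs. \<exists>v\<in>set xs. u \<noteq> v \<and> e = edge u v"
      using len by (intro bexI[of _ "xs ! 0"] bexI[of _ "xs ! (i + 1)"]) (auto simp: nth)
  qed
  show "(\<lambda>i. xs ! (i + 1)) ` {..<r} \<subseteq> set xs" using len by auto
  show "card ((\<lambda>i. xs ! (i + 1)) ` {..<r}) = r" using card_image[OF inj(2)] by simp
qed

lemma card_codegree_edges:
  assumes "xs \<in> distinct_lists n 5"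
  shows "card (codegree_edges xs) = 6"
    "\<forall>e\<in>codegree_edges xs. \<exists>u\<in>set xs. \<exists>v\<in>set xs. u \<noteq> v \<and> e = edge u v"
proof -
  have len: "length xs = 5" and dist: "distinct xs" using assms by (auto simp: distinct_lists_def)
  have nth: "xs ! i = xs ! j \<longleftrightarrow> i = j" if "i < 5" "j < 5" for i j
    using nth_eq_iff_index_eq[OF dist] len that by auto
  have inj: "inj_on (\<lambda>i. edge (xs ! 0) (xs ! (i + 2))) {..<3}" "inj_on (\<lambda>i. edge (xs ! 1) (xs ! (i + 2))) {..<3}"
    by (auto simp: inj_on_def edge_eq_iff nth)
  have "(\<lambda>i. edge (xs ! 0) (xs ! (i + 2))) ` {..<3} \<inter> (\<lambda>i. edge (xs ! 1) (xs ! (i + 2))) ` {..<3} = {}"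
    by (auto simp: edge_eq_iff nth)
  then show "card (codegree_edges xs) = 6"
    unfolding codegree_edges_def using card_image[OF inj(1)] card_image[OF inj(2)] by (simp add: card_Un_disjoint)
  show "\<forall>e\<in>codegree_edges xs. \<exists>u\<in>set xs. \<exists>v\<in>set xs. u \<noteq> v \<and> e = edge u v"
    unfolding codegree_edges_def
  proof (rule ballI, elim UnE imageE)
    fix e i assume "e = edge (xs ! 0) (xs ! (i + 2))" "i \<in> {..<3}"
    then show "\<exists>u\<in>set xs. \<exists>v\<in>set xs. u \<noteq> v \<and> e = edge u v"
      using len by (intro bexI[of _ "xs ! 0"] bexI[of _ "xs ! (i + 2)"]) (auto simp: nth)
  next
    fix e i assume "e = edge (xs ! 1) (xs ! (i + 2))" "i \<in> {..<3}"
    then show "\<exists>u\<in>set xs. \<exists>v\<in>set xs. u \<noteq> v \<and> e = edge u v"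
      using len by (intro bexI[of _ "xs ! 1"] bexI[of _ "xs ! (i + 2)"]) (auto simp: nth)
  qed
qed

section \<open>Most neighbours of a high vertex are leaves\<close>

definition high_vertices :: "nat \<Rightarrow> graph \<Rightarrow> real \<Rightarrow> nat set" where
  "high_vertices n G K = {u. u < n \<and> K \<le> vertex_degree n G u}"

text \<open>The three patterns have small expected number. The first is K_{2,3}, with five vertices
  and six edges, rare without any degree condition. The other two are trees with one vertex more
  than edges; in them the surplus factor n is beaten by r vertices of large degree once r is
  large.\<close>

definition high_vertices_spread :: "nat \<Rightarrow> graph \<Rightarrow> real \<Rightarrow> nat \<Rightarrow> bool" where
  "high_vertices_spread n G K r \<longleftrightarrow>
     \<not> (\<exists>xs\<in>distinct_lists n 5. \<forall>e\<in>codegree_edges xs. G e) \<and>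
     \<not> (\<exists>xs\<in>distinct_lists n (r + 1). (\<forall>e\<in>star_edges r xs. G e) \<and>
        (\<forall>w\<in>(\<lambda>i. xs ! (i + 1)) ` {..<r}. K \<le> vertex_degree n G w)) \<and>
     \<not> (\<exists>xs\<in>distinct_lists n (2 * r + 1). (\<forall>e\<in>bipath_edges r xs. G e) \<and>
        (\<forall>w\<in>(\<lambda>i. xs ! (i + 1 + r)) ` {..<r}. K \<le> vertex_degree n G w))"

definition leaves :: "nat \<Rightarrow> graph \<Rightarrow> nat set \<Rightarrow> nat \<Rightarrow> nat set" where
  "leaves n G U u = {v. v < n \<and> v \<notin> U \<and> G (edge u v) \<and> (\<forall>w\<in>U. G (edge w v) \<longrightarrow> w = u)}"

lemma common_neighbours_le:
  assumes "high_vertices_spread n G K r" and uw: "u < n" "w < n" "u \<noteq> w"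
    and C: "C \<subseteq> {v. v < n \<and> v \<noteq> u \<and> v \<noteq> w \<and> G (edge u v) \<and> G (edge w v)}"
  shows "card C \<le> 2"
proof (rule ccontr)
  assume "\<not> card C \<le> 2"
  then obtain T where T: "T \<subseteq> C" "card T = 3" by (metis not_less_eq_eq numeral_2_eq_2 numeral_3_eq_3 obtain_subset_with_card_n)
  then have "finite T" by (intro card_ge_0_finite) simp
  then obtain vs where vs: "set vs = T" "distinct vs" using finite_distinct_list by blast
  then have len: "length vs = 3" using T by (metis distinct_card)
  define xs where "xs = u # w # vs"
  have "xs \<in> distinct_lists n 5"
    using vs T C uw len by (auto simp: xs_def distinct_lists_def)
  moreover have "\<forall>e\<in>codegree_edges xs. G e"
  proof -
    have "vs ! i \<in> C" if "i < 3" for i using that vs T len nth_mem[of i vs] by auto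
    then have "G (edge u (vs ! i))" "G (edge w (vs ! i))" if "i < 3" for i using C that by blast+
    then show ?thesis by (auto simp: codegree_edges_def xs_def)
  qed
  ultimately show False using assms(1) unfolding high_vertices_spread_def by blast
qed

text \<open>A neighbour of u that is not a leaf is u itself (a loop), a high vertex, or a low vertex
  with another high neighbour. The second kind has at most r - 1 members by the star pattern. In the
  third kind the other high neighbours number fewer than r by the path pattern, and each shares at
  most 2 neighbours with u. The sum is 1 + (r - 1) + 2r = 3r.\<close>

lemma degree_le_leaves:
  assumes good: "high_vertices_spread n G K r" and r: "r \<ge> 1" and U: "U = high_vertices n G K" and u: "u \<in> U"
  shows "vertex_degree n G u \<le> real (card (leaves n G U u)) + 3 * real r"
proof -
  have un: "u < n" using u U by (simp add: high_vertices_def)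
  have Un: "U \<subseteq> {..<n}" using U by (auto simp: high_vertices_def)
  define X where "X = {v. v < n \<and> v \<in> U \<and> v \<noteq> u \<and> G (edge u v)}"
  define Y where "Y = {v. v < n \<and> v \<notin> U \<and> G (edge u v) \<and> (\<exists>w\<in>U. w \<noteq> u \<and> G (edge w v))}"
  have X: "card X \<le> r - 1"
  proof (rule ccontr)
    assume "\<not> card X \<le> r - 1"
    then have "r \<le> card X" using r by auto
    then obtain T where T: "T \<subseteq> X" "card T = r" by (rule obtain_subset_with_card_n)
    then have "finite T" using r by (intro card_ge_0_finite) simp
    then obtain vs where vs: "set vs = T" "distinct vs" using finite_distinct_list by blast
    then have len: "length vs = r" using T by (metis distinct_card)
    have vsX: "vs ! i \<in> X" if "i < r" for i using that vs T len nth_mem[of i vs] by auto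
    have "u # vs \<in> distinct_lists n (r + 1)"
      using vs T un len by (auto simp: distinct_lists_def X_def)
    moreover have "\<forall>e\<in>star_edges r (u # vs). G e"
      using vsX by (auto simp: star_edges_def X_def)
    moreover have "\<forall>w\<in>(\<lambda>i. (u # vs) ! (i + 1)) ` {..<r}. K \<le> vertex_degree n G w"
      using vsX U by (auto simp: X_def high_vertices_def)
    ultimately show False using good unfolding high_vertices_spread_def by blast
  qed
  have Y: "card Y \<le> 2 * r"
  proof -
    have fin: "finite Y" by (rule finite_subset[of _ "{..<n}"]) (auto simp: Y_def)
    have "\<forall>v\<in>Y. \<exists>w. w \<in> U \<and> w \<noteq> u \<and> G (edge w v)" by (auto simp: Y_def)
    from bchoice[OF this] obtain f where "\<forall>v\<in>Y. f v \<in> U \<and> f v \<noteq> u \<and> G (edge (f v) v)" by blast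
    then have f: "f v \<in> U" "f v \<noteq> u" "G (edge (f v) v)" if "v \<in> Y" for v using that by auto
    have fib: "card {v \<in> Y. f v = w} \<le> 2" if "w \<in> f ` Y" for w
    proof (rule common_neighbours_le[OF good un])
      show "w < n" "u \<noteq> w" using that f Un by auto
      show "{v \<in> Y. f v = w} \<subseteq> {v. v < n \<and> v \<noteq> u \<and> v \<noteq> w \<and> G (edge u v) \<and> G (edge w v)}"
      proof
        fix v assume "v \<in> {v \<in> Y. f v = w}"
        then have v: "v \<in> Y" "f v = w" by auto
        from v(1) have "v < n" "v \<notin> U" "G (edge u v)" by (auto simp: Y_def)
        then show "v \<in> {v. v < n \<and> v \<noteq> u \<and> v \<noteq> w \<and> G (edge u v) \<and> G (edge w v)}"
          using f[OF v(1)] u v(2) by auto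
      qed
    qed
    have "card (f ` Y) < r"
    proof (rule ccontr)
      assume "\<not> card (f ` Y) < r"
      then have "r \<le> card (f ` Y)" by simp
      then obtain T where T: "T \<subseteq> f ` Y" "card T = r" by (rule obtain_subset_with_card_n)
      then have "finite T" using r by (intro card_ge_0_finite) simp
      then obtain ws where ws: "set ws = T" "distinct ws" using finite_distinct_list by blast
      then have len: "length ws = r" using T by (metis distinct_card)
      \<comment> \<open>One midpoint for each far endpoint. The midpoints are distinct since f
        recovers the endpoint, and they differ from the endpoints since they lie outside
        \<open>U\<close>.\<close>
      define g where "g = inv_into Y f"
      have g: "g w \<in> Y" "f (g w) = w" if "w \<in> T" for w
        using that T inv_into_into[of w f Y] f_inv_into_f[of w f Y] by (auto simp: g_def)
      have wT: "ws ! i \<in> T" if "i < r" for i using that ws len nth_mem[of i ws] by auto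
      define xs where "xs = u # map g ws @ ws"
      have "distinct (map g ws)"
        unfolding distinct_map using ws g by (auto simp: inj_on_def) metis
      moreover have "T \<subseteq> U" using T f by auto
      moreover have "g ` T \<inter> U = {}" "g ` T \<subseteq> {..<n}" using g by (auto simp: Y_def)
      moreover have "u \<notin> T" using T f by auto
      ultimately have "xs \<in> distinct_lists n (2 * r + 1)"
        using ws un Un u len by (auto simp: xs_def distinct_lists_def)
      moreover have "\<forall>e\<in>bipath_edges r xs. G e"
      proof -
        have "G (edge u (g (ws ! i)))" "G (edge (g (ws ! i)) (ws ! i))" if "i < r" for i
        proof -
          show "G (edge u (g (ws ! i)))" using g[OF wT[OF that]] by (auto simp: Y_def)
          have "G (edge (f (g (ws ! i))) (g (ws ! i)))" using f(3)[OF g(1)[OF wT[OF that]]] .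
          then show "G (edge (g (ws ! i)) (ws ! i))"
            using g(2)[OF wT[OF that]] by (simp add: edge_def min.commute max.commute)
        qed
        then show ?thesis by (auto simp: bipath_edges_def xs_def nth_append len)
      qed
      moreover have "\<forall>w\<in>(\<lambda>i. xs ! (i + 1 + r)) ` {..<r}. K \<le> vertex_degree n G w"
        using wT \<open>T \<subseteq> U\<close> U len by (auto simp: xs_def nth_append high_vertices_def)
      ultimately show False using good unfolding high_vertices_spread_def by blast
    qed
    have "card Y = (\<Sum>w\<in>f ` Y. card {v \<in> Y. f v = w})"
      using sum.image_gen[OF fin, of "\<lambda>_. 1 :: nat" f] by simp
    also have "\<dots> \<le> (\<Sum>w\<in>f ` Y. 2)" by (rule sum_mono) (rule fib)
    also have "\<dots> \<le> 2 * r" using \<open>card (f ` Y) < r\<close> by simp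
    finally show ?thesis .
  qed
  have "vertex_degree n G u = (\<Sum>v<n. of_bool (G (edge u v)))"
    using un by (simp add: vertex_degree_adj adj_edge)
  also have "\<dots> = real (card {v. v < n \<and> G (edge u v)})"
    by (simp add: of_bool_def flip: sum.inter_filter)
  also have "card {v. v < n \<and> G (edge u v)} \<le> card (leaves n G U u \<union> {u} \<union> X \<union> Y)"
  proof (rule card_mono)
    show "{v. v < n \<and> G (edge u v)} \<subseteq> leaves n G U u \<union> {u} \<union> X \<union> Y"
      by (auto simp: leaves_def X_def Y_def)
  qed (auto simp: leaves_def X_def Y_def)
  also have "\<dots> \<le> card (leaves n G U u) + card {u} + card X + card Y"
    by (intro order_trans[OF card_Un_le] add_mono) auto
  also have "\<dots> \<le> card (leaves n G U u) + 1 + (r - 1) + 2 * r"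
    using X Y by simp
  also have "\<dots> = card (leaves n G U u) + 3 * r" using r by simp
  finally show ?thesis by simp
qed

lemma leaves_le_degree:
  assumes "u < n"
  shows "real (card (leaves n G U u)) \<le> vertex_degree n G u"
proof -
  have "real (card (leaves n G U u)) = (\<Sum>v\<in>leaves n G U u. of_bool (G (edge u v)))"
    by (simp add: leaves_def)
  also have "\<dots> \<le> (\<Sum>v<n. of_bool (G (edge u v)))"
    by (intro sum_mono2) (auto simp: leaves_def)
  also have "\<dots> = vertex_degree n G u" using assms by (simp add: vertex_degree_adj adj_edge)
  finally show ?thesis .
qed

lemma stars_leaves:
  assumes "U \<subseteq> {..<n}"
  shows "stars n U (leaves n G U)"
  by unfold_locales (use assms in \<open>auto simp: leaves_def\<close>)

subsection \<open>Estimates under the sparsity condition\<close>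

text \<open>The error function is the largest failure probability over all p satisfying the
  condition, so uniformity in p is built in. Inserting 0 keeps the set nonempty and the supremum
  nonnegative when no p qualifies.\<close>

lemma with_high_probabilityI:
  assumes "\<And>\<kappa> e. \<kappa> > 0 \<Longrightarrow> e > 0 \<Longrightarrow> \<exists>N. \<exists>\<eta>0>0. \<forall>n\<ge>N. \<forall>\<eta> p. 0 < \<eta> \<longrightarrow> \<eta> < \<eta>0 \<longrightarrow>
      edge_probabilities n p \<longrightarrow> \<A> n \<kappa> \<eta> p \<longrightarrow> 1 - e \<le> measure_pmf.prob (random_graph n p) {G. E n p G}"
  shows "with_high_probability \<A> E"
proof -
  define X where "X n \<kappa> \<eta> = insert 0 ((\<lambda>p. 1 - measure_pmf.prob (random_graph n p) {G. E n p G}) `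
      {p. edge_probabilities n p \<and> \<A> n \<kappa> \<eta> p})" for n \<kappa> \<eta>
  define \<psi> where "\<psi> n \<kappa> \<eta> = Sup (X n \<kappa> \<eta>)" for n \<kappa> \<eta>
  have bdd: "bdd_above (X n \<kappa> \<eta>)" for n \<kappa> \<eta>
    by (rule bdd_aboveI[of _ 1]) (auto simp: X_def)
  have nn: "0 \<le> \<psi> n \<kappa> \<eta>" for n \<kappa> \<eta>
    unfolding \<psi>_def by (rule cSup_upper[OF _ bdd]) (simp add: X_def)
  have "admissible \<psi>"
    unfolding admissible_def
  proof (intro allI impI tendstoI)
    fix \<kappa> e :: real assume "\<kappa> > 0" "e > 0"
    \<comment> \<open>Half of e, because the supremum preserves only a weak inequality while
      convergence asks for a strict one.\<close>
    then have "e / 2 > 0" by simp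
    from assms[OF \<open>\<kappa> > 0\<close> this] obtain N \<eta>0 where \<eta>0: "\<eta>0 > 0" and
      "\<forall>n\<ge>N. \<forall>\<eta> p. 0 < \<eta> \<longrightarrow> \<eta> < \<eta>0 \<longrightarrow> edge_probabilities n p \<longrightarrow> \<A> n \<kappa> \<eta> p \<longrightarrow>
        1 - e / 2 \<le> measure_pmf.prob (random_graph n p) {G. E n p G}"
      by (elim exE conjE)
    then have N: "n \<ge> N \<Longrightarrow> 0 < \<eta> \<Longrightarrow> \<eta> < \<eta>0 \<Longrightarrow> edge_probabilities n p \<Longrightarrow>
        \<A> n \<kappa> \<eta> p \<Longrightarrow> 1 - e / 2 \<le> measure_pmf.prob (random_graph n p) {G. E n p G}" for n \<eta> p
      by blast
    have "\<psi> n \<kappa> \<eta> \<le> e / 2" if "n \<ge> N" "0 < \<eta>" "\<eta> < \<eta>0" for n \<eta>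
      unfolding \<psi>_def
    proof (rule cSup_least)
      fix y assume "y \<in> X n \<kappa> \<eta>"
      then show "y \<le> e / 2" using N[OF that] \<open>e > 0\<close> by (fastforce simp: X_def)
    qed (simp add: X_def)
    then have small: "dist (\<psi> n \<kappa> \<eta>) 0 < e" if "n \<ge> N" "0 < \<eta>" "\<eta> < \<eta>0" for n \<eta>
      using that nn[of n \<kappa> \<eta>] \<open>e > 0\<close> by fastforce
    show "eventually (\<lambda>x. dist (case x of (n, \<eta>) \<Rightarrow> \<psi> n \<kappa> \<eta>) 0 < e) (at_top \<times>\<^sub>F at_right 0)"
      unfolding eventually_prod_filter
    proof (intro exI conjI allI impI)
      show "eventually (\<lambda>n. n \<ge> N) at_top" by (rule eventually_ge_at_top)
      show "eventually (\<lambda>\<eta>. 0 < \<eta> \<and> \<eta> < \<eta>0) (at_right 0)"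
        using \<eta>0 by (auto simp: eventually_at_right_field)
    qed (use small in auto)
  qed
  moreover have "1 - \<psi> n \<kappa> \<eta> \<le> measure_pmf.prob (random_graph n p) {G. E n p G}"
    if "edge_probabilities n p" "\<A> n \<kappa> \<eta> p" for n \<kappa> \<eta> p
  proof -
    have "1 - measure_pmf.prob (random_graph n p) {G. E n p G} \<le> \<psi> n \<kappa> \<eta>"
      unfolding \<psi>_def by (rule cSup_upper[OF _ bdd]) (use that in \<open>auto simp: X_def\<close>)
    then show ?thesis by linarith
  qed
  ultimately show ?thesis unfolding with_high_probability_def by blast
qed

lemma prob_ge_of_prob_not_le:
  assumes "\<And>G. \<not> B G \<Longrightarrow> E G" "measure_pmf.prob M {G. B G} \<le> e"
  shows "1 - e \<le> measure_pmf.prob M {G. E G}"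
proof -
  have "1 = measure_pmf.prob M {G. B G \<or> E G}"
    using assms(1) by (metis (mono_tags, lifting) UNIV_eq_I mem_Collect_eq measure_pmf.prob_space space_measure_pmf)
  also have "\<dots> \<le> measure_pmf.prob M {G. B G} + measure_pmf.prob M {G. E G}" by (rule prob_Un_le)
  finally show ?thesis using assms(2) by linarith
qed

lemma prob_card_ge:
  assumes "\<And>i. i < n \<Longrightarrow> measure_pmf.prob M {G. Q i G} \<le> q" and c: "c > 0"
  shows "measure_pmf.prob M {G. c \<le> real (card {i. i < n \<and> Q i G})} \<le> real n * q / c"
proof -
  have card: "real (card {i. i < n \<and> Q i G}) = (\<Sum>i<n. indicat_real {G. Q i G} G)" for G
    by (simp add: indicator_def flip: sum.inter_filter) (rule arg_cong[where f = card], auto)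
  have int: "integrable (measure_pmf M) (indicat_real {G. Q i G})" for i
    by (simp add: measure_pmf.emeasure_eq_measure)
  have "measure_pmf.prob M {G. c \<le> real (card {i. i < n \<and> Q i G})} \<le>
      measure_pmf.expectation M (\<lambda>G. \<Sum>i<n. indicat_real {G. Q i G} G) / c"
    unfolding card
    using integral_Markov_inequality_measure[of "measure_pmf M" "\<lambda>G. \<Sum>i<n. indicat_real {G. Q i G} G" UNIV c] c int
    by (simp add: sum_nonneg)
  also have "measure_pmf.expectation M (\<lambda>G. \<Sum>i<n. indicat_real {G. Q i G} G) =
      (\<Sum>i<n. measure_pmf.prob M {G. Q i G})"
    using int by (subst Bochner_Integration.integral_sum) auto
  also have "\<dots> \<le> real n * q"
    using sum_bounded_above[of "{..<n}" "\<lambda>i. measure_pmf.prob M {G. Q i G}" q] assms(1) by simp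
  finally show ?thesis using c by (simp add: divide_right_mono)
qed

section \<open>Parameters and exponents\<close>

lemma p_max_bounds:
  assumes "edge_probabilities n p" "n \<ge> 2"
  shows "i < n \<Longrightarrow> j < n \<Longrightarrow> i \<noteq> j \<Longrightarrow> p i j \<le> p_max n p" "0 \<le> p_max n p"
proof -
  have fin: "finite {p i j | i j. i < n \<and> j < n \<and> i \<noteq> j}"
    by (rule finite_subset[of _ "(\<lambda>(i, j). p i j) ` ({..<n} \<times> {..<n})"]) auto
  show le: "p i j \<le> p_max n p" if "i < n" "j < n" "i \<noteq> j" for i j
    unfolding p_max_def by (rule Max_ge[OF fin]) (use that in auto)
  have "0 \<le> p 0 1" using assms by (auto simp: edge_probabilities_def)
  then show "0 \<le> p_max n p" using le[of 0 1] assms(2) by linarith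
qed

lemma row_sum_le_d_max: "i < n \<Longrightarrow> (\<Sum>j<n. p i j) \<le> d_max n p"
  unfolding d_max_def by (rule Max_ge) auto

text \<open>The bound 1/16 on \<eta> gives ratio \<ge> 16 and thus ln ratio \<ge> 1, gives sqrt
  \<eta> \<le> 1/4 for the maximal degree, and gives -1 + 6 \<eta> \<le> -1/2 for common
  neighbours.\<close>

locale sparse_parameters =
  fixes n :: nat and \<kappa> \<eta> :: real and p :: "nat \<Rightarrow> nat \<Rightarrow> real"
  assumes n: "n \<ge> 2" and \<kappa>: "\<kappa> > 0" and \<eta>: "0 < \<eta>" "\<eta> \<le> 1 / 16"
    and p: "edge_probabilities n p" and cond: "sparsity_condition n \<kappa> \<eta> p"
begin

abbreviation d where "d \<equiv> d_max n p"
abbreviation L where "L \<equiv> L1 n p"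

definition ratio where "ratio = ln (real n) / d"

definition tilt where "tilt = ln ratio / 2"

lemma d_bounds: "\<kappa> \<le> d" "d \<le> \<eta> * ln (real n)" "0 < d"
  using cond \<kappa> by (auto simp: sparsity_condition_def)

lemma ln_n_pos: "0 < ln (real n)"
  using n by simp

lemma ratio_bounds: "16 \<le> ratio" "1 / \<eta> \<le> ratio" "ratio \<le> ln (real n) / \<kappa>"
proof -
  show 1: "1 / \<eta> \<le> ratio" using d_bounds \<eta> by (simp add: ratio_def field_simps)
  have "16 \<le> 1 / \<eta>" using \<eta> by (simp add: field_simps)
  then show "16 \<le> ratio" using 1 by linarith
  show "ratio \<le> ln (real n) / \<kappa>"
    using d_bounds \<kappa> ln_n_pos by (simp add: ratio_def frac_le)
qed

lemma ln_ratio_ge_1: "1 \<le> ln ratio"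
proof -
  have "exp 1 \<le> ratio" using exp_le ratio_bounds(1) by linarith
  then show ?thesis using ratio_bounds(1) by (subst ln_ge_iff) auto
qed

lemma L_eq: "L = ln (real n) / ln ratio"
  by (simp add: L1_def ratio_def)

text \<open>The last bound depends on n and \<kappa> alone and tends to infinity with n. Through it
  additive constants are absorbed into multiples of L uniformly in p; this is where the lower bound
  \<kappa> on d is used.\<close>

lemma L_bounds: "0 < L" "L \<le> ln (real n)" "ln (real n) / ln (ln (real n) / \<kappa>) \<le> L"
proof -
  show "0 < L" "L \<le> ln (real n)"
    unfolding L_eq using ln_n_pos ln_ratio_ge_1 by (simp_all add: field_simps)
  show "ln (real n) / ln (ln (real n) / \<kappa>) \<le> L"
    unfolding L_eq using ln_n_pos ln_ratio_ge_1 ratio_bounds by (intro divide_left_mono) auto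
qed

lemma tilt_nonneg: "0 \<le> tilt"
  using ln_ratio_ge_1 by (simp add: tilt_def)

lemma exp_tilt: "exp tilt = sqrt ratio"
  using ratio_bounds(1) by (simp add: tilt_def flip: ln_sqrt)

text \<open>The choice \<open>exp tilt = sqrt (ln n / d)\<close> makes \<open>tilt * L = ln n / 2\<close>, while \<open>d * exp tilt\<close> is of
  smaller order than \<open>ln n\<close>.\<close>

lemma degree_exponent_le:
  "exp (real c * (d * exp tilt - tilt * (\<delta> * L - real m))) \<le>
     real n powr (real c * (sqrt \<eta> - \<delta> / 2)) * sqrt (ln (real n) / \<kappa>) ^ (c * m)"
proof -
  have "d * exp tilt = ln (real n) / sqrt ratio"
  proof -
    have "d * exp tilt = ln (real n) * (sqrt ratio / ratio)"
      using d_bounds ln_n_pos by (simp add: exp_tilt) (simp add: ratio_def)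
    also have "sqrt ratio / ratio = 1 / sqrt ratio"
      using ratio_bounds(1) by (simp add: sqrt_divide_self_eq inverse_eq_divide)
    finally show ?thesis by simp
  qed
  also have "\<dots> \<le> sqrt \<eta> * ln (real n)"
  proof -
    have "1 / sqrt \<eta> \<le> sqrt ratio"
      using ratio_bounds(2) by (metis real_sqrt_divide real_sqrt_le_iff real_sqrt_one)
    then have "1 / sqrt ratio \<le> sqrt \<eta>" using \<eta> ratio_bounds(1) by (simp add: field_simps)
    from mult_right_mono[OF this, of "ln (real n)"] show ?thesis using ln_n_pos by simp
  qed
  finally have 1: "d * exp tilt \<le> sqrt \<eta> * ln (real n)" .
  have 2: "tilt * L = ln (real n) / 2"
    using ln_ratio_ge_1 by (simp add: tilt_def L_eq)
  have "real c * (d * exp tilt - tilt * (\<delta> * L - real m)) =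
      real c * (d * exp tilt - \<delta> * (tilt * L)) + real (c * m) * tilt"
    by (simp add: algebra_simps)
  also have "\<dots> \<le> real c * (sqrt \<eta> * ln (real n) - \<delta> * (ln (real n) / 2)) + real (c * m) * tilt"
    unfolding 2 using 1 by (intro add_right_mono mult_left_mono) auto
  also have "\<dots> = real c * (sqrt \<eta> - \<delta> / 2) * ln (real n) + real (c * m) * tilt"
    by (simp add: algebra_simps)
  finally have "exp (real c * (d * exp tilt - tilt * (\<delta> * L - real m))) \<le>
      exp (real c * (sqrt \<eta> - \<delta> / 2) * ln (real n)) * exp tilt ^ (c * m)"
    by (simp flip: exp_add exp_of_nat_mult)
  also have "exp (real c * (sqrt \<eta> - \<delta> / 2) * ln (real n)) = real n powr (real c * (sqrt \<eta> - \<delta> / 2))"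
    using n by (simp add: powr_def)
  also have "real n powr (real c * (sqrt \<eta> - \<delta> / 2)) * exp tilt ^ (c * m) \<le>
      real n powr (real c * (sqrt \<eta> - \<delta> / 2)) * sqrt (ln (real n) / \<kappa>) ^ (c * m)"
    unfolding exp_tilt using ratio_bounds by (intro mult_left_mono power_mono) auto
  finally show ?thesis .
qed

lemma prob_vertex_degree_ge:
  assumes "i < n"
  shows "measure_pmf.prob (random_graph n p) {G. \<delta> * L \<le> vertex_degree n G i} \<le>
    real n powr (sqrt \<eta> - \<delta> / 2) * sqrt (ln (real n) / \<kappa>)"
proof -
  have "measure_pmf.prob (random_graph n p) {G. (\<forall>e\<in>{}. G e) \<and> (\<forall>w\<in>{i}. \<delta> * L \<le> vertex_degree n G w)} \<le>
    (\<Prod>e\<in>{}. edge_prob p e) * exp (real (card {i}) * (d * exp tilt - tilt * (\<delta> * L - real (card {i}))))"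
    by (rule prob_large_degrees[OF p tilt_nonneg]) (use assms row_sum_le_d_max in auto)
  then show ?thesis
    using degree_exponent_le[of 1 \<delta> 1] by simp
qed

text \<open>Each vertex of the pattern contributes n, each prescribed edge n^(\<eta> - 1), and each
  vertex of large degree n^(sqrt \<eta> - \<delta>/2); the remaining factor is a power of a
  logarithm for a fixed pattern.\<close>

lemma prob_degree_pattern:
  fixes F :: "nat list \<Rightarrow> (nat \<times> nat) set" and W :: "nat list \<Rightarrow> nat set"
  assumes W: "\<And>xs. xs \<in> distinct_lists n m \<Longrightarrow> W xs \<subseteq> set xs \<and> card (W xs) = c"
    and F: "\<And>xs. xs \<in> distinct_lists n m \<Longrightarrow> card (F xs) = f \<and>
      (\<forall>e\<in>F xs. \<exists>u\<in>set xs. \<exists>v\<in>set xs. u \<noteq> v \<and> e = edge u v)"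
  shows "measure_pmf.prob (random_graph n p)
      {G. \<exists>xs\<in>distinct_lists n m. (\<forall>e\<in>F xs. G e) \<and> (\<forall>w\<in>W xs. \<delta> * L \<le> vertex_degree n G w)}
    \<le> real n powr (real m + real f * (\<eta> - 1) + real c * (sqrt \<eta> - \<delta> / 2)) * sqrt (ln (real n) / \<kappa>) ^ (c * m)"
proof -
  have q: "p i j \<le> real n powr (\<eta> - 1)" if "i < n" "j < n" "i \<noteq> j" for i j
  proof -
    have "p i j \<le> p_max n p" using p_max_bounds[OF p n] that by blast
    also have "\<dots> \<le> real n powr (- 1 + \<eta>)" using cond by (simp add: sparsity_condition_def)
    finally show ?thesis by simp
  qed
  have "measure_pmf.prob (random_graph n p)
      {G. \<exists>xs\<in>distinct_lists n m. (\<forall>e\<in>F xs. G e) \<and> (\<forall>w\<in>W xs. \<delta> * L \<le> vertex_degree n G w)}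
    \<le> real n ^ m * ((real n powr (\<eta> - 1)) ^ f * exp (real c * (d * exp tilt - tilt * (\<delta> * L - real m))))"
    by (rule prob_pattern[OF p tilt_nonneg row_sum_le_d_max q _ W F]) auto
  also have "\<dots> \<le> real n ^ m * ((real n powr (\<eta> - 1)) ^ f *
      (real n powr (real c * (sqrt \<eta> - \<delta> / 2)) * sqrt (ln (real n) / \<kappa>) ^ (c * m)))"
    by (intro mult_left_mono degree_exponent_le) auto
  also have "real n ^ m = real n powr real m" using n by (simp add: powr_realpow)
  also have "(real n powr (\<eta> - 1)) ^ f = real n powr (real f * (\<eta> - 1))"
    using n by (simp add: powr_realpow[symmetric] powr_powr mult.commute)
  finally show ?thesis by (simp add: powr_add mult.assoc)
qed

text \<open>Both \<eta> and sqrt \<eta> are at most \<delta>/16, so the star and path exponents are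
  at most 1 - 3 r \<delta>/8 and 1 - 5 r \<delta>/16. With r \<delta> \<ge> 16 these are well below
  -1.\<close>

lemma prob_not_spread:
  assumes \<delta>: "sqrt \<eta> \<le> \<delta> / 16" "16 \<le> real r * \<delta>"
  shows "measure_pmf.prob (random_graph n p) {G. \<not> high_vertices_spread n G (\<delta> * L) r} \<le>
    real n powr (- 1 / 2) + (real n powr (- 1) * sqrt (ln (real n) / \<kappa>) ^ (r * (r + 1)) +
      real n powr (- 1) * sqrt (ln (real n) / \<kappa>) ^ (r * (2 * r + 1)))"
proof -
  let ?A = "\<lambda>G. \<exists>xs\<in>distinct_lists n 5. (\<forall>e\<in>codegree_edges xs. G e) \<and> (\<forall>w\<in>{}. \<delta> * L \<le> vertex_degree n G w)"
  let ?B = "\<lambda>G. \<exists>xs\<in>distinct_lists n (r + 1). (\<forall>e\<in>star_edges r xs. G e) \<and>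
        (\<forall>w\<in>(\<lambda>i. xs ! (i + 1)) ` {..<r}. \<delta> * L \<le> vertex_degree n G w)"
  let ?C = "\<lambda>G. \<exists>xs\<in>distinct_lists n (2 * r + 1). (\<forall>e\<in>bipath_edges r xs. G e) \<and>
        (\<forall>w\<in>(\<lambda>i. xs ! (i + 1 + r)) ` {..<r}. \<delta> * L \<le> vertex_degree n G w)"
  have n1: "real n \<ge> 1" using n by simp
  have "sqrt \<eta> * sqrt \<eta> \<le> sqrt \<eta> * 1" using \<eta> by (intro mult_left_mono) (auto intro!: real_le_lsqrt)
  then have "\<eta> \<le> sqrt \<eta>" using \<eta> by simp
  then have "\<eta> \<le> \<delta> / 16" using \<delta> by linarith
  from mult_left_mono[OF this, of "real r"] mult_left_mono[OF \<delta>(1), of "real r"]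
  have r\<eta>: "real r * \<eta> \<le> real r * \<delta> / 16" "real r * sqrt \<eta> \<le> real r * \<delta> / 16" by simp_all
  have A: "measure_pmf.prob (random_graph n p) {G. ?A G} \<le> real n powr (- 1 / 2)"
  proof -
    have "measure_pmf.prob (random_graph n p) {G. ?A G} \<le>
      real n powr (real 5 + real 6 * (\<eta> - 1) + real 0 * (sqrt \<eta> - \<delta> / 2)) * sqrt (ln (real n) / \<kappa>) ^ (0 * 5)"
      by (rule prob_degree_pattern) (use card_codegree_edges in auto)
    also have "\<dots> = real n powr (- 1 + 6 * \<eta>)" by (simp add: algebra_simps)
    also have "\<dots> \<le> real n powr (- 1 / 2)" using \<eta> n1 by (intro powr_mono) auto
    finally show ?thesis .
  qed
  have B: "measure_pmf.prob (random_graph n p) {G. ?B G} \<le> real n powr (- 1) * sqrt (ln (real n) / \<kappa>) ^ (r * (r + 1))"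
  proof -
    have "measure_pmf.prob (random_graph n p) {G. ?B G} \<le>
      real n powr (real (r + 1) + real r * (\<eta> - 1) + real r * (sqrt \<eta> - \<delta> / 2)) * sqrt (ln (real n) / \<kappa>) ^ (r * (r + 1))"
      by (rule prob_degree_pattern) (use card_star_edges in auto)
    also have "\<dots> \<le> real n powr (- 1) * sqrt (ln (real n) / \<kappa>) ^ (r * (r + 1))"
      using r\<eta> \<delta> n1 ln_n_pos \<kappa> by (intro mult_right_mono powr_mono) (auto simp: algebra_simps)
    finally show ?thesis .
  qed
  have C: "measure_pmf.prob (random_graph n p) {G. ?C G} \<le> real n powr (- 1) * sqrt (ln (real n) / \<kappa>) ^ (r * (2 * r + 1))"
  proof -
    have "measure_pmf.prob (random_graph n p) {G. ?C G} \<le>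
      real n powr (real (2 * r + 1) + real (2 * r) * (\<eta> - 1) + real r * (sqrt \<eta> - \<delta> / 2)) * sqrt (ln (real n) / \<kappa>) ^ (r * (2 * r + 1))"
      by (rule prob_degree_pattern) (use card_bipath_edges in blast)+
    also have "\<dots> \<le> real n powr (- 1) * sqrt (ln (real n) / \<kappa>) ^ (r * (2 * r + 1))"
      using r\<eta> \<delta> n1 ln_n_pos \<kappa> by (intro mult_right_mono powr_mono) (auto simp: algebra_simps)
    finally show ?thesis .
  qed
  have eq: "{G. \<not> high_vertices_spread n G (\<delta> * L) r} = {G. ?A G \<or> ?B G \<or> ?C G}"
    unfolding high_vertices_spread_def by auto
  have "measure_pmf.prob (random_graph n p) {G. ?A G \<or> ?B G \<or> ?C G} \<le>
      measure_pmf.prob (random_graph n p) {G. ?A G} + measure_pmf.prob (random_graph n p) {G. ?B G \<or> ?C G}"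
    by (rule prob_Un_le)
  also have "\<dots> \<le> measure_pmf.prob (random_graph n p) {G. ?A G} +
      (measure_pmf.prob (random_graph n p) {G. ?B G} + measure_pmf.prob (random_graph n p) {G. ?C G})"
    by (intro add_left_mono prob_Un_le)
  finally show ?thesis unfolding eq using A B C by (meson add_mono order_trans)
qed

text \<open>The factor 3 makes the exponent negative after the union over n vertices: 1 + 1/4 - 3/2
  = -1/4.\<close>

lemma prob_max_degree_ge:
  "measure_pmf.prob (random_graph n p) {G. \<exists>i\<in>{..<n}. 3 * L \<le> vertex_degree n G i} \<le>
    real n powr (- 1 / 4) * sqrt (ln (real n) / \<kappa>)"
proof -
  let ?Y = "sqrt (ln (real n) / \<kappa>)"
  have Y: "0 \<le> ?Y" using ln_n_pos \<kappa> by simp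
  have "measure_pmf.prob (random_graph n p) {G. \<exists>i\<in>{..<n}. 3 * L \<le> vertex_degree n G i} \<le>
      (\<Sum>i<n. real n powr (sqrt \<eta> - 3 / 2) * ?Y)"
    by (rule prob_UNION_le) (use prob_vertex_degree_ge in auto)
  also have "\<dots> = real n powr (1 + (sqrt \<eta> - 3 / 2)) * ?Y"
    using n by (simp only: powr_add) simp
  also have "sqrt \<eta> \<le> 1 / 4"
    by (rule real_le_lsqrt) (use \<eta> in \<open>auto simp: power2_eq_square\<close>)
  then have "real n powr (1 + (sqrt \<eta> - 3 / 2)) * ?Y \<le> real n powr (- 1 / 4) * ?Y"
    using n Y by (intro mult_right_mono powr_mono) auto
  finally show ?thesis .
qed

text \<open>Markov's inequality for the expected number, whose exponent is 1 + sqrt \<eta> -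
  \<delta>/2. The gain over the threshold is at least \<delta>/4 - \<delta>/16, more than
  \<delta>/8. A small number of centres keeps the split-off edges below n and leaves room for the
  ranks k.\<close>

lemma prob_many_high_vertices:
  assumes \<delta>: "sqrt \<eta> \<le> \<delta> / 16" "\<delta> > 0"
  shows "measure_pmf.prob (random_graph n p)
      {G. real n powr (1 - \<delta> / 4) \<le> real (card (high_vertices n G (\<delta> * L)))} \<le>
    real n powr (- \<delta> / 8) * sqrt (ln (real n) / \<kappa>)"
proof -
  let ?Y = "sqrt (ln (real n) / \<kappa>)"
  have Y: "0 \<le> ?Y" using ln_n_pos \<kappa> by simp
  have "measure_pmf.prob (random_graph n p)
      {G. real n powr (1 - \<delta> / 4) \<le> real (card (high_vertices n G (\<delta> * L)))} \<le>
    real n * (real n powr (sqrt \<eta> - \<delta> / 2) * ?Y) / real n powr (1 - \<delta> / 4)"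
    unfolding high_vertices_def by (rule prob_card_ge) (use n prob_vertex_degree_ge in auto)
  also have "\<dots> = real n powr (1 + (sqrt \<eta> - \<delta> / 2) - (1 - \<delta> / 4)) * ?Y"
    using n by (simp only: powr_add powr_diff) simp
  also have "\<dots> \<le> real n powr (- \<delta> / 8) * ?Y"
    using n \<delta> Y by (intro mult_right_mono powr_mono) auto
  finally show ?thesis .
qed

end

context sparse_parameters
begin

lemma np_le: "i < j \<Longrightarrow> j < n \<Longrightarrow> 0 \<le> c \<Longrightarrow> real n * p i j \<le> c + real n * p_max n p"
  by (rule add_increasing) (auto intro!: mult_left_mono p_max_bounds(1)[OF p n])

lemma spectrum_near_mean:
  assumes D: "D = 3 * L + real n * p_max n p" and quasi: "quasirandom n p D G"
    and deg: "\<And>i. i < n \<Longrightarrow> vertex_degree n G i \<le> 3 * L" and k: "k \<in> {1..n}"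
  shows "\<bar>eigval k n (adj G) - eigval k n p\<bar> \<le> 43200 * sqrt D + 1"
proof (rule weyl_inequality[OF _ _ k])
  have pm: "0 \<le> real n * p_max n p" using p_max_bounds(2)[OF p n] by simp
  have D0: "D > 0" using D pm L_bounds by simp
  show "symm n (adj G)" by (simp add: symm_def adj_symm)
  show "symm n p" using p by (simp add: symm_def edge_probabilities_def)
  fix x
  \<comment> \<open>Nothing is split off here, since all degrees are already at most 3 L.\<close>
  have "\<bar>inprod n x (mat_app n (adj G) x) - inprod n x (mat_app n (\<lambda>_ _. 0) x) - inprod n x (mat_app n p x)\<bar> \<le> (43200 * sqrt D + 1) * inprod n x x"
  proof (rule adj_form_bound[OF p D0 _ _ quasi])
    fix i j assume "i < j" "j < n"
    then show "real n * p i j \<le> D" unfolding D using L_bounds by (intro np_le) auto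
  next
    fix i assume "i < n"
    then show "(\<Sum>j<n. adj G i j - 0) \<le> D" using deg[of i] pm D by (simp add: vertex_degree_adj)
  qed (use n adj_bounds in auto)
  then show "\<bar>inprod n x (mat_app n (adj G) x) - inprod n x (mat_app n p x)\<bar> \<le> (43200 * sqrt D + 1) * inprod n x x"
    by (simp add: form_sum)
qed

text \<open>The threshold \<delta> L plays three parts: it defines the centres, bounds the degrees
  of all other vertices, and bounds the at most 3 r neighbours that a centre keeps outside its star.
  The last two bound the row sums of the rest by D. The condition 6 L B \<le> n limits the split-off
  entries: two per edge, at most 3 L edges per star, at most B stars.\<close>

lemma spectrum_near_stars:
  assumes D: "D = \<delta> * L + real n * p_max n p" and \<delta>: "\<delta> > 0" and quasi: "quasirandom n p D G"
    and deg: "\<And>i. i < n \<Longrightarrow> vertex_degree n G i \<le> 3 * L"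
    and spread: "high_vertices_spread n G (\<delta> * L) r" and r: "1 \<le> r" "3 * real r \<le> \<delta> * L"
    and B: "real (card (high_vertices n G (\<delta> * L))) \<le> B" "6 * L * B \<le> real n"
    and k: "1 \<le> k" "real k + B \<le> real n" and \<sigma>: "\<bar>\<sigma>\<bar> = 1"
  shows "\<bar>eigval k n (\<lambda>i j. \<sigma> * adj G i j) - sqrt (ordered_degree n G k)\<bar> \<le> 43200 * sqrt D + 1 + d + sqrt (\<delta> * L)"
proof -
  define U where "U = high_vertices n G (\<delta> * L)"
  have Un: "U \<subseteq> {..<n}" by (auto simp: U_def high_vertices_def)
  interpret stars n U "leaves n G U" by (rule stars_leaves[OF Un])
  have pm: "0 \<le> real n * p_max n p" using p_max_bounds(2)[OF p n] by simp
  have \<delta>L: "0 < \<delta> * L" using \<delta> L_bounds by simp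
  have D0: "D > 0" using D pm \<delta>L by simp
  have leaf_adj: "adj G u v = 1" if "v \<in> leaves n G U u" for u v
    using that by (simp add: adj_edge leaves_def)
  note star_le = star_adj_le[where G = G, OF leaf_adj]
  have star_row: "(\<Sum>j<n. star_adj u j) = real (card (leaves n G U u))" if "u \<in> U" for u
  proof -
    have "(\<Sum>j<n. star_adj u j) = (\<Sum>j<n. of_bool (j \<in> leaves n G U u))"
      using that by (intro sum.cong refl) (auto simp: star_adj_def leaves_def)
    also have "\<dots> = (\<Sum>j\<in>leaves n G U u. 1)"
      by (intro sum.mono_neutral_cong_right) (auto simp: leaves_def)
    finally show ?thesis by simp
  qed
  have N_deg: "real (card (leaves n G U u)) \<le> vertex_degree n G u \<and> vertex_degree n G u \<le> real (card (leaves n G U u)) + \<delta> * L"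
    if "u \<in> U" for u
    using degree_le_leaves[OF spread r(1) U_def that] leaves_le_degree[of u n G U] that Un r(2) by auto
  have form: "\<bar>inprod n x (mat_app n (adj G) x) - inprod n x (mat_app n star_adj x)\<bar> \<le> (43200 * sqrt D + 1 + d) * inprod n x x" for x
  proof -
    have "\<bar>inprod n x (mat_app n (adj G) x) - inprod n x (mat_app n star_adj x) - inprod n x (mat_app n p x)\<bar> \<le> (43200 * sqrt D + 1) * inprod n x x"
    proof (rule adj_form_bound[OF p D0 _ _ quasi star_le])
      fix i j assume "i < j" "j < n"
      then show "real n * p i j \<le> D" unfolding D using \<delta>L by (intro np_le) auto
    next
      fix i assume i: "i < n"
      have "(\<Sum>j<n. adj G i j - star_adj i j) \<le> \<delta> * L"
      proof (cases "i \<in> U")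
        case True
        then show ?thesis
          using N_deg[OF True] star_row[OF True] i by (simp add: sum_subtractf vertex_degree_adj)
      next
        case False
        have "(\<Sum>j<n. adj G i j - star_adj i j) \<le> (\<Sum>j<n. adj G i j)"
          by (intro sum_mono) (simp add: star_adj_def)
        then show ?thesis using False i by (simp add: U_def high_vertices_def vertex_degree_adj)
      qed
      then show "(\<Sum>j<n. adj G i j - star_adj i j) \<le> D" using D pm by linarith
    next
      \<comment> \<open>The number of entries is the form at the constant vector 1, so
        \<open>star_form\<close> counts them.\<close>
      have "(\<Sum>i<n. \<Sum>j<n. star_adj i j) = inprod n (\<lambda>_. 1) (mat_app n star_adj (\<lambda>_. 1))"
        by (simp add: form_sum)
      also have "\<dots> = 2 * (\<Sum>u\<in>U. real (card (leaves n G U u)))" by (simp add: star_form)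
      also have "\<dots> \<le> 2 * (real (card U) * (3 * L))"
        using N_deg deg Un by (intro mult_left_mono sum_bounded_above) (auto intro: order_trans)
      also have "\<dots> \<le> 6 * L * B" using B(1) L_bounds(1) by (simp add: U_def)
      finally show "(\<Sum>i<n. \<Sum>j<n. star_adj i j) \<le> real n" using B(2) by linarith
    qed (use n in auto)
    moreover have "\<bar>inprod n x (mat_app n p x)\<bar> \<le> d * inprod n x x"
      by (rule mean_form_bound[OF p row_sum_le_d_max])
    ultimately show ?thesis by (simp add: distrib_right)
  qed
  obtain \<pi> where \<pi>: "decreasing_perm n (vertex_degree n G) \<pi>" using decreasing_perm_exists by blast
  have card_B: "real k + real (card U) \<le> real n" using k(2) B(1) by (simp add: U_def)
  then have kU: "k + card U \<le> n" by (simp only: of_nat_add[symmetric] of_nat_le_iff)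
  have "\<bar>eigval k n (\<lambda>i j. \<sigma> * adj G i j) - sqrt (vertex_degree n G (\<pi> (k - 1)))\<bar> \<le> 43200 * sqrt D + 1 + d + sqrt (\<delta> * L)"
  proof (rule star_eigenvalue_estimate[OF \<sigma> \<pi> _ _ N_deg _ form k(1) kU])
    show "symm n (adj G)" by (simp add: symm_def adj_symm)
    show "0 \<le> vertex_degree n G i" if "i < n" for i
      using that adj_bounds by (simp add: vertex_degree_adj sum_nonneg)
  qed (use \<delta>L in \<open>auto simp: U_def high_vertices_def\<close>)
  moreover have "ordered_degree n G k = vertex_degree n G (\<pi> (k - 1))"
    unfolding ordered_degree_def by (rule rev_sort_nth[OF \<pi>]) (use k kU in auto)
  ultimately show ?thesis by simp
qed

end

section \<open>Limits in n and choice of constants\<close>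

lemma L1_ge_1:
  assumes "sparse_parameters n \<kappa> \<eta> p" "1 \<le> ln (real n) / ln (ln (real n) / \<kappa>)"
  shows "1 \<le> L1 n p"
  using sparse_parameters.L_bounds(3)[OF assms(1)] assms(2) by linarith

lemma with_high_probability_mean:
  "with_high_probability sparsity_condition (\<lambda>n p G. \<forall>k\<in>{1..n}.
     \<bar>ordered_eigenvalue k (adjacency_matrix n G) - ordered_eigenvalue k (expected_adjacency_matrix n p)\<bar>
       \<le> 100000 * (sqrt (L1 n p) + sqrt (real n * p_max n p)))"
proof (rule with_high_probabilityI)
  fix \<kappa> e :: real assume \<kappa>: "\<kappa> > 0" and e: "e > 0"
  have "((\<lambda>n::nat. exp (- 2 * real n) + 1 / real n + real n powr (- 1 / 4) * sqrt (ln (real n) / \<kappa>)) \<longlongrightarrow> 0) at_top"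
    using \<kappa> by real_asymp
  then have "eventually (\<lambda>n::nat. exp (- 2 * real n) + 1 / real n + real n powr (- 1 / 4) * sqrt (ln (real n) / \<kappa>) < e) at_top"
    using e by (rule order_tendstoD)
  moreover have "eventually (\<lambda>n::nat. 1 \<le> ln (real n) / ln (ln (real n) / \<kappa>)) at_top"
    using \<kappa> by real_asymp
  moreover have "eventually (\<lambda>n::nat. n \<ge> 2) at_top" by (rule eventually_ge_at_top)
  ultimately have "eventually (\<lambda>n::nat. exp (- 2 * real n) + 1 / real n + real n powr (- 1 / 4) * sqrt (ln (real n) / \<kappa>) < e \<and>
      1 \<le> ln (real n) / ln (ln (real n) / \<kappa>) \<and> n \<ge> 2) at_top"
    by eventually_elim auto
  then obtain N :: nat where N: "\<And>n. n \<ge> N \<Longrightarrow> exp (- 2 * real n) + 1 / real n + real n powr (- 1 / 4) * sqrt (ln (real n) / \<kappa>) < e"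
    "\<And>n. n \<ge> N \<Longrightarrow> 1 \<le> ln (real n) / ln (ln (real n) / \<kappa>)" "\<And>n. n \<ge> N \<Longrightarrow> n \<ge> 2"
    unfolding eventually_at_top_linorder by blast
  show "\<exists>N. \<exists>\<eta>0>0. \<forall>n\<ge>N. \<forall>\<eta> p. 0 < \<eta> \<longrightarrow> \<eta> < \<eta>0 \<longrightarrow>
      edge_probabilities n p \<longrightarrow> sparsity_condition n \<kappa> \<eta> p \<longrightarrow> 1 - e \<le> measure_pmf.prob (random_graph n p)
     {G. \<forall>k\<in>{1..n}. \<bar>ordered_eigenvalue k (adjacency_matrix n G) - ordered_eigenvalue k (expected_adjacency_matrix n p)\<bar>
       \<le> 100000 * (sqrt (L1 n p) + sqrt (real n * p_max n p))}"
  proof (rule exI[of _ N], rule exI[of _ "1 / 16"], intro conjI allI impI)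
    fix n \<eta> p assume nN: "n \<ge> N" and \<eta>: "0 < \<eta>" "\<eta> < 1 / 16" and p: "edge_probabilities n p" "sparsity_condition n \<kappa> \<eta> p"
    interpret sparse_parameters n \<kappa> \<eta> p
      by unfold_locales (use N(3)[OF nN] \<eta> p \<kappa> in auto)
    have L1: "1 \<le> L" using L1_ge_1[OF sparse_parameters_axioms N(2)[OF nN]] .
    have pm: "0 \<le> real n * p_max n p" using p_max_bounds(2)[OF p(1)] N(3)[OF nN] by simp
    define D where "D = 3 * L + real n * p_max n p"
    have D0: "D > 0" using L1 pm by (simp add: D_def)
    have np: "real n * p i j \<le> D" if "i < j" "j < n" for i j
      unfolding D_def using that L1 by (intro np_le) auto
    have "measure_pmf.prob (random_graph n p) {G. \<not> quasirandom n p D G \<or> (\<exists>i\<in>{..<n}. 3 * L \<le> vertex_degree n G i)} \<le>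
        (exp (- 2 * real n) + 1 / real n) + real n powr (- 1 / 4) * sqrt (ln (real n) / \<kappa>)"
      using prob_Un_le[of "random_graph n p" "\<lambda>G. \<not> quasirandom n p D G" "\<lambda>G. \<exists>i\<in>{..<n}. 3 * L \<le> vertex_degree n G i"]
        prob_not_quasirandom[OF p(1) D0 _ np] prob_max_degree_ge N(3)[OF nN] by fastforce
    also have "\<dots> \<le> e" using N(1)[OF nN] by simp
    finally have bad: "measure_pmf.prob (random_graph n p) {G. \<not> quasirandom n p D G \<or> (\<exists>i\<in>{..<n}. 3 * L \<le> vertex_degree n G i)} \<le> e" .
    show "1 - e \<le> measure_pmf.prob (random_graph n p)
     {G. \<forall>k\<in>{1..n}. \<bar>ordered_eigenvalue k (adjacency_matrix n G) - ordered_eigenvalue k (expected_adjacency_matrix n p)\<bar>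
       \<le> 100000 * (sqrt L + sqrt (real n * p_max n p))}"
    proof (rule prob_ge_of_prob_not_le[OF _ bad], rule ballI)
      fix G k assume G: "\<not> (\<not> quasirandom n p D G \<or> (\<exists>i\<in>{..<n}. 3 * L \<le> vertex_degree n G i))" and k: "k \<in> {1..n}"
      have "\<bar>eigval k n (adj G) - eigval k n p\<bar> \<le> 43200 * sqrt D + 1"
        by (rule spectrum_near_mean[OF D_def _ _ k]) (use G in \<open>auto simp: not_le less_imp_le\<close>)
      also have "sqrt D \<le> sqrt (3 * L) + sqrt (real n * p_max n p)"
        unfolding D_def using L1 pm by (intro sqrt_add_le_add_sqrt) auto
      \<comment> \<open>Rounding 3 up to 4 gives an integer root. Since L \<ge> 1 absorbs the
        additive 1, the coefficient of sqrt L becomes 2 * 43200 + 1, below 100000.\<close>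
      also have "sqrt (3 * L) \<le> sqrt (2\<^sup>2 * L)" using L1 by (intro real_sqrt_le_mono) auto
      also have "\<dots> = 2 * sqrt L" by (simp add: real_sqrt_mult)
      finally have "\<bar>eigval k n (adj G) - eigval k n p\<bar> \<le> 43200 * (2 * sqrt L + sqrt (real n * p_max n p)) + 1" by simp
      moreover have "1 \<le> sqrt L" "0 \<le> sqrt (real n * p_max n p)" using L1 pm by simp_all
      ultimately show "\<bar>ordered_eigenvalue k (adjacency_matrix n G) - ordered_eigenvalue k (expected_adjacency_matrix n p)\<bar>
         \<le> 100000 * (sqrt L + sqrt (real n * p_max n p))"
        unfolding adjacency_matrix_adj expected_adjacency_matrix_def distrib_left by linarith
    qed
  qed simp
qed

lemma with_high_probability_stars:
  assumes \<epsilon>: "\<epsilon> \<in> {0<..<1}"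
  shows "with_high_probability sparsity_condition (\<lambda>n p G.
       (MAX k\<in>{1..nat \<lfloor>real n powr (1 - \<epsilon>)\<rfloor>}.
          \<bar>ordered_eigenvalue k (adjacency_matrix n G) - sqrt (ordered_degree n G k)\<bar>)
         \<le> 100000 * sqrt (real n * p_max n p) + \<epsilon> * sqrt (L1 n p) + d_max n p \<and>
       (MAX k\<in>{1..nat \<lfloor>real n powr (1 - \<epsilon>)\<rfloor>}.
          \<bar>ordered_eigenvalue (n + 1 - k) (adjacency_matrix n G) + sqrt (ordered_degree n G k)\<bar>)
         \<le> 100000 * sqrt (real n * p_max n p) + \<epsilon> * sqrt (L1 n p) + d_max n p)"
    (is "with_high_probability _ ?E")
proof (rule with_high_probabilityI)
  fix \<kappa> e :: real assume \<kappa>: "\<kappa> > 0" and e: "e > 0"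
  \<comment> \<open>The error terms amount to 43200 + 1 + 1 multiples of sqrt (\<delta> L): from the
    norm bound, from the additive 1 (as sqrt (\<delta> L) \<ge> 1), and from the threshold. This
    choice makes them equal to \<epsilon> sqrt L.\<close>
  define \<delta> where "\<delta> = (\<epsilon> / 43202)\<^sup>2"
  have \<delta>: "\<delta> > 0" "sqrt \<delta> = \<epsilon> / 43202" using \<epsilon> by (simp_all add: \<delta>_def)
  obtain r :: nat where r0: "16 / \<delta> < real r" using reals_Archimedean2 by blast
  have "0 < 16 / \<delta>" using \<delta> by simp
  then have r1: "1 \<le> r" using r0 by (cases r) auto
  have r16: "16 \<le> real r * \<delta>" using r0 \<delta> by (simp add: field_simps)
  define bad :: "nat \<Rightarrow> real" where "bad n = (exp (- 2 * real n) + 1 / real n) +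
      ((real n powr (- 1 / 2) + (real n powr (- 1) * sqrt (ln (real n) / \<kappa>) ^ (r * (r + 1)) +
        real n powr (- 1) * sqrt (ln (real n) / \<kappa>) ^ (r * (2 * r + 1)))) +
      (real n powr (- 1 / 4) * sqrt (ln (real n) / \<kappa>) + real n powr (- \<delta> / 8) * sqrt (ln (real n) / \<kappa>)))" for n
  have poly: "((\<lambda>n::nat. real n powr (- 1) * sqrt (ln (real n) / \<kappa>) ^ m) \<longlongrightarrow> 0) at_top" for m :: nat
    using \<kappa> by real_asymp
  have "(bad \<longlongrightarrow> (0 + 0) + ((0 + (0 + 0)) + (0 + 0))) at_top"
    unfolding bad_def by (intro tendsto_add poly) (use \<kappa> \<delta> in real_asymp)+
  then have "(bad \<longlongrightarrow> 0) at_top" by simp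
  then have "eventually (\<lambda>n. bad n < e) at_top"
    using e by (rule order_tendstoD)
  \<comment> \<open>A single bound provides both L \<ge> 1 and 3 r \<le> \<delta> L.\<close>
  moreover have "eventually (\<lambda>n::nat. 1 + 3 * real r / \<delta> \<le> ln (real n) / ln (ln (real n) / \<kappa>)) at_top"
    using \<kappa> by real_asymp
  moreover have "eventually (\<lambda>n::nat. 6 * ln (real n) * real n powr (1 - \<delta> / 4) \<le> real n) at_top"
    using \<delta> by real_asymp
  \<comment> \<open>The ranks considered and the centres together must not exceed n, so that the
    lower bound on eigenvalues reaches all these ranks.\<close>
  moreover have "eventually (\<lambda>n::nat. real n powr (1 - \<epsilon>) + real n powr (1 - \<delta> / 4) \<le> real n) at_top"
  proof -
    have "((\<lambda>n::nat. real n powr (- \<epsilon>) + real n powr (- \<delta> / 4)) \<longlongrightarrow> 0 + 0) at_top"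
      by (intro tendsto_add) (use \<epsilon> \<delta> in real_asymp)+
    then have "eventually (\<lambda>n::nat. real n powr (- \<epsilon>) + real n powr (- \<delta> / 4) < 1) at_top"
      by (intro order_tendstoD) auto
    then show ?thesis
      using eventually_gt_at_top[of 0]
    proof eventually_elim
      case (elim n)
      have "real n powr (1 - \<epsilon>) + real n powr (1 - \<delta> / 4) = real n * (real n powr (- \<epsilon>) + real n powr (- \<delta> / 4))"
        using elim(2) by (simp add: distrib_left powr_mult_base)
      also have "\<dots> \<le> real n * 1" using elim(1) by (intro mult_left_mono) auto
      finally show ?case by simp
    qed
  qed
  moreover have "eventually (\<lambda>n::nat. n \<ge> 2) at_top" by (rule eventually_ge_at_top)
  ultimately have "eventually (\<lambda>n::nat. bad n < e \<and> 1 + 3 * real r / \<delta> \<le> ln (real n) / ln (ln (real n) / \<kappa>) \<and>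
      6 * ln (real n) * real n powr (1 - \<delta> / 4) \<le> real n \<and>
      real n powr (1 - \<epsilon>) + real n powr (1 - \<delta> / 4) \<le> real n \<and> n \<ge> 2) at_top"
    by eventually_elim auto
  then obtain N :: nat where N: "\<And>n. n \<ge> N \<Longrightarrow> bad n < e"
    "\<And>n. n \<ge> N \<Longrightarrow> 1 + 3 * real r / \<delta> \<le> ln (real n) / ln (ln (real n) / \<kappa>)"
    "\<And>n. n \<ge> N \<Longrightarrow> 6 * ln (real n) * real n powr (1 - \<delta> / 4) \<le> real n"
    "\<And>n. n \<ge> N \<Longrightarrow> real n powr (1 - \<epsilon>) + real n powr (1 - \<delta> / 4) \<le> real n"
    "\<And>n. n \<ge> N \<Longrightarrow> n \<ge> 2"
    unfolding eventually_at_top_linorder by blast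
  \<comment> \<open>The second entry gives sqrt \<eta> \<le> \<delta>/16, which is why the error
    function may depend on \<epsilon>.\<close>
  define \<eta>0 where "\<eta>0 = min (1 / 16) ((\<delta> / 16)\<^sup>2)"
  show "\<exists>N. \<exists>\<eta>0>0. \<forall>n\<ge>N. \<forall>\<eta> p. 0 < \<eta> \<longrightarrow> \<eta> < \<eta>0 \<longrightarrow>
      edge_probabilities n p \<longrightarrow> sparsity_condition n \<kappa> \<eta> p \<longrightarrow> 1 - e \<le> measure_pmf.prob (random_graph n p) {G. ?E n p G}"
  proof (rule exI[of _ N], rule exI[of _ \<eta>0], intro conjI allI impI)
    show "0 < \<eta>0" using \<delta> by (simp add: \<eta>0_def)
    fix n \<eta> p assume nN: "n \<ge> N" and \<eta>N: "0 < \<eta>" "\<eta> < \<eta>0" and p: "edge_probabilities n p" "sparsity_condition n \<kappa> \<eta> p"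
    interpret sparse_parameters n \<kappa> \<eta> p
      by unfold_locales (use N(5)[OF nN] \<eta>N p \<kappa> in \<open>auto simp: \<eta>0_def\<close>)
    have "\<eta> \<le> (\<delta> / 16)\<^sup>2" using \<eta>N(2) unfolding \<eta>0_def by linarith
    then have sqrt_\<eta>: "sqrt \<eta> \<le> \<delta> / 16"
      by (intro real_le_lsqrt) (use \<eta> \<delta> in auto)
    have "1 + 3 * real r / \<delta> \<le> L" using L_bounds(3) N(2)[OF nN] by linarith
    moreover have "0 \<le> 3 * real r / \<delta>" using \<delta> by simp
    ultimately have L1: "1 \<le> L" and "3 * real r / \<delta> \<le> L" by linarith+
    then have rL: "3 * real r \<le> \<delta> * L" using \<delta> by (simp add: field_simps)
    have pm: "0 \<le> real n * p_max n p" using p_max_bounds(2)[OF p(1)] N(5)[OF nN] by simp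
    define D where "D = \<delta> * L + real n * p_max n p"
    have D0: "D > 0" using L1 pm \<delta> by (simp add: D_def add_pos_nonneg)
    have np: "real n * p i j \<le> D" if "i < j" "j < n" for i j
      unfolding D_def using that L1 \<delta> by (intro np_le) auto
    define B where "B = real n powr (1 - \<delta> / 4)"
    have LB: "6 * L * B \<le> real n"
    proof -
      have "6 * L * B \<le> 6 * ln (real n) * B" using L_bounds(2) by (intro mult_right_mono) (auto simp: B_def)
      then show ?thesis using N(3)[OF nN] by (simp add: B_def)
    qed
    let ?Q1 = "\<lambda>G. \<not> quasirandom n p D G" and ?Q2 = "\<lambda>G. \<not> high_vertices_spread n G (\<delta> * L) r"
    let ?Q3 = "\<lambda>G. \<exists>i\<in>{..<n}. 3 * L \<le> vertex_degree n G i" and ?Q4 = "\<lambda>G. B \<le> real (card (high_vertices n G (\<delta> * L)))"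
    let ?P = "\<lambda>Q. measure_pmf.prob (random_graph n p) {G. Q G}"
    have "?P (\<lambda>G. ?Q1 G \<or> ?Q2 G \<or> ?Q3 G \<or> ?Q4 G) \<le> ?P ?Q1 + (?P ?Q2 + (?P ?Q3 + ?P ?Q4))"
      by (intro order_trans[OF prob_Un_le] add_left_mono order_refl)
    also have "\<dots> \<le> bad n"
      unfolding bad_def
    proof (intro add_mono[of "?P ?Q1"] add_mono[of "?P ?Q2"] add_mono[of "?P ?Q3"])
      show "?P ?Q1 \<le> exp (- 2 * real n) + 1 / real n"
        by (rule prob_not_quasirandom[OF p(1) D0 _ np]) (use N(5)[OF nN] in auto)
      show "?P ?Q2 \<le> real n powr (- 1 / 2) + (real n powr (- 1) * sqrt (ln (real n) / \<kappa>) ^ (r * (r + 1)) +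
        real n powr (- 1) * sqrt (ln (real n) / \<kappa>) ^ (r * (2 * r + 1)))"
        by (rule prob_not_spread[OF sqrt_\<eta> r16])
      show "?P ?Q3 \<le> real n powr (- 1 / 4) * sqrt (ln (real n) / \<kappa>)" by (rule prob_max_degree_ge)
      show "?P ?Q4 \<le> real n powr (- \<delta> / 8) * sqrt (ln (real n) / \<kappa>)"
        unfolding B_def by (rule prob_many_high_vertices[OF sqrt_\<eta> \<delta>(1)])
    qed
    also have "\<dots> \<le> e" using N(1)[OF nN] by simp
    finally have bad_le: "?P (\<lambda>G. ?Q1 G \<or> ?Q2 G \<or> ?Q3 G \<or> ?Q4 G) \<le> e" .
    show "1 - e \<le> measure_pmf.prob (random_graph n p) {G. ?E n p G}"
    proof (rule prob_ge_of_prob_not_le[OF _ bad_le])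
      fix G assume G: "\<not> (?Q1 G \<or> ?Q2 G \<or> ?Q3 G \<or> ?Q4 G)"
      let ?R = "100000 * sqrt (real n * p_max n p) + \<epsilon> * sqrt L + d"
      have fin: "43200 * sqrt D + 1 + d + sqrt (\<delta> * L) \<le> ?R"
      proof -
        have "sqrt D \<le> sqrt (\<delta> * L) + sqrt (real n * p_max n p)"
          unfolding D_def using L1 pm \<delta> by (intro sqrt_add_le_add_sqrt) auto
        moreover have "1 \<le> sqrt (\<delta> * L)" using rL r1 by simp
        moreover have "43202 * sqrt (\<delta> * L) = \<epsilon> * sqrt L" by (simp add: real_sqrt_mult \<delta>(2))
        moreover have "0 \<le> sqrt (real n * p_max n p)" using pm by simp
        ultimately show ?thesis by linarith
      qed
      have main: "\<bar>eigval k n (\<lambda>i j. \<sigma> * adj G i j) - sqrt (ordered_degree n G k)\<bar> \<le> ?R"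
        if k: "k \<in> {1..nat \<lfloor>real n powr (1 - \<epsilon>)\<rfloor>}" and \<sigma>: "\<bar>\<sigma>\<bar> = 1" for k \<sigma>
      proof -
        have "real k \<le> real n powr (1 - \<epsilon>)" using k by (auto simp: le_nat_iff le_floor_iff)
        then have "real k + B \<le> real n" using N(4)[OF nN] by (simp add: B_def)
        then have "\<bar>eigval k n (\<lambda>i j. \<sigma> * adj G i j) - sqrt (ordered_degree n G k)\<bar> \<le> 43200 * sqrt D + 1 + d + sqrt (\<delta> * L)"
          by (intro spectrum_near_stars[OF D_def \<delta>(1) _ _ _ r1 rL _ LB _ _ \<sigma>])
            (use G k in \<open>auto simp: not_le less_imp_le\<close>)
        then show ?thesis using fin by linarith
      qed
      have kn: "k \<in> {1..n}" if "k \<in> {1..nat \<lfloor>real n powr (1 - \<epsilon>)\<rfloor>}" for k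
      proof -
        have "real k \<le> real n powr (1 - \<epsilon>)" using that by (auto simp: le_nat_iff le_floor_iff)
        also have "\<dots> \<le> real n" using N(4)[OF nN] powr_ge_zero[of "real n" "1 - \<delta> / 4"] by linarith
        finally show ?thesis using that by simp
      qed
      have symm: "symm n (adj G)" by (simp add: symm_def adj_symm)
      \<comment> \<open>The range of ranks has to be nonempty for the maximum to be
        meaningful.\<close>
      have "1 \<le> real n powr (1 - \<epsilon>)" using N(5)[OF nN] \<epsilon> by (intro ge_one_powr_ge_zero) auto
      then have "1 \<in> {1..nat \<lfloor>real n powr (1 - \<epsilon>)\<rfloor>}" by (simp add: le_nat_iff le_floor_iff)
      then have ne: "{1..nat \<lfloor>real n powr (1 - \<epsilon>)\<rfloor>} \<noteq> {}" by blast
      have Max_le: "(MAX k\<in>{1..nat \<lfloor>real n powr (1 - \<epsilon>)\<rfloor>}. g k) \<le> ?R"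
        if "\<And>k. k \<in> {1..nat \<lfloor>real n powr (1 - \<epsilon>)\<rfloor>} \<Longrightarrow> g k \<le> ?R" for g :: "nat \<Rightarrow> real"
        by (rule Max.boundedI) (use ne that in auto)
      show "?E n p G"
      proof (intro conjI Max_le)
        fix k assume k: "k \<in> {1..nat \<lfloor>real n powr (1 - \<epsilon>)\<rfloor>}"
        show "\<bar>ordered_eigenvalue k (adjacency_matrix n G) - sqrt (ordered_degree n G k)\<bar> \<le> ?R"
          using main[OF k, of 1] by (simp add: adjacency_matrix_adj)
        have "ordered_eigenvalue (n + 1 - k) (adjacency_matrix n G) = - eigval k n (\<lambda>i j. - adj G i j)"
          unfolding adjacency_matrix_adj by (rule eigval_uminus[OF symm kn[OF k]])
        then show "\<bar>ordered_eigenvalue (n + 1 - k) (adjacency_matrix n G) + sqrt (ordered_degree n G k)\<bar> \<le> ?R"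
          using main[OF k, of "- 1"] by (simp add: abs_minus_commute)
      qed
    qed
  qed
qed

theorem corollary1p7:
  shows "\<exists>C>0::real.
    (\<forall>\<epsilon>\<in>{0<..<1}. with_high_probability sparsity_condition (\<lambda>n p G.
       (MAX k\<in>{1..nat \<lfloor>real n powr (1 - \<epsilon>)\<rfloor>}.
          \<bar>ordered_eigenvalue k (adjacency_matrix n G) - sqrt (ordered_degree n G k)\<bar>)
         \<le> C * sqrt (real n * p_max n p) + \<epsilon> * sqrt (L1 n p) + d_max n p \<and>
       (MAX k\<in>{1..nat \<lfloor>real n powr (1 - \<epsilon>)\<rfloor>}.
          \<bar>ordered_eigenvalue (n + 1 - k) (adjacency_matrix n G) + sqrt (ordered_degree n G k)\<bar>)
         \<le> C * sqrt (real n * p_max n p) + \<epsilon> * sqrt (L1 n p) + d_max n p)) \<and>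
    with_high_probability sparsity_condition (\<lambda>n p G.
       \<forall>k\<in>{1..n}.
         \<bar>ordered_eigenvalue k (adjacency_matrix n G)
            - ordered_eigenvalue k (expected_adjacency_matrix n p)\<bar>
           \<le> C * (sqrt (L1 n p) + sqrt (real n * p_max n p)))"
  using with_high_probability_stars with_high_probability_mean
  by (intro exI[of _ 100000] conjI ballI) auto

end
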